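(* Consider the infinite-dimensional setting and the greedy subspace procedure described in the context, with $$\widetilde\delta:=\min_{\mu\in\mathcal D}\lambda_{r+1}(\mu)-\max_{\mu\in\mathcal D}\lambda_r(\mu)>0 .$$ For every $\zeta>0$ there is a threshold $h_0>0$, depending only on the operators $A_m$, the functions $\theta_m$, $\mathcal D$, $\ell$, $r$ and $\zeta$, such that the following holds. Suppose the procedure is initialized with the points of a uniform grid for $\mathcal D$ of spacing at most $h_0$ and generates a sequence of points $\{\mu_j\}$ and a sequence of subspaces $\{\mathcal V_j\}$ such that (i) $H^{(j+1)}(\mu)\le H^{(j)}(\mu)$ for every $\mu\in\mathcal D$ and every integer $j\ge1$; (ii) $\sigma_{\min}(\Theta^{(j)}(\mu))>\zeta$ for all $\mu\in\mathcal D$ and all $j\ge1$. Then $$\lim_{j\to\infty}\overline{\mathcal E}^{(j)}=\lim_{j\to\infty}\mathcal E^{(j)}(\mu_{j+1})=\lim_{j\to\infty}H^{(j)}(\mu_{j+1})=0,$$ where $\mathcal E^{(j)}(\mu)=\lambda^{\mathcal V_j}_{\min}(\mu)-\lambda_{\min}(\mu)$ and $\overline{\mathcal E}^{(j)}=\max_{\mu\in\mathcal D}\mathcal E^{(j)}(\mu)$.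
   Context: Setting. $\mathcal D\subset\mathbb R^p$ is compact; $A_1,\dots,A_\kappa:\ell^2(\mathbb N)\to\ell^2(\mathbb N)$ are compact self-adjoint operators; $\theta_1,\dots,\theta_\kappa:\mathbb R^p\to\mathbb R$ are real analytic; $\theta(\mu)=[\theta_1(\mu),\dots,\theta_\kappa(\mu)]^T$; $A(\mu)=\sum_{m=1}^\kappa\theta_m(\mu)A_m$. It is assumed that $A(\mu)$ has a negative eigenvalue for every $\mu$. $\lambda_k(\mu)$ denotes the $k$-th smallest eigenvalue of $A(\mu)$ counted with multiplicity (assumed to exist whenever it is used), and $\lambda_{\min}(\mu)=\lambda_1(\mu)$. Integers $1\le r\le\ell$ are fixed. $\|\cdot\|$ is the operator norm. Bounds from a finite point set. For $j\ge1$ let $P_j\subset\mathcal D$ be a finite set. For $\nu\in P_j$ let $v_1(\nu),\dots,v_\ell(\nu)$ be orthonormal eigenvectors of $A(\nu)$ for $\lambda_1(\nu),\dots,\lambda_\ell(\nu)$; $\Lambda^{(\nu)}=\mathrm{diag}(\lambda_1(\nu),\dots,\lambda_\ell(\nu))$; $V^{(\nu)}:\mathbb C^\ell\to\ell^2(\mathbb N)$, $V^{(\nu)}x=\sum_kx_kv_k(\nu)$. Put $\mathcal V_j=\mathrm{span}\{v_k(\nu):\nu\in P_j,1\le k\le\ell\}$, $d=\dim\mathcal V_j$, $V_j:\mathbb C^d\to\ell^2(\mathbb N)$ a linear isometry with range $\mathcal V_j$, $A^{V_j}(\mu)=V_j^*A(\mu)V_j$; $\lambda^{\mathcal V_j}_k(\mu)$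 is the $k$-th smallest eigenvalue of $A^{V_j}(\mu)$, $\lambda^{\mathcal V_j}_{\min}=\lambda^{\mathcal V_j}_1$, and $w^{V_j}_1(\mu),\dots,w^{V_j}_r(\mu)$ are orthonormal eigenvectors for the $r$ smallest eigenvalues. Let $U_j(\mu):\mathbb C^r\to\ell^2(\mathbb N)$, $U_j(\mu)x=\sum_{k=1}^rx_kV_jw^{V_j}_k(\mu)$. Define - $\rho^{(j)}(\mu)=\|(I-U_j(\mu)U_j(\mu)^* )A(\mu)U_j(\mu)\|$; - for $\nu\in P_j$, $\beta^{(\nu,j)}(\mu)=\lambda_{\min}\big(\Lambda^{(\nu)}-\lambda_1(\nu)I_\ell-[V^{(\nu)}]^*U_j(\mu)U_j(\mu)^*V^{(\nu)}(\Lambda^{(\nu)}-\lambda_{\ell+1}(\nu)I_\ell)\big)$ (smallest eigenvalue of an $\ell\times\ell$ matrix with real eigenvalues); - $\mathcal B=\prod_{m=1}^\kappa[\lambda_{\min}(A_m),\lambda_{\max}(A_m)]$, the endpoints being the infimum and supremum of the Rayleigh quotients of $A_m$; - $\mathcal Y^{(j)}_{\mathrm{LB}}(\mu)=\{y\in\mathcal B:\theta(\nu)^Ty\ge\lambda_1(\nu)+\beta^{(\nu,j)}(\mu)\ \forall\nu\in P_j\}$; - $\eta^{(j)}_*(\mu)=\min\{\theta(\mu)^Ty:y\in\mathcal Y^{(j)}_{\mathrm{LB}}(\mu)\}$, with minimizer $y^{(j)}(\mu)$; - $$\lambda^{(j)}_{\mathrm{LB}}(\mu)=\min\{\lambda^{\mathcal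 V_j}_1(\mu),\eta^{(j)}_*(\mu)\}-\frac{2\rho^{(j)}(\mu)^2}{|\lambda^{\mathcal V_j}_1(\mu)-\eta^{(j)}_*(\mu)|+\sqrt{(\lambda^{\mathcal V_j}_1(\mu)-\eta^{(j)}_*(\mu))^2+4\rho^{(j)}(\mu)^2}}$$ (fraction equal to $0$ if it reads $0/0$); - $H^{(j)}(\mu)=\lambda^{\mathcal V_j}_{\min}(\mu)-\lambda^{(j)}_{\mathrm{LB}}(\mu)$. Matrix $\Theta^{(j)}(\mu)$. The minimizer $y^{(j)}(\mu)$ is taken to be one at which $\kappa$ linearly independent constraints of the linear program are active. The rows of $\Theta^{(j)}(\mu)\in\mathbb R^{\kappa\times\kappa}$ are the normals ($\theta(\nu)^T$ for a constraint of $\nu\in P_j$, $\mathbf e_m^T$ for a box constraint) of $\kappa$ linearly independent constraints active at $y^{(j)}(\mu)$; if several choices are possible, the one maximizing the smallest singular value $\sigma_{\min}(\Theta^{(j)}(\mu))$ is taken. Greedy subspace procedure. Choose initial points $\mu_{1,1},\dots,\mu_{1,N}\in\mathcal D$, $P_1=\{\mu_{1,1},\dots,\mu_{1,N}\}$. For $j=1,2,\dots$, let $\mu_{j+1}$ be a maximizer of $H^{(j)}$ over $\mathcal D$ and $P_{j+1}=P_j\cup\{\mu_{j+1}\}$. The procedure is run indefinitely (no termination). A uniform grid for $\mathcal D$ of spacing at most $h$ is a finite set of points of $\mathcal D$ lying on an axis-parallel uniform lattice with adjacent points at distance at most $h$, such that every point of $\mathcal D$ lies in a closed axis-parallel cube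 of side $h$ centred at a grid point. *)

theory Defs
  imports "HOL-Analysis.Analysis" "HOL-Library.Extended_Nat" "Jordan_Normal_Form.Char_Poly"
begin

no_notation Matrix.vec_index (infixl "$" 100)
no_notation Matrix.scalar_prod (infix "\<bullet>" 70)

typedef ell2 = "{f :: nat \<Rightarrow> complex. summable (\<lambda>n. (cmod (f n))\<^sup>2)}"
  morphisms coord Abs_ell2
  by (intro exI[of _ "\<lambda>_. 0"]) simp

setup_lifting type_definition_ell2

lemma summable_coord: "summable (\<lambda>n. (cmod (coord x n))\<^sup>2)"
  using coord[of x] by simp

lemma ell2_eqI: "(\<And>n. coord x n = coord y n) \<Longrightarrow> x = y"
  by (metis coord_inject ext)

lemma sq_summable_add:
  assumes "summable (\<lambda>n. (cmod (f n))\<^sup>2)" "summable (\<lambda>n. (cmod (g n))\<^sup>2)"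
  shows "summable (\<lambda>n. (cmod (f n + g n))\<^sup>2)"
proof (rule summable_comparison_test')
  show "summable (\<lambda>n. 2 * (cmod (f n))\<^sup>2 + 2 * (cmod (g n))\<^sup>2)"
    by (intro summable_add summable_mult assms)
  fix n :: nat
  have "(cmod (f n + g n))\<^sup>2 \<le> (cmod (f n) + cmod (g n))\<^sup>2"
    by (intro power_mono norm_triangle_ineq) simp
  also have "\<dots> \<le> 2 * (cmod (f n))\<^sup>2 + 2 * (cmod (g n))\<^sup>2"
    using zero_le_power2[of "cmod (f n) - cmod (g n)"] by (simp add: power2_eq_square algebra_simps)
  finally show "norm ((cmod (f n + g n))\<^sup>2) \<le> 2 * (cmod (f n))\<^sup>2 + 2 * (cmod (g n))\<^sup>2"
    by simp
qed

lemma sq_summable_scale: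
  assumes "summable (\<lambda>n. (cmod (f n))\<^sup>2)"
  shows "summable (\<lambda>n. (cmod (c * f n))\<^sup>2)"
  using summable_mult[OF assms, of "(cmod c)\<^sup>2"] by (simp add: norm_mult power_mult_distrib)

lemma summable_coord_prod: "summable (\<lambda>n. cnj (coord x n) * coord y n)"
proof (rule summable_comparison_test')
  show "summable (\<lambda>n. (cmod (coord x n))\<^sup>2 + (cmod (coord y n))\<^sup>2)"
    by (intro summable_add summable_coord)
  fix n :: nat
  have "2 * (cmod (coord x n) * cmod (coord y n)) \<le> (cmod (coord x n))\<^sup>2 + (cmod (coord y n))\<^sup>2"
    using zero_le_power2[of "cmod (coord x n) - cmod (coord y n)"]
    by (simp add: power2_eq_square algebra_simps)
  moreover have "0 \<le> cmod (coord x n) * cmod (coord y n)" by simp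
  ultimately show "norm (cnj (coord x n) * coord y n) \<le> (cmod (coord x n))\<^sup>2 + (cmod (coord y n))\<^sup>2"
    unfolding norm_mult complex_mod_cnj by linarith
qed

instantiation ell2 :: ab_group_add
begin
lift_definition zero_ell2 :: ell2 is "\<lambda>_. 0" by simp
lift_definition plus_ell2 :: "ell2 \<Rightarrow> ell2 \<Rightarrow> ell2" is "\<lambda>f g n. f n + g n"
  by (rule sq_summable_add)
lift_definition uminus_ell2 :: "ell2 \<Rightarrow> ell2" is "\<lambda>f n. - f n" by simp
lift_definition minus_ell2 :: "ell2 \<Rightarrow> ell2 \<Rightarrow> ell2" is "\<lambda>f g n. f n - g n"
proof -
  fix f g :: "nat \<Rightarrow> complex"
  assume "summable (\<lambda>n. (cmod (f n))\<^sup>2)" "summable (\<lambda>n. (cmod (g n))\<^sup>2)"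
  then show "summable (\<lambda>n. (cmod (f n - g n))\<^sup>2)"
    using sq_summable_add[of f "\<lambda>n. - g n"] by simp
qed
instance by standard (transfer; simp add: fun_eq_iff)+
end

lift_definition scaleC :: "complex \<Rightarrow> ell2 \<Rightarrow> ell2" (infixr "*\<^sub>C" 75) is "\<lambda>c f n. c * f n"
  by (rule sq_summable_scale)

definition cinner :: "ell2 \<Rightarrow> ell2 \<Rightarrow> complex" where
  "cinner x y = (\<Sum>n. cnj (coord x n) * coord y n)"

instantiation ell2 :: real_inner
begin
definition scaleR_ell2 :: "real \<Rightarrow> ell2 \<Rightarrow> ell2" where "scaleR_ell2 a x = complex_of_real a *\<^sub>C x"
definition inner_ell2 :: "ell2 \<Rightarrow> ell2 \<Rightarrow> real" where "inner_ell2 x y = Re (cinner x y)"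
definition norm_ell2 :: "ell2 \<Rightarrow> real" where "norm_ell2 x = sqrt (inner x x)"
definition sgn_ell2 :: "ell2 \<Rightarrow> ell2" where "sgn_ell2 x = inverse (norm x) *\<^sub>R x"
definition dist_ell2 :: "ell2 \<Rightarrow> ell2 \<Rightarrow> real" where "dist_ell2 x y = norm (x - y)"
definition uniformity_ell2 :: "(ell2 \<times> ell2) filter" where
  "uniformity_ell2 = (INF e\<in>{0<..}. principal {(x, y). dist x y < e})"
definition open_ell2 :: "ell2 set \<Rightarrow> bool" where
  "open_ell2 U \<longleftrightarrow> (\<forall>x\<in>U. eventually (\<lambda>(x', y). x' = x \<longrightarrow> y \<in> U) uniformity)"

lemma inner_self_ell2: "inner x x = (\<Sum>n. (cmod (coord x n))\<^sup>2)" for x :: ell2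
proof -
  have "inner x x = (\<Sum>n. Re (cnj (coord x n) * coord x n))"
    unfolding inner_ell2_def cinner_def using summable_coord_prod by (rule Re_suminf)
  also have "\<dots> = (\<Sum>n. (cmod (coord x n))\<^sup>2)"
    unfolding cmod_power2 by (simp add: power2_eq_square)
  finally show ?thesis .
qed

instance
proof
  fix x y z :: ell2 and a b :: real
  show "a *\<^sub>R (x + y) = a *\<^sub>R x + a *\<^sub>R y" "(a + b) *\<^sub>R x = a *\<^sub>R x + b *\<^sub>R x"
    "a *\<^sub>R b *\<^sub>R x = (a * b) *\<^sub>R x" "1 *\<^sub>R x = x"
    unfolding scaleR_ell2_def by (transfer; simp add: algebra_simps fun_eq_iff)+
  show "dist x y = norm (x - y)" by (rule dist_ell2_def)
  show "sgn x = inverse (norm x) *\<^sub>R x" by (rule sgn_ell2_def)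
  show "(uniformity :: (ell2 \<times> ell2) filter) = (INF e\<in>{0<..}. principal {(x, y). dist x y < e})"
    by (rule uniformity_ell2_def)
  show "norm x = sqrt (inner x x)" by (rule norm_ell2_def)
  show "open U \<longleftrightarrow> (\<forall>x\<in>U. eventually (\<lambda>(x', y). x' = x \<longrightarrow> y \<in> U) uniformity)" for U :: "ell2 set"
    by (rule open_ell2_def)
  show "inner x y = inner y x"
  proof -
    have "inner x y = (\<Sum>n. Re (cnj (coord x n) * coord y n))"
      unfolding inner_ell2_def cinner_def using summable_coord_prod by (rule Re_suminf)
    also have "\<dots> = (\<Sum>n. Re (cnj (coord y n) * coord x n))"
      by (simp add: mult.commute)
    also have "\<dots> = inner y x"
      unfolding inner_ell2_def cinner_def using summable_coord_prod by (rule Re_suminf[symmetric])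
    finally show ?thesis .
  qed
  have "cinner (x + y) z = cinner x z + cinner y z"
    unfolding cinner_def
    by (simp add: plus_ell2.rep_eq distrib_right suminf_add summable_coord_prod)
  then show "inner (x + y) z = inner x z + inner y z"
    by (simp add: inner_ell2_def)
  have "cinner (a *\<^sub>R x) y = a * cinner x y"
    unfolding cinner_def
    by (simp add: scaleR_ell2_def scaleC.rep_eq mult.assoc suminf_mult summable_coord_prod)
  then show "inner (a *\<^sub>R x) y = a * inner x y"
    by (simp add: inner_ell2_def)
  show "0 \<le> inner x x"
    unfolding inner_self_ell2 by (rule suminf_nonneg[OF summable_coord]) simp
  have "inner x x = 0 \<longleftrightarrow> (\<forall>n. coord x n = 0)"
    unfolding inner_self_ell2 by (subst suminf_eq_zero_iff[OF summable_coord]) simp_all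
  also have "\<dots> \<longleftrightarrow> x = 0"
    by (auto simp: zero_ell2.rep_eq intro: ell2_eqI)
  finally show "inner x x = 0 \<longleftrightarrow> x = 0" .
qed
end

interpretation ell2C: vector_space scaleC
  by unfold_locales (transfer; simp add: algebra_simps fun_eq_iff)+

definition compact_selfadjoint :: "(ell2 \<Rightarrow> ell2) \<Rightarrow> bool" where
  "compact_selfadjoint T \<longleftrightarrow>
     (\<forall>x y. T (x + y) = T x + T y) \<and> (\<forall>c x. T (c *\<^sub>C x) = c *\<^sub>C T x) \<and>
     compact (closure (T ` cball 0 1)) \<and>
     (\<forall>x y. cinner (T x) y = cinner x (T y))"

definition eigenspace :: "(ell2 \<Rightarrow> ell2) \<Rightarrow> real \<Rightarrow> ell2 set" where
  "eigenspace T t = {x. T x = t *\<^sub>R x}"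

(* Dimension of the eigenspace over the complex numbers, possibly infinite. *)
definition eig_mult :: "(ell2 \<Rightarrow> ell2) \<Rightarrow> real \<Rightarrow> enat" where
  "eig_mult T t =
     (SUP B\<in>{B. finite B \<and> B \<subseteq> eigenspace T t \<and> ell2C.independent B}. enat (card B))"

(* Number of eigenvalues lying in S, counted with multiplicity. *)
definition eig_count :: "(ell2 \<Rightarrow> ell2) \<Rightarrow> real set \<Rightarrow> enat" where
  "eig_count T S = (SUP F\<in>{F. finite F \<and> F \<subseteq> S}. \<Sum>t\<in>F. eig_mult T t)"

(* For k >= 1 at most one t satisfies this. None does if T has fewer than k eigenvalues or if
   its eigenvalues, listed increasingly, accumulate from above before the k-th is reached. *)
definition is_kth_eig :: "(ell2 \<Rightarrow> ell2) \<Rightarrow> nat \<Rightarrow> real \<Rightarrow> bool" where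
  "is_kth_eig T k t \<longleftrightarrow> eig_count T {..<t} < enat k \<and> enat k \<le> eig_count T {..t}"

definition kth_eig :: "(ell2 \<Rightarrow> ell2) \<Rightarrow> nat \<Rightarrow> real" where
  "kth_eig T k = (THE t. is_kth_eig T k t)"

definition rayleigh_min :: "(ell2 \<Rightarrow> ell2) \<Rightarrow> real" where
  "rayleigh_min T = (INF x\<in>-{0}. inner x (T x) / (norm x)\<^sup>2)"

definition rayleigh_max :: "(ell2 \<Rightarrow> ell2) \<Rightarrow> real" where
  "rayleigh_max T = (SUP x\<in>-{0}. inner x (T x) / (norm x)\<^sup>2)"

definition cvec_norm :: "complex Matrix.vec \<Rightarrow> real" where
  "cvec_norm x = sqrt (Re (x \<bullet>c x))"

(* Vector indices start at 0, whereas the families of vectors below are indexed from 1. *)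
definition frame :: "nat \<Rightarrow> (nat \<Rightarrow> ell2) \<Rightarrow> complex Matrix.vec \<Rightarrow> ell2" where
  "frame n f x = (\<Sum>k\<in>{1..n}. vec_index x (k - 1) *\<^sub>C f k)"

definition isometry_onto :: "nat \<Rightarrow> (complex Matrix.vec \<Rightarrow> ell2) \<Rightarrow> ell2 set \<Rightarrow> bool" where
  "isometry_onto n V S \<longleftrightarrow>
     (\<forall>x\<in>carrier_vec n. \<forall>y\<in>carrier_vec n. V (x + y) = V x + V y) \<and>
     (\<forall>c. \<forall>x\<in>carrier_vec n. V (c \<cdot>\<^sub>v x) = c *\<^sub>C V x) \<and>
     (\<forall>x\<in>carrier_vec n. norm (V x) = cvec_norm x) \<and>
     V ` carrier_vec n = S"

definition adj :: "nat \<Rightarrow> (complex Matrix.vec \<Rightarrow> ell2) \<Rightarrow> ell2 \<Rightarrow> complex Matrix.vec" where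
  "adj n V x = Matrix.vec n (\<lambda>i. cinner (V (unit_vec n i)) x)"

definition mat_of_map :: "nat \<Rightarrow> (complex Matrix.vec \<Rightarrow> complex Matrix.vec) \<Rightarrow> complex Matrix.mat" where
  "mat_of_map n f = Matrix.mat n n (\<lambda>(a, b). vec_index (f (unit_vec n b)) a)"

definition op_norm :: "nat \<Rightarrow> (complex Matrix.vec \<Rightarrow> ell2) \<Rightarrow> real" where
  "op_norm n T = (SUP x\<in>{x \<in> carrier_vec n. cvec_norm x \<le> 1}. norm (T x))"

(* Used only for matrices all of whose eigenvalues are real. *)
definition mat_eig :: "complex Matrix.mat \<Rightarrow> nat \<Rightarrow> real" where
  "mat_eig M k = sorted_list_of_multiset (image_mset Re (proots (char_poly M))) ! (k - 1)"

definition real_analytic :: "(real^'p \<Rightarrow> real) \<Rightarrow> bool" where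
  "real_analytic f \<longleftrightarrow>
     (\<forall>x. \<exists>e>0. \<exists>c :: ('p \<Rightarrow> nat) \<Rightarrow> real. \<forall>y. dist y x < e \<longrightarrow>
        ((\<lambda>\<alpha>. c \<alpha> * (\<Prod>i\<in>UNIV. (y $ i - x $ i) ^ \<alpha> i)) has_sum f y) UNIV)"

(* The lattice may have a different step in each coordinate direction. *)
definition uniform_grid :: "(real^'p) set \<Rightarrow> real \<Rightarrow> (real^'p) set \<Rightarrow> bool" where
  "uniform_grid D h G \<longleftrightarrow>
     finite G \<and> G \<subseteq> D \<and>
     (\<exists>a s. (\<forall>i. 0 < s $ i \<and> s $ i \<le> h) \<and>
        (\<forall>g\<in>G. \<forall>i. \<exists>n::int. g $ i = a $ i + of_int n * s $ i)) \<and>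
     (\<forall>x\<in>D. \<exists>g\<in>G. \<forall>i. \<bar>x $ i - g $ i\<bar> \<le> h / 2)"

definition sigma_min :: "real^'n^'n \<Rightarrow> real" where
  "sigma_min M = Min {s. 0 \<le> s \<and> (\<exists>x. x \<noteq> 0 \<and> Finite_Cartesian_Product.transpose M *v (M *v x) = s\<^sup>2 *\<^sub>R x)}"

definition par_op :: "('k::finite \<Rightarrow> ell2 \<Rightarrow> ell2) \<Rightarrow> (real^'p \<Rightarrow> real^'k) \<Rightarrow> real^'p \<Rightarrow> ell2 \<Rightarrow> ell2" where
  "par_op A \<theta> \<mu> x = (\<Sum>m\<in>UNIV. (\<theta> \<mu> $ m) *\<^sub>R A m x)"

definition eig :: "('k::finite \<Rightarrow> ell2 \<Rightarrow> ell2) \<Rightarrow> (real^'p \<Rightarrow> real^'k) \<Rightarrow> nat \<Rightarrow> real^'p \<Rightarrow> real" where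
  "eig A \<theta> k \<mu> = kth_eig (par_op A \<theta> \<mu>) k"

definition box :: "('k::finite \<Rightarrow> ell2 \<Rightarrow> ell2) \<Rightarrow> (real^'k) set" where
  "box A = {y. \<forall>m. rayleigh_min (A m) \<le> y $ m \<and> y $ m \<le> rayleigh_max (A m)}"

context
  fixes A :: "'k::finite \<Rightarrow> ell2 \<Rightarrow> ell2"
    and \<theta> :: "real^'p \<Rightarrow> real^'k"
    and l r :: nat
    and P :: "nat \<Rightarrow> (real^'p) set"
    and v :: "real^'p \<Rightarrow> nat \<Rightarrow> ell2"
    and V :: "nat \<Rightarrow> complex Matrix.vec \<Rightarrow> ell2"
    and w :: "nat \<Rightarrow> real^'p \<Rightarrow> nat \<Rightarrow> complex Matrix.vec"
begin

definition proj_space :: "nat \<Rightarrow> ell2 set" where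
  "proj_space j = ell2C.span {v \<nu> k |\<nu> k. \<nu> \<in> P j \<and> k \<in> {1..l}}"

definition proj_mat :: "nat \<Rightarrow> real^'p \<Rightarrow> complex Matrix.mat" where
  "proj_mat j \<mu> =
     (let d = ell2C.dim (proj_space j)
      in mat_of_map d (\<lambda>x. adj d (V j) (par_op A \<theta> \<mu> (V j x))))"

definition ritz :: "nat \<Rightarrow> nat \<Rightarrow> real^'p \<Rightarrow> real" where
  "ritz j k \<mu> = mat_eig (proj_mat j \<mu>) k"

definition ritz_frame :: "nat \<Rightarrow> real^'p \<Rightarrow> complex Matrix.vec \<Rightarrow> ell2" where
  "ritz_frame j \<mu> = frame r (\<lambda>k. V j (w j \<mu> k))"

definition residual :: "nat \<Rightarrow> real^'p \<Rightarrow> real" where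
  "residual j \<mu> =
     (let U = ritz_frame j \<mu>; T = par_op A \<theta> \<mu>
      in op_norm r (\<lambda>x. T (U x) - U (adj r U (T (U x)))))"

definition beta :: "real^'p \<Rightarrow> nat \<Rightarrow> real^'p \<Rightarrow> real" where
  "beta \<nu> j \<mu> =
     (let \<Lambda> = mat_diag l (\<lambda>i. complex_of_real (eig A \<theta> (Suc i) \<nu>));
          F = frame l (v \<nu>);
          U = ritz_frame j \<mu>;
          G = mat_of_map l (\<lambda>x. adj l F (U (adj r U (F x))))
      in mat_eig (\<Lambda> - complex_of_real (eig A \<theta> 1 \<nu>) \<cdot>\<^sub>m 1\<^sub>m l
            - G * (\<Lambda> - complex_of_real (eig A \<theta> (l + 1) \<nu>) \<cdot>\<^sub>m 1\<^sub>m l)) 1)"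

definition Y_LB :: "nat \<Rightarrow> real^'p \<Rightarrow> (real^'k) set" where
  "Y_LB j \<mu> = {y \<in> box A. \<forall>\<nu>\<in>P j. inner (\<theta> \<nu>) y \<ge> eig A \<theta> 1 \<nu> + beta \<nu> j \<mu>}"

definition eta :: "nat \<Rightarrow> real^'p \<Rightarrow> real" where
  "eta j \<mu> = (INF y\<in>Y_LB j \<mu>. inner (\<theta> \<mu>) y)"

(* Division by zero yields 0, which is the convention wanted for the fraction 0/0. *)
definition lambda_LB :: "nat \<Rightarrow> real^'p \<Rightarrow> real" where
  "lambda_LB j \<mu> =
     min (ritz j 1 \<mu>) (eta j \<mu>)
     - 2 * (residual j \<mu>)\<^sup>2
       / (\<bar>ritz j 1 \<mu> - eta j \<mu>\<bar> + sqrt ((ritz j 1 \<mu> - eta j \<mu>)\<^sup>2 + 4 * (residual j \<mu>)\<^sup>2))"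

definition gap_H :: "nat \<Rightarrow> real^'p \<Rightarrow> real" where
  "gap_H j \<mu> = ritz j 1 \<mu> - lambda_LB j \<mu>"

definition err_E :: "nat \<Rightarrow> real^'p \<Rightarrow> real" where
  "err_E j \<mu> = ritz j 1 \<mu> - eig A \<theta> 1 \<mu>"

definition snapshots_at :: "real^'p \<Rightarrow> bool" where
  "snapshots_at \<nu> \<longleftrightarrow>
     (\<forall>k\<in>{1..l+1}. \<exists>t. is_kth_eig (par_op A \<theta> \<nu>) k t) \<and>
     (\<forall>k\<in>{1..l}. par_op A \<theta> \<nu> (v \<nu> k) = eig A \<theta> k \<nu> *\<^sub>R v \<nu> k) \<and>
     (\<forall>a\<in>{1..l}. \<forall>b\<in>{1..l}. cinner (v \<nu> a) (v \<nu> b) = (if a = b then 1 else 0))"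

definition ritz_vectors_at :: "nat \<Rightarrow> real^'p \<Rightarrow> bool" where
  "ritz_vectors_at j \<mu> \<longleftrightarrow>
     (\<forall>k\<in>{1..r}. w j \<mu> k \<in> carrier_vec (ell2C.dim (proj_space j)) \<and>
        proj_mat j \<mu> *\<^sub>v w j \<mu> k = complex_of_real (ritz j k \<mu>) \<cdot>\<^sub>v w j \<mu> k) \<and>
     (\<forall>a\<in>{1..r}. \<forall>b\<in>{1..r}. w j \<mu> a \<bullet>c w j \<mu> b = (if a = b then 1 else 0))"

definition active_normals :: "nat \<Rightarrow> real^'p \<Rightarrow> real^'k \<Rightarrow> (real^'k) set" where
  "active_normals j \<mu> y =
     {\<theta> \<nu> |\<nu>. \<nu> \<in> P j \<and> inner (\<theta> \<nu>) y = eig A \<theta> 1 \<nu> + beta \<nu> j \<mu>} \<union>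
     {axis m 1 |m. y $ m = rayleigh_min (A m) \<or> y $ m = rayleigh_max (A m)}"

definition active_mat :: "nat \<Rightarrow> real^'p \<Rightarrow> real^'k \<Rightarrow> real^'k^'k \<Rightarrow> bool" where
  "active_mat j \<mu> y M \<longleftrightarrow>
     (\<forall>i. M $ i \<in> active_normals j \<mu> y) \<and> inj (\<lambda>i. M $ i) \<and> independent (range (\<lambda>i. M $ i))"

definition lp_choice :: "nat \<Rightarrow> real^'p \<Rightarrow> real^'k \<Rightarrow> real^'k^'k \<Rightarrow> bool" where
  "lp_choice j \<mu> y M \<longleftrightarrow>
     is_arg_min (inner (\<theta> \<mu>)) (\<lambda>z. z \<in> Y_LB j \<mu>) y \<and>
     is_arg_max sigma_min (active_mat j \<mu> y) M"

definition greedy_run ::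
  "(real^'p) set \<Rightarrow> (real^'p) set \<Rightarrow> (nat \<Rightarrow> real^'p) \<Rightarrow>
   (nat \<Rightarrow> real^'p \<Rightarrow> real^'k) \<Rightarrow> (nat \<Rightarrow> real^'p \<Rightarrow> real^'k^'k) \<Rightarrow> bool" where
  "greedy_run D P1 \<mu>s y \<Theta> \<longleftrightarrow>
     P 1 = P1 \<and>
     (\<forall>j\<ge>1.
        (\<forall>\<nu>\<in>P j. snapshots_at \<nu>) \<and>
        isometry_onto (ell2C.dim (proj_space j)) (V j) (proj_space j) \<and>
        (\<forall>\<mu>\<in>D. ritz_vectors_at j \<mu> \<and> lp_choice j \<mu> (y j \<mu>) (\<Theta> j \<mu>)) \<and>
        is_arg_max (gap_H j) (\<lambda>\<mu>. \<mu> \<in> D) (\<mu>s (Suc j)) \<and>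
        P (Suc j) = insert (\<mu>s (Suc j)) (P j))"

end

end

theory Submission
  imports Defs "HOL-Combinatorics.Permutations"
begin

text \<open>
  If \<open>\<nu> \<in> P j\<close>, every \<open>\<beta>\<close> is nonnegative, so \<open>\<eta>(\<mu>)\<close> is at least
  \<open>\<lambda>\<^sub>1(\<nu>) - C \<bar>\<theta>(\<mu>) - \<theta>(\<nu>)\<bar>\<close>, while the smallest Ritz value at \<open>\<mu>\<close> is at most
  \<open>\<lambda>\<^sub>1(\<nu>) + C \<bar>\<theta>(\<mu>) - \<theta>(\<nu>)\<bar>\<close>. By the Ky Fan minimum principle and the gap between
  \<open>\<lambda>\<^sub>r(\<nu>)\<close> and \<open>\<lambda>\<^sub>r\<^sub>+\<^sub>1(\<nu>)\<close>, the Ritz space at \<open>\<mu>\<close> is close to the span of the first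
  \<open>r\<close> eigenvectors at \<open>\<nu>\<close>, so the residual at \<open>\<mu>\<close> is small as well. Hence \<open>H j \<mu>\<close> is bounded by
  a function of \<open>\<bar>\<theta>(\<mu>) - \<theta>(\<nu>)\<bar>\<close> alone that vanishes at \<open>0\<close>. By compactness two greedy points
  become arbitrarily close, and monotonicity in \<open>j\<close> turns one small maximal gap into convergence.
  Finally \<open>0 \<le> E j \<mu> \<le> H j \<mu>\<close>: the form of \<open>A(\<mu>)\<close> on the orthogonal complement of the Ritz space is at
  least \<open>\<eta>(\<mu>)\<close>, and the smaller eigenvalue of the matrix with rows \<open>(a, \<rho>)\<close> and \<open>(\<rho>, \<eta>)\<close>,
  with \<open>a\<close> the smallest Ritz value, is the lower bound.
\<close>

text \<open>\<open>is_kth_eig\<close> only counts eigenvectors, so min-max bounds on the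
  infinite-dimensional space are derived from compactness: a negative infimum of the form on a
  closed invariant subspace is attained, and below any positive number there is always a further
  eigenvector. The matrix behind \<beta> is not Hermitian. With D = diag(b - t k) and P the
  projection onto the Ritz space it equals (b - t 1) I - V^* (I - P) V D, and pairing an eigenvector
  c with D c restores symmetry. This yields \<beta> >= 0 and, on unit vectors u orthogonal to the
  Ritz space, the lower bound t 1 + \<beta> for the form, so that the vector of the forms of the
  \<open>A m\<close> at u is feasible for the linear program. The residual is controlled through the
  sum of r Ritz values rather than through single ones: inside a cluster of eigenvalues individual
  Ritz vectors need not approach individual eigenvectors, but the sum controls the distance between
  the whole spaces. The constant C is \<open>sum \<kappa> UNIV\<close>, where
  \<open>\<kappa> m\<close> bounds the operator \<open>A m\<close>.\<close>

section \<open>The complex inner product on \<open>ell2\<close>\<close>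

lemma cmod_sq: "(complex_of_real (cmod z))\<^sup>2 = z * cnj z"
  by (metis complex_norm_square of_real_power)

lemma coord_scaleC: "coord (c *\<^sub>C x) n = c * coord x n"
  by (simp add: scaleC.rep_eq)

lemma cinner_commute: "cinner y x = cnj (cinner x y)"
proof -
  have "cnj (cinner x y) = (\<Sum>n. cnj (cnj (coord x n) * coord y n))"
    unfolding cinner_def
    by (rule bounded_linear.suminf[OF bounded_linear_cnj summable_coord_prod, symmetric, THEN sym])
  then show ?thesis by (simp add: cinner_def mult.commute)
qed

lemma cinner_add_left: "cinner (x + y) z = cinner x z + cinner y z"
  unfolding cinner_def
  by (simp add: plus_ell2.rep_eq distrib_right suminf_add summable_coord_prod)

lemma cinner_scaleC_left: "cinner (c *\<^sub>C x) y = cnj c * cinner x y"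
  unfolding cinner_def by (simp add: coord_scaleC mult.assoc suminf_mult summable_coord_prod)

lemma cinner_add_right: "cinner z (x + y) = cinner z x + cinner z y"
  by (metis cinner_add_left cinner_commute complex_cnj_add)

lemma cinner_scaleC_right: "cinner x (c *\<^sub>C y) = c * cinner x y"
  by (metis cinner_scaleC_left cinner_commute complex_cnj_mult complex_cnj_cnj)

lemma cinner_zero_left [simp]: "cinner 0 x = 0" and cinner_zero_right [simp]: "cinner x 0 = 0"
  by (simp_all add: cinner_def zero_ell2.rep_eq)

lemma cinner_minus_left: "cinner (- x) y = - cinner x y"
  by (metis add_eq_0_iff2 cinner_add_left cinner_zero_left ab_left_minus)

lemma cinner_minus_right: "cinner x (- y) = - cinner x y"
  by (metis add_eq_0_iff2 cinner_add_right cinner_zero_right ab_left_minus)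

lemma cinner_diff_left: "cinner (x - y) z = cinner x z - cinner y z"
  by (metis add_uminus_conv_diff cinner_add_left cinner_minus_left)

lemma cinner_diff_right: "cinner z (x - y) = cinner z x - cinner z y"
  by (metis add_uminus_conv_diff cinner_add_right cinner_minus_right)

lemma scaleC_of_real: "complex_of_real a *\<^sub>C x = a *\<^sub>R x"
  by (simp add: scaleR_ell2_def)

lemma cinner_scaleR_left: "cinner (a *\<^sub>R x) y = a * cinner x y"
  by (simp add: scaleR_ell2_def cinner_scaleC_left)

lemma cinner_scaleR_right: "cinner x (a *\<^sub>R y) = a * cinner x y"
  by (simp add: scaleR_ell2_def cinner_scaleC_right)

lemma cinner_sum_left: "cinner (sum f I) y = (\<Sum>i\<in>I. cinner (f i) y)"
  by (induction I rule: infinite_finite_induct) (auto simp: cinner_add_left)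

lemma cinner_sum_right: "cinner y (sum f I) = (\<Sum>i\<in>I. cinner y (f i))"
  by (induction I rule: infinite_finite_induct) (auto simp: cinner_add_right)

lemmas cinner_simps = cinner_add_left cinner_add_right cinner_diff_left cinner_diff_right
  cinner_scaleC_left cinner_scaleC_right cinner_scaleR_left cinner_scaleR_right
  cinner_minus_left cinner_minus_right

lemma inner_eq_Re_cinner: "inner x y = Re (cinner x y)"
  by (simp add: inner_ell2_def)

lemma cinner_self: "cinner x x = complex_of_real ((norm x)\<^sup>2)"
proof (rule complex_eqI)
  show "Re (cinner x x) = Re (complex_of_real ((norm x)\<^sup>2))"
    by (simp add: power2_norm_eq_inner inner_eq_Re_cinner)
  show "Im (cinner x x) = Im (complex_of_real ((norm x)\<^sup>2))"
    using cinner_commute[of x x] by (simp add: complex_eq_iff)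
qed

lemma norm_scaleC: "norm (c *\<^sub>C x) = cmod c * norm x" for x :: ell2
proof -
  have "complex_of_real ((norm (c *\<^sub>C x))\<^sup>2) = complex_of_real ((cmod c * norm x)\<^sup>2)"
    unfolding cinner_self[symmetric] cinner_simps
    by (simp add: cinner_self power_mult_distrib cmod_sq)
  then have "(norm (c *\<^sub>C x))\<^sup>2 = (cmod c * norm x)\<^sup>2"
    using of_real_eq_iff by blast
  then show ?thesis by (simp add: power2_eq_iff_nonneg)
qed

text \<open>Multiplying \<open>x\<close> by the phase of \<open>cinner x y\<close> makes the inner
  product real and nonnegative, which reduces the claim to the real inequality.\<close>

lemma cinner_cauchy_schwarz: "cmod (cinner x y) \<le> norm x * norm y"
proof (cases "cinner x y = 0")
  case False
  define c where "c = sgn (cinner x y)"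
  have c: "cmod c = 1" using False by (simp add: c_def norm_sgn)
  have "cnj c * cinner x y = cmod (cinner x y)"
    unfolding c_def using False
    by (simp add: sgn_eq complex_norm_square[symmetric] mult.commute power2_eq_square
        flip: complex_norm_square)
  then have "cmod (cinner x y) = inner (c *\<^sub>C x) y"
    by (simp add: inner_eq_Re_cinner cinner_simps)
  also have "\<dots> \<le> norm (c *\<^sub>C x) * norm y" by (rule norm_cauchy_schwarz)
  finally show ?thesis by (simp add: norm_scaleC c)
qed simp

lemma continuous_cinner_right: "continuous_on UNIV (\<lambda>x. cinner y x)"
proof -
  have "bounded_linear (cinner y)"
    by (rule bounded_linear_intro[where K = "norm y"])
      (auto simp: cinner_simps scaleR_conv_of_real mult.commute[of "norm _" "norm y"] cinner_cauchy_schwarz)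
  then show ?thesis by (simp add: linear_continuous_on)
qed

lemma scaleC_simps:
  "c *\<^sub>C (x + y) = c *\<^sub>C x + c *\<^sub>C y" "c *\<^sub>C (x - y) = c *\<^sub>C x - c *\<^sub>C y"
  "(c + d) *\<^sub>C x = c *\<^sub>C x + d *\<^sub>C x" "c *\<^sub>C d *\<^sub>C x = (c * d) *\<^sub>C x"
  "0 *\<^sub>C x = 0" "c *\<^sub>C 0 = 0" "1 *\<^sub>C x = x"
  by (simp_all add: ell2C.scale_right_distrib ell2C.scale_right_diff_distrib ell2C.scale_left_distrib)

lemma scaleC_scaleR: "c *\<^sub>C a *\<^sub>R x = a *\<^sub>R c *\<^sub>C x"
  by (simp add: scaleR_ell2_def ell2C.scale_left_commute)

lemma cinner_orth_pythagoras:
  assumes "cinner x y = 0" shows "(norm (x + y))\<^sup>2 = (norm x)\<^sup>2 + (norm y)\<^sup>2"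
proof -
  have "inner x y = 0" using assms by (simp add: inner_eq_Re_cinner)
  then show ?thesis by (simp add: power2_norm_eq_inner inner_simps inner_commute)
qed

text \<open>The standard unit vectors. They supply orthonormal families of every finite size, which
  is how infinite dimension enters.\<close>

definition unit_ell2 :: "nat \<Rightarrow> ell2" where
  "unit_ell2 k = Abs_ell2 (\<lambda>n. if n = k then 1 else 0)"

lemma coord_unit_ell2: "coord (unit_ell2 k) n = (if n = k then 1 else 0)"
proof -
  have "summable (\<lambda>n. (cmod (if n = k then 1 else 0))\<^sup>2)"
    by (rule summable_finite[of "{k}"]) auto
  then show ?thesis unfolding unit_ell2_def by (subst Abs_ell2_inverse) auto
qed

lemma cinner_unit_ell2: "cinner (unit_ell2 a) (unit_ell2 b) = (if a = b then 1 else 0)"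
proof -
  have "cinner (unit_ell2 a) (unit_ell2 b) = (\<Sum>n\<in>{a}. cnj (coord (unit_ell2 a) n) * coord (unit_ell2 b) n)"
    unfolding cinner_def by (rule suminf_finite) (auto simp: coord_unit_ell2)
  then show ?thesis by (simp add: coord_unit_ell2)
qed

subsection \<open>Finite orthonormal families\<close>

definition orthonormal :: "'i set \<Rightarrow> ('i \<Rightarrow> ell2) \<Rightarrow> bool" where
  "orthonormal I e \<longleftrightarrow> finite I \<and> (\<forall>a\<in>I. \<forall>b\<in>I. cinner (e a) (e b) = (if a = b then 1 else 0))"

text \<open>The orthogonal projection onto the span when the family is orthonormal. As a bare
  formula it is additive, homogeneous and symmetric for every family.\<close>

definition proj :: "'i set \<Rightarrow> ('i \<Rightarrow> ell2) \<Rightarrow> ell2 \<Rightarrow> ell2" where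
  "proj I e x = (\<Sum>i\<in>I. cinner (e i) x *\<^sub>C e i)"

lemma orthonormal_finite: "orthonormal I e \<Longrightarrow> finite I"
  by (simp add: orthonormal_def)

lemma orthonormal_cinner:
  "orthonormal I e \<Longrightarrow> a \<in> I \<Longrightarrow> b \<in> I \<Longrightarrow> cinner (e a) (e b) = (if a = b then 1 else 0)"
  by (simp add: orthonormal_def)

lemma orthonormal_norm: "orthonormal I e \<Longrightarrow> a \<in> I \<Longrightarrow> norm (e a) = 1"
proof -
  assume "orthonormal I e" "a \<in> I"
  then have "cinner (e a) (e a) = 1" by (simp add: orthonormal_cinner)
  then have "(norm (e a))\<^sup>2 = 1" by (simp add: cinner_self flip: of_real_power)
  then show ?thesis by (simp add: power2_eq_1_iff) (smt (verit) norm_ge_zero)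
qed

lemma norm_unit_ell2: "norm (unit_ell2 a) = 1"
  by (rule orthonormal_norm[of "{a}" unit_ell2 a]) (simp_all add: orthonormal_def cinner_unit_ell2)

lemma operator_bound_nonneg:
  fixes T :: "ell2 \<Rightarrow> ell2"
  assumes "\<And>z. norm (T z) \<le> k * norm z" shows "0 \<le> k"
  using order_trans[OF norm_ge_zero assms[of "unit_ell2 0"]] by (simp add: norm_unit_ell2)

lemma orthonormal_subset: "orthonormal I e \<Longrightarrow> J \<subseteq> I \<Longrightarrow> orthonormal J e"
  unfolding orthonormal_def by (meson finite_subset subset_iff)

lemma cinner_orthonormal_sum:
  assumes "orthonormal I e" "a \<in> I"
  shows "cinner (e a) (\<Sum>i\<in>I. c i *\<^sub>C e i) = c a"
proof -
  have "cinner (e a) (\<Sum>i\<in>I. c i *\<^sub>C e i) = (\<Sum>i\<in>I. if i = a then c a else 0)"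
    unfolding cinner_sum_right using assms
    by (intro sum.cong) (auto simp: cinner_simps orthonormal_cinner)
  then show ?thesis using assms by (simp add: orthonormal_finite)
qed

lemma cinner_orthonormal_sums:
  assumes "orthonormal I e"
  shows "cinner (\<Sum>i\<in>I. c i *\<^sub>C e i) (\<Sum>i\<in>I. d i *\<^sub>C e i) = (\<Sum>i\<in>I. cnj (c i) * d i)"
  unfolding cinner_sum_left cinner_scaleC_left
  using assms by (intro sum.cong) (auto simp: cinner_orthonormal_sum)

lemma norm_orthonormal_sum:
  assumes "orthonormal I e"
  shows "(norm (\<Sum>i\<in>I. c i *\<^sub>C e i))\<^sup>2 = (\<Sum>i\<in>I. (cmod (c i))\<^sup>2)"
proof -
  have "complex_of_real ((norm (\<Sum>i\<in>I. c i *\<^sub>C e i))\<^sup>2) = complex_of_real (\<Sum>i\<in>I. (cmod (c i))\<^sup>2)"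
    unfolding cinner_self[symmetric] cinner_orthonormal_sums[OF assms]
    by (simp add: cmod_sq mult.commute)
  then show ?thesis using of_real_eq_iff by blast
qed

lemma proj_member:
  assumes "orthonormal I e" "a \<in> I"
  shows "proj I e (e a) = e a"
proof -
  have "proj I e (e a) = (\<Sum>i\<in>I. if i = a then e a else 0)"
    unfolding proj_def using assms(2)
    by (intro sum.cong) (auto simp: orthonormal_cinner[OF assms(1)])
  then show ?thesis using assms by (simp add: orthonormal_finite)
qed

lemma proj_orthonormal_sum:
  assumes "orthonormal I e"
  shows "proj I e (\<Sum>i\<in>I. c i *\<^sub>C e i) = (\<Sum>i\<in>I. c i *\<^sub>C e i)"
  unfolding proj_def using assms by (intro sum.cong) (auto simp: cinner_orthonormal_sum)

lemma cinner_proj: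
  "orthonormal I e \<Longrightarrow> a \<in> I \<Longrightarrow> cinner (e a) (proj I e x) = cinner (e a) x"
  unfolding proj_def by (rule cinner_orthonormal_sum)

lemma proj_idem: "orthonormal I e \<Longrightarrow> proj I e (proj I e x) = proj I e x"
  unfolding proj_def[of I e x] by (rule proj_orthonormal_sum)

lemma cinner_diff_proj:
  "orthonormal I e \<Longrightarrow> a \<in> I \<Longrightarrow> cinner (e a) (x - proj I e x) = 0"
  by (simp add: cinner_simps cinner_proj)

lemma proj_add: "proj I e (x + y) = proj I e x + proj I e y"
  by (simp add: proj_def cinner_simps scaleC_simps sum.distrib)

lemma proj_scaleC: "proj I e (c *\<^sub>C x) = c *\<^sub>C proj I e x"
  by (simp add: proj_def cinner_simps ell2C.scale_sum_right)

lemma proj_eq_0: "(\<And>i. i \<in> I \<Longrightarrow> cinner (e i) x = 0) \<Longrightarrow> proj I e x = 0"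
  by (simp add: proj_def)

lemma cinner_proj_left: "cinner (proj I e x) y = cinner x (proj I e y)"
  unfolding proj_def cinner_sum_left cinner_sum_right cinner_simps
  by (intro sum.cong) (auto simp: cinner_commute[of x])

lemma norm_proj_sq:
  "orthonormal I e \<Longrightarrow> (norm (proj I e x))\<^sup>2 = (\<Sum>i\<in>I. (cmod (cinner (e i) x))\<^sup>2)"
  unfolding proj_def by (rule norm_orthonormal_sum)

lemma norm_proj_pythagoras:
  assumes "orthonormal I e"
  shows "(norm x)\<^sup>2 = (norm (proj I e x))\<^sup>2 + (norm (x - proj I e x))\<^sup>2"
proof -
  have "cinner (proj I e x) (x - proj I e x) = 0"
    by (simp add: cinner_proj_left cinner_simps proj_idem[OF assms])
  from cinner_orth_pythagoras[OF this] show ?thesis by simp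
qed

lemma bessel:
  assumes "orthonormal I e"
  shows "(\<Sum>i\<in>I. (cmod (cinner (e i) x))\<^sup>2) \<le> (norm x)\<^sup>2"
  using norm_proj_pythagoras[OF assms, of x] norm_proj_sq[OF assms, of x] by simp

lemma norm_proj_le: "orthonormal I e \<Longrightarrow> norm (proj I e x) \<le> norm x"
  using norm_proj_pythagoras[of I e x] by (simp add: power2_le_imp_le)

lemma norm_diff_proj_le: "orthonormal I e \<Longrightarrow> norm (x - proj I e x) \<le> norm x"
  using norm_proj_pythagoras[of I e x] by (simp add: power2_le_imp_le)

text \<open>A dimension count by traces: if every \<open>f a\<close> were fixed by the projection,
  the squared norms of the projections would sum to \<open>card J\<close>, whereas exchanging the
  sums and applying Bessel to the \<open>e i\<close> bounds the total by
  \<open>card I\<close>.\<close>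

lemma orthonormal_escape:
  assumes I: "orthonormal I e" and J: "orthonormal J f" and "card I < card J"
  shows "\<exists>a\<in>J. f a - proj I e (f a) \<noteq> 0"
proof (rule ccontr)
  assume "\<not> ?thesis"
  then have eq: "proj I e (f a) = f a" if "a \<in> J" for a using that by simp
  have "real (card J) = (\<Sum>a\<in>J. (norm (proj I e (f a)))\<^sup>2)"
    by (simp add: eq orthonormal_norm[OF J])
  also have "\<dots> = (\<Sum>a\<in>J. \<Sum>i\<in>I. (cmod (cinner (f a) (e i)))\<^sup>2)"
    by (simp add: norm_proj_sq[OF I] cinner_commute[of _ "f _"])
  also have "\<dots> = (\<Sum>i\<in>I. \<Sum>a\<in>J. (cmod (cinner (f a) (e i)))\<^sup>2)"
    by (rule sum.swap)
  also have "\<dots> \<le> (\<Sum>i\<in>I. (norm (e i))\<^sup>2)"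
    by (intro sum_mono bessel[OF J])
  also have "\<dots> = real (card I)" by (simp add: orthonormal_norm[OF I])
  finally show False using assms(3) by simp
qed

lemma orthonormal_fun_upd:
  assumes "orthonormal {..<n} f" "norm u = 1" "\<And>i. i < n \<Longrightarrow> cinner (f i) u = 0"
  shows "orthonormal {..<Suc n} (f(n := u))"
proof -
  have "cinner u u = 1" using assms(2) by (simp add: cinner_self)
  moreover have "cinner u (f i) = 0" if "i < n" for i
    using assms(3)[OF that] cinner_commute[of u "f i"] by simp
  ultimately show ?thesis
    using assms by (auto simp: orthonormal_def less_Suc_eq)
qed

definition ocomp :: "'i set \<Rightarrow> ('i \<Rightarrow> ell2) \<Rightarrow> ell2 set" where
  "ocomp I e = {x. \<forall>i\<in>I. cinner (e i) x = 0}"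

lemma closed_ocomp: "closed (ocomp I e)"
proof -
  have "ocomp I e = (\<Inter>i\<in>I. {x. cinner (e i) x = 0})" by (auto simp: ocomp_def)
  moreover have "closed {x. cinner (e i) x = 0}" for i
    using continuous_closed_preimage[OF continuous_cinner_right[of "e i"] closed_UNIV, of "{0}"]
    by (simp add: vimage_def)
  ultimately show ?thesis by auto
qed

lemma subspace_ocomp: "subspace (ocomp I e)"
  by (auto simp: subspace_def ocomp_def cinner_simps)

subsection \<open>Compact self-adjoint operators\<close>

lemma csa_add: "compact_selfadjoint T \<Longrightarrow> T (x + y) = T x + T y"
  and csa_scaleC: "compact_selfadjoint T \<Longrightarrow> T (c *\<^sub>C x) = c *\<^sub>C T x"
  and csa_compact: "compact_selfadjoint T \<Longrightarrow> compact (closure (T ` cball 0 1))"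
  and csa_cinner: "compact_selfadjoint T \<Longrightarrow> cinner (T x) y = cinner x (T y)"
  by (auto simp: compact_selfadjoint_def)

lemma csa_scaleR: "compact_selfadjoint T \<Longrightarrow> T (a *\<^sub>R x) = a *\<^sub>R T x"
  by (simp add: scaleR_ell2_def csa_scaleC)

lemma csa_zero: "compact_selfadjoint T \<Longrightarrow> T 0 = 0"
  using csa_scaleR[of T 0 0] by simp

lemma csa_diff: "compact_selfadjoint T \<Longrightarrow> T (x - y) = T x - T y"
  using csa_add[of T "x - y" y] by simp

lemma csa_sum: "compact_selfadjoint T \<Longrightarrow> T (sum f I) = (\<Sum>i\<in>I. T (f i))"
  by (induction I rule: infinite_finite_induct) (auto simp: csa_zero csa_add)

lemma csa_inner: "compact_selfadjoint T \<Longrightarrow> inner (T x) y = inner x (T y)"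
  by (simp add: inner_eq_Re_cinner csa_cinner)

lemma csa_bounded:
  assumes "compact_selfadjoint T"
  obtains K where "K > 0" "\<And>x. norm (T x) \<le> K * norm x"
proof -
  have "bounded (T ` cball 0 1)"
    using compact_imp_bounded[OF csa_compact[OF assms]] closure_subset bounded_subset by blast
  then obtain K where K: "K > 0" "\<And>x. norm x \<le> 1 \<Longrightarrow> norm (T x) \<le> K"
    unfolding bounded_pos by auto
  have "norm (T x) \<le> K * norm x" for x
  proof (cases "x = 0")
    case False
    have "norm (T (inverse (norm x) *\<^sub>R x)) \<le> K" using False by (intro K) simp
    then show ?thesis using False by (simp add: csa_scaleR[OF assms] field_simps)
  qed (simp add: csa_zero[OF assms])
  with K show ?thesis using that by blast
qed

lemma csa_bounded_linear:
  assumes "compact_selfadjoint T" shows "bounded_linear T"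
proof -
  obtain K where "\<And>x. norm (T x) \<le> K * norm x" using csa_bounded[OF assms] by blast
  then show ?thesis
    by (intro bounded_linear_intro[where K = K]) (auto simp: csa_add[OF assms] csa_scaleR[OF assms] mult.commute)
qed

lemma compact_closure_subset:
  fixes S :: "'a::metric_space set"
  assumes "compact K" "S \<subseteq> K" shows "compact (closure S)"
proof -
  have "closure S \<subseteq> K" using assms by (simp add: closure_minimal compact_imp_closed)
  then show ?thesis using compact_Int_closed[OF assms(1), of "closure S"] by (simp add: Int_absorb1)
qed

lemma csa_const_zero: "compact_selfadjoint (\<lambda>x. 0)"
proof -
  have "compact (closure ((\<lambda>x. 0 :: ell2) ` cball (0::ell2) 1))"
    by (rule compact_closure_subset[of "{0}"]) auto
  then show ?thesis by (simp add: compact_selfadjoint_def)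
qed

lemma csa_plus:
  assumes "compact_selfadjoint S" "compact_selfadjoint T"
  shows "compact_selfadjoint (\<lambda>x. S x + T x)"
proof -
  have "compact (closure ((\<lambda>x. S x + T x) ` cball 0 1))"
    by (rule compact_closure_subset[OF compact_sums[OF csa_compact[OF assms(1)] csa_compact[OF assms(2)]]])
      (auto intro!: exI subsetD[OF closure_subset])
  then show ?thesis using assms
    by (simp add: compact_selfadjoint_def cinner_simps scaleC_simps)
qed

lemma csa_scale:
  assumes "compact_selfadjoint T"
  shows "compact_selfadjoint (\<lambda>x. a *\<^sub>R T x)"
proof -
  have "compact (closure ((\<lambda>x. a *\<^sub>R T x) ` cball 0 1))"
    by (rule compact_closure_subset[OF compact_scaling[OF csa_compact[OF assms], of a]])
      (auto intro!: subsetD[OF closure_subset])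
  then show ?thesis using assms
    by (simp add: compact_selfadjoint_def cinner_simps scaleC_simps scaleC_scaleR scaleR_add_right)
qed

lemma csa_sum_op:
  assumes "\<And>i. i \<in> I \<Longrightarrow> compact_selfadjoint (T i)"
  shows "compact_selfadjoint (\<lambda>x. \<Sum>i\<in>I. T i x)"
  using assms
  by (induction I rule: infinite_finite_induct) (auto simp: csa_const_zero intro!: csa_plus)

lemma csa_rank_one: "compact_selfadjoint (\<lambda>x. cinner e x *\<^sub>C e)"
proof -
  have bl: "bounded_linear (\<lambda>c. c *\<^sub>C e)"
    by (rule bounded_linear_intro[where K = "norm e"])
      (auto simp: scaleC_simps norm_scaleC scaleR_conv_of_real scaleC_of_real[symmetric])
  have "compact ((\<lambda>c. c *\<^sub>C e) ` cball 0 (norm e))"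
    by (intro compact_continuous_image linear_continuous_on bl compact_cball)
  moreover have "(\<lambda>x. cinner e x *\<^sub>C e) ` cball 0 1 \<subseteq> (\<lambda>c. c *\<^sub>C e) ` cball 0 (norm e)"
  proof clarsimp
    fix x :: ell2 assume "norm x \<le> 1"
    then have "cmod (cinner e x) \<le> norm e"
      using cinner_cauchy_schwarz[of e x] mult_left_mono[of "norm x" 1 "norm e"] by simp
    then show "cinner e x *\<^sub>C e \<in> (\<lambda>c. c *\<^sub>C e) ` cball 0 (norm e)" by (intro imageI) simp
  qed
  ultimately have "compact (closure ((\<lambda>x. cinner e x *\<^sub>C e) ` cball 0 1))"
    by (rule compact_closure_subset)
  then show ?thesis
    by (simp add: compact_selfadjoint_def cinner_simps scaleC_simps cinner_commute[of _ e])
qed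

text \<open>Stated for abstract \<open>Q\<close> so that it serves both a projection and its
  complement.\<close>

lemma csa_compress:
  assumes T: "compact_selfadjoint T"
    and add: "\<And>x y. Q (x + y) = Q x + Q y" and scale: "\<And>c x. Q (c *\<^sub>C x) = c *\<^sub>C Q x"
    and adj: "\<And>x y. cinner (Q x) y = cinner x (Q y)" and norm: "\<And>x. norm (Q x) \<le> norm x"
  shows "compact_selfadjoint (\<lambda>x. Q (T (Q x)))"
proof -
  have "bounded_linear Q"
    by (rule bounded_linear_intro[where K = 1]) (auto simp: add scaleR_ell2_def scale norm)
  then have "compact (Q ` closure (T ` cball 0 1))"
    by (intro compact_continuous_image linear_continuous_on csa_compact[OF T])
  moreover have "(\<lambda>x. Q (T (Q x))) ` cball 0 1 \<subseteq> Q ` closure (T ` cball 0 1)"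
  proof clarify
    fix x :: ell2 assume "x \<in> cball 0 1"
    then have "Q x \<in> cball 0 1" using norm[of x] by simp
    then show "Q (T (Q x)) \<in> Q ` closure (T ` cball 0 1)"
      by (intro imageI subsetD[OF closure_subset])
  qed
  ultimately have "compact (closure ((\<lambda>x. Q (T (Q x))) ` cball 0 1))"
    by (rule compact_closure_subset)
  then show ?thesis
    by (simp add: compact_selfadjoint_def add scale adj csa_add[OF T] csa_scaleC[OF T] csa_cinner[OF T])
qed

lemma csa_invariant_ocomp:
  assumes "compact_selfadjoint T" "\<And>i. i \<in> I \<Longrightarrow> T (e i) = t i *\<^sub>R e i" "x \<in> ocomp I e"
  shows "T x \<in> ocomp I e"
  using assms csa_cinner[OF assms(1), of "e _" x, symmetric]
  by (auto simp: ocomp_def cinner_simps)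

text \<open>The infimum \<open>m\<close> of the form over unit vectors of \<open>S\<close> is
  negative, and this is why it is attained: along a minimizing sequence \<open>T x - m x\<close>
  tends to 0, compactness makes \<open>T x\<close> converge on a subsequence, and division by
  \<open>m\<close> gives convergence of the vectors themselves.\<close>

lemma csa_min_eigenvector:
  assumes T: "compact_selfadjoint T" and S: "closed S" "subspace S"
    and inv: "\<And>x. x \<in> S \<Longrightarrow> T x \<in> S" and x0: "x0 \<in> S" "inner x0 (T x0) < 0"
  shows "\<exists>u\<in>S. \<exists>s<0. norm u = 1 \<and> T u = s *\<^sub>R u \<and> (\<forall>x\<in>S. s * (norm x)\<^sup>2 \<le> inner x (T x))"
proof -
  obtain K where K: "K > 0" "\<And>x. norm (T x) \<le> K * norm x" using csa_bounded[OF T] by blast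
  have quad: "\<bar>inner x (T x)\<bar> \<le> K * (norm x)\<^sup>2" for x
  proof -
    have "\<bar>inner x (T x)\<bar> \<le> norm x * norm (T x)" by (rule Cauchy_Schwarz_ineq2)
    also have "\<dots> \<le> norm x * (K * norm x)" by (intro mult_left_mono K) simp
    finally show ?thesis by (simp add: power2_eq_square algebra_simps)
  qed
  define R where "R = (\<lambda>x. inner x (T x)) ` {x\<in>S. norm x = 1}"
  define m where "m = Inf R"
  have bdd: "bdd_below R"
  proof -
    have "- K \<le> inner x (T x)" if "norm x = 1" for x
      using quad[of x] that by (simp add: abs_le_iff)
    then show ?thesis unfolding R_def by (intro bdd_belowI2[of _ "- K"]) auto
  qed
  have "x0 \<noteq> 0" using x0 csa_zero[OF T] by auto
  have scaled: "inner (inverse (norm x) *\<^sub>R x) (T (inverse (norm x) *\<^sub>R x)) = inner x (T x) / (norm x)\<^sup>2"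
    for x by (simp add: csa_scaleR[OF T] power2_eq_square divide_inverse)
  have lower: "m * (norm x)\<^sup>2 \<le> inner x (T x)" if "x \<in> S" for x
  proof (cases "x = 0")
    case False
    then have "inner (inverse (norm x) *\<^sub>R x) (T (inverse (norm x) *\<^sub>R x)) \<in> R"
      unfolding R_def using that S(2) by (intro imageI) (simp add: subspace_scale)
    from cInf_lower[OF this bdd] show ?thesis
      using False unfolding scaled m_def by (simp add: field_simps)
  qed simp
  have "m * (norm x0)\<^sup>2 < 0" using lower[OF x0(1)] x0(2) by simp
  then have m: "m < 0" by (simp add: mult_less_0_iff not_less)
  have ne: "R \<noteq> {}"
  proof -
    have "inner (inverse (norm x0) *\<^sub>R x0) (T (inverse (norm x0) *\<^sub>R x0)) \<in> R"
      unfolding R_def using \<open>x0 \<noteq> 0\<close> x0 S(2) by (intro imageI) (simp add: subspace_scale)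
    then show ?thesis by blast
  qed
  have "\<exists>x\<in>S. norm x = 1 \<and> inner x (T x) < m + inverse (real (Suc n))" for n
  proof -
    have "Inf R < m + inverse (real (Suc n))" by (simp add: m_def)
    from cInf_lessD[OF ne this] show ?thesis unfolding R_def by auto
  qed
  then obtain X where X: "\<And>n. X n \<in> S" "\<And>n. norm (X n) = 1"
    "\<And>n. inner (X n) (T (X n)) < m + inverse (real (Suc n))" by metis
  define B where "B x = T x - m *\<^sub>R x" for x
  \<comment> \<open>An upper bound for the form of \<open>B\<close> on unit vectors: that of
    \<open>T\<close> is at most \<open>K\<close>, and \<open>- m\<close> is added.\<close>
  define L where "L = K - m"
  have L: "L > 0" using K(1) m by (simp add: L_def)
  have BS: "B x \<in> S" if "x \<in> S" for x
    unfolding B_def using that inv S(2) by (intro subspace_diff subspace_scale)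
  have Bd: "B (x - y) = B x - B y" and Bs: "B (a *\<^sub>R x) = a *\<^sub>R B x" for x y a
    by (simp_all add: B_def csa_diff[OF T] csa_scaleR[OF T] algebra_simps)
  have Bi: "inner x (B y) = inner (B x) y" for x y
    by (simp add: B_def inner_simps csa_inner[OF T])
  have q: "inner x (B x) = inner x (T x) - m * (norm x)\<^sup>2" for x
    by (simp add: B_def inner_diff_right power2_norm_eq_inner)
  text \<open>Cauchy--Schwarz for the nonnegative form of \<^term>\<open>B\<close> on \<^term>\<open>S\<close>, in the form
    obtained by testing at \<open>x - B x / L\<close>.\<close>
  have B_le: "(norm (B x))\<^sup>2 \<le> L * inner x (B x)" if "x \<in> S" for x
  proof -
    define z where "z = x - inverse L *\<^sub>R B x"
    have "z \<in> S" unfolding z_def using that BS S(2) by (intro subspace_diff subspace_scale)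
    then have "0 \<le> inner z (B z)" using lower[of z] by (simp add: q)
    moreover have "B z = B x - inverse L *\<^sub>R B (B x)"
      by (simp add: z_def Bd Bs)
    moreover have "inner x (B (B x)) = (norm (B x))\<^sup>2"
      by (simp add: Bi[of x "B x"] power2_norm_eq_inner)
    ultimately have "0 \<le> inner x (B x) - 2 * inverse L * (norm (B x))\<^sup>2
        + inverse L * inverse L * inner (B x) (B (B x))"
      unfolding z_def by (simp add: inner_simps power2_norm_eq_inner algebra_simps)
    moreover have "inner (B x) (B (B x)) \<le> L * (norm (B x))\<^sup>2"
      using quad[of "B x"] by (simp add: q L_def algebra_simps)
    then have "inverse L * inverse L * inner (B x) (B (B x)) \<le> inverse L * inverse L * (L * (norm (B x))\<^sup>2)"
      using L by (intro mult_left_mono) auto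
    moreover have "inverse L * inverse L * (L * (norm (B x))\<^sup>2) = inverse L * (norm (B x))\<^sup>2"
      using L by simp
    ultimately have "inverse L * (norm (B x))\<^sup>2 \<le> inner x (B x)" by linarith
    then show ?thesis using L by (simp add: field_simps)
  qed
  have B0: "(\<lambda>n. B (X n)) \<longlonglongrightarrow> 0"
  proof -
    have "norm ((norm (B (X n)))\<^sup>2) \<le> L * inverse (real (Suc n))" for n
    proof -
      have "inner (X n) (B (X n)) \<le> inverse (real (Suc n))"
        using X(2,3)[of n] by (simp add: q)
      from mult_left_mono[OF this less_imp_le[OF L]] B_le[OF X(1)[of n]] show ?thesis
        unfolding real_norm_def abs_power2 by (rule order_trans[rotated])
    qed
    moreover have "(\<lambda>n. L * inverse (real (Suc n))) \<longlonglongrightarrow> 0"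
      using tendsto_mult_left[OF LIMSEQ_inverse_real_of_nat, of L] by simp
    ultimately have "(\<lambda>n. (norm (B (X n)))\<^sup>2) \<longlonglongrightarrow> 0"
      by (rule Lim_null_comparison[OF always_eventually[OF allI]])
    from tendsto_real_sqrt[OF this] have "(\<lambda>n. norm (B (X n))) \<longlonglongrightarrow> 0" by simp
    then show ?thesis by (rule tendsto_norm_zero_cancel)
  qed
  have "\<forall>n. T (X n) \<in> closure (T ` cball 0 1)"
    using X(2) by (intro allI subsetD[OF closure_subset] imageI) simp
  then obtain y r where r: "strict_mono r" "(\<lambda>n. T (X (r n))) \<longlonglongrightarrow> y"
    by (rule seq_compactE[OF compact_imp_seq_compact[OF csa_compact[OF T]], of "\<lambda>n. T (X n)"])
      (simp_all add: comp_def)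
  \<comment> \<open>The difference is \<open>m\<close> times the sequence itself, and
    \<open>m\<close> is nonzero.\<close>
  have "(\<lambda>n. T (X (r n)) - B (X (r n))) \<longlonglongrightarrow> y - 0"
    using LIMSEQ_subseq_LIMSEQ[OF B0 r(1)] r(2) by (intro tendsto_diff) (simp_all add: comp_def)
  then have "(\<lambda>n. inverse m *\<^sub>R m *\<^sub>R X (r n)) \<longlonglongrightarrow> inverse m *\<^sub>R y"
    by (intro tendsto_scaleR tendsto_const) (simp add: B_def)
  then have lim: "(\<lambda>n. X (r n)) \<longlonglongrightarrow> inverse m *\<^sub>R y" using m by simp
  define u where "u = inverse m *\<^sub>R y"
  have "u \<in> S" unfolding u_def by (rule closed_sequentially[OF S(1) _ lim]) (rule X(1))
  moreover have "norm u = 1"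
  proof -
    have "(\<lambda>n. 1) \<longlonglongrightarrow> norm u" using tendsto_norm[OF lim] unfolding X(2) u_def .
    from LIMSEQ_unique[OF tendsto_const this] show ?thesis by simp
  qed
  moreover have "T u = m *\<^sub>R u"
  proof -
    have "(\<lambda>n. T (X (r n))) \<longlonglongrightarrow> T u"
      unfolding u_def by (rule bounded_linear.tendsto[OF csa_bounded_linear[OF T] lim])
    from LIMSEQ_unique[OF this r(2)] show ?thesis using m by (simp add: u_def)
  qed
  ultimately show ?thesis using m lower by blast
qed

text \<open>A negative value of the form is treated by the minimum principle, a positive one by the
  same principle for \<open>- T\<close>. If the form vanishes on \<open>S\<close>, its value at
  \<open>x + T x\<close> is twice the squared norm of \<open>T x\<close>, so \<open>T\<close> is 0
  on \<open>S\<close>.\<close>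

lemma csa_eigenvector_exists:
  assumes T: "compact_selfadjoint T" and S: "closed S" "subspace S"
    and inv: "\<And>x. x \<in> S \<Longrightarrow> T x \<in> S" and x0: "x0 \<in> S" "x0 \<noteq> 0"
  shows "\<exists>u\<in>S. norm u = 1 \<and> (\<exists>s. T u = s *\<^sub>R u)"
proof (cases "\<exists>x\<in>S. inner x (T x) \<noteq> 0")
  case True
  then obtain x where x: "x \<in> S" "inner x (T x) \<noteq> 0" by blast
  show ?thesis
  proof (cases "inner x (T x) < 0")
    case True
    then show ?thesis using csa_min_eigenvector[OF T S inv x(1)] by blast
  next
    case False
    have "(-1) *\<^sub>R T z \<in> S" if "z \<in> S" for z using that inv S(2) by (intro subspace_scale)
    from csa_min_eigenvector[OF csa_scale[OF T, of "-1"] S this x(1)]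
    obtain u s where "u \<in> S" "norm u = 1" "- T u = s *\<^sub>R u" using False x(2) by auto
    moreover from this have "T u = (- s) *\<^sub>R u" by (metis minus_minus scaleR_minus_left)
    ultimately show ?thesis by blast
  qed
next
  case False
  have "T x = 0" if "x \<in> S" for x
  proof -
    have "inner (x + T x) (T (x + T x)) = 0" "inner x (T x) = 0" "inner (T x) (T (T x)) = 0"
      using that inv False S(2) subspace_add by blast+
    then have "inner (T x) (T x) = 0"
      using csa_inner[OF T, of x "T x"] by (simp add: csa_add[OF T] inner_simps inner_commute)
    then show ?thesis by simp
  qed
  then show ?thesis using x0 S(2) csa_scaleR[OF T]
    by (intro bexI[of _ "inverse (norm x0) *\<^sub>R x0"]) (auto simp: subspace_scale intro!: exI[of _ 0])
qed

text \<open>Otherwise eigenvectors with eigenvalue at least \<open>b\<close> could be picked in the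
  complement without end, since finitely many vectors never exhaust an infinite-dimensional space.
  Their images would be pairwise at distance at least \<open>b\<close>, against total boundedness of
  the image of the unit ball.\<close>

lemma csa_eigenvector_below_pos:
  assumes T: "compact_selfadjoint T" and I: "orthonormal I e"
    and ev: "\<And>i. i \<in> I \<Longrightarrow> T (e i) = t i *\<^sub>R e i" and "b > 0"
  shows "\<exists>u s. u \<in> ocomp I e \<and> norm u = 1 \<and> T u = s *\<^sub>R u \<and> s < b"
proof (rule ccontr)
  assume neg: "\<not> ?thesis"
  let ?S = "ocomp I e"
  have family: "\<exists>f s. orthonormal {..<n} f \<and> (\<forall>i<n. f i \<in> ?S \<and> T (f i) = s i *\<^sub>R f i \<and> b \<le> s i)" for n :: nat
  proof (induction n)
    case 0
    show ?case by (simp add: orthonormal_def)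
  next
    case (Suc n)
    then obtain f s where f: "orthonormal {..<n} f"
      "\<And>i. i < n \<Longrightarrow> f i \<in> ?S \<and> T (f i) = s i *\<^sub>R f i \<and> b \<le> s i" by blast
    \<comment> \<open>The given family and the eigenvectors picked so far, joined over the disjoint
      union of their index sets.\<close>
    let ?g = "case_sum e f" and ?J = "I <+> {..<n}"
    have fe: "cinner (f j) (e i) = 0" "cinner (e i) (f j) = 0" if "i \<in> I" "j < n" for i j
      using f(2)[OF that(2)] that(1) cinner_commute[of "f j" "e i"] by (auto simp: ocomp_def)
    have g: "orthonormal ?J ?g"
      unfolding orthonormal_def[of ?J]
      by (auto simp: finite_Plus fe orthonormal_finite[OF I] orthonormal_cinner[OF I]
          orthonormal_cinner[OF f(1)] split: if_splits)
    \<comment> \<open>One unit vector more than the joined family has members, so one of them leaves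
      its span.\<close>
    have "orthonormal {..card ?J} unit_ell2" by (simp add: orthonormal_def cinner_unit_ell2)
    then obtain a where "unit_ell2 a - proj ?J ?g (unit_ell2 a) \<noteq> 0"
      using orthonormal_escape[OF g] by (metis card_atMost lessI)
    moreover have "unit_ell2 a - proj ?J ?g (unit_ell2 a) \<in> ocomp ?J ?g"
      unfolding ocomp_def using cinner_diff_proj[OF g] by blast
    ultimately obtain x0 where x0: "x0 \<noteq> 0" "x0 \<in> ocomp ?J ?g" by blast
    have "\<exists>u\<in>ocomp ?J ?g. norm u = 1 \<and> (\<exists>s. T u = s *\<^sub>R u)"
      by (rule csa_eigenvector_exists[OF T closed_ocomp subspace_ocomp _ x0(2,1)],
          rule csa_invariant_ocomp[OF T, where t = "case_sum t s"]) (use ev f(2) in auto)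
    then obtain u s' where u: "norm u = 1" "u \<in> ocomp ?J ?g" "T u = s' *\<^sub>R u" by blast
    then have *: "cinner (?g i) u = 0" if "i \<in> ?J" for i using that unfolding ocomp_def by blast
    have uS: "u \<in> ?S" "\<And>i. i < n \<Longrightarrow> cinner (f i) u = 0"
      using *[OF InlI] *[OF InrI] by (auto simp: ocomp_def)
    then have "b \<le> s'" using neg u by force
    moreover have "orthonormal {..<Suc n} (f(n := u))"
      by (rule orthonormal_fun_upd[OF f(1) u(1) uS(2)])
    moreover from calculation have "\<forall>i<Suc n. (f(n := u)) i \<in> ?S \<and>
        T ((f(n := u)) i) = (s(n := s')) i *\<^sub>R (f(n := u)) i \<and> b \<le> (s(n := s')) i"
      using u uS f(2) by (simp add: less_Suc_eq)
    ultimately show ?case by blast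
  qed
  \<comment> \<open>Pigeonhole: among \<open>card C + 1\<close> images two lie within
    \<open>b / 2\<close> of the same centre.\<close>
  obtain C where C: "finite C" "closure (T ` cball 0 1) \<subseteq> (\<Union>c\<in>C. ball c (b / 2))"
    using seq_compact_imp_totally_bounded[OF compact_imp_seq_compact[OF csa_compact[OF T]],
        rule_format, of "b / 2"] \<open>b > 0\<close> by auto
  obtain f s where f: "orthonormal {..<Suc (card C)} f"
    "\<And>i. i < Suc (card C) \<Longrightarrow> T (f i) = s i *\<^sub>R f i \<and> b \<le> s i" using family by blast
  have "\<exists>c\<in>C. dist c (T (f i)) < b / 2" if "i < Suc (card C)" for i
  proof -
    have "f i \<in> cball 0 1" using orthonormal_norm[OF f(1)] that by simp
    then have "T (f i) \<in> closure (T ` cball 0 1)" by (intro imageI subsetD[OF closure_subset])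
    with C(2) show ?thesis by fastforce
  qed
  then obtain c where c: "\<And>i. i < Suc (card C) \<Longrightarrow> c i \<in> C \<and> dist (c i) (T (f i)) < b / 2" by metis
  have "inj_on c {..<Suc (card C)}"
  proof (rule inj_onI, rule ccontr)
    fix i j assume ij: "i \<in> {..<Suc (card C)}" "j \<in> {..<Suc (card C)}" "c i = c j" "i \<noteq> j"
    \<comment> \<open>The images stay orthogonal, so their squared distance is the sum of the
      squared eigenvalues.\<close>
    have "cinner (s i *\<^sub>R f i) (- (s j *\<^sub>R f j)) = 0"
      using ij by (simp add: cinner_simps orthonormal_cinner[OF f(1)])
    from cinner_orth_pythagoras[OF this]
    have "(norm (T (f i) - T (f j)))\<^sup>2 = (s i)\<^sup>2 + (s j)\<^sup>2"
      using ij f(2) orthonormal_norm[OF f(1)] by simp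
    moreover have "b\<^sup>2 \<le> (s i)\<^sup>2" using f(2)[of i] ij \<open>b > 0\<close> by (intro power_mono) auto
    ultimately have "b\<^sup>2 \<le> (norm (T (f i) - T (f j)))\<^sup>2"
      using zero_le_power2[of "s j"] by linarith
    then have "b \<le> dist (T (f i)) (T (f j))" unfolding dist_norm by (rule power2_le_imp_le) simp
    also have "\<dots> \<le> dist (c i) (T (f i)) + dist (c j) (T (f j))"
      using ij(3) by (metis dist_commute dist_triangle)
    also have "\<dots> < b" using c[of i] c[of j] ij by simp
    finally show False by simp
  qed
  then have "card {..<Suc (card C)} \<le> card C"
    using C(1) c by (intro card_inj_on_le) auto
  then show False by simp
qed

subsection \<open>The k-th smallest eigenvalue\<close>

lemma orthonormal_independent:
  assumes "orthonormal I e"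
  shows "inj_on e I" "ell2C.independent (e ` I)"
proof -
  show inj: "inj_on e I"
    using assms unfolding orthonormal_def inj_on_def by (metis zero_neq_one)
  have "c x = 0" if c: "(\<Sum>x\<in>e ` I. c x *\<^sub>C x) = 0" and x: "x \<in> e ` I" for c x
  proof -
    obtain a where a: "a \<in> I" "x = e a" using x by blast
    have "(\<Sum>i\<in>I. c (e i) *\<^sub>C e i) = 0" using c by (simp add: sum.reindex[OF inj])
    then show ?thesis using cinner_orthonormal_sum[OF assms a(1), of "\<lambda>i. c (e i)"] a by simp
  qed
  then show "ell2C.independent (e ` I)"
    using orthonormal_finite[OF assms] by (subst ell2C.dependent_finite) auto
qed

text \<open>Grouping the vectors by eigenvalue gives an independent set in each eigenspace, hence a
  lower bound for each multiplicity in the supremum.\<close>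

lemma eig_count_ge:
  assumes I: "orthonormal I e" and ev: "\<And>i. i \<in> I \<Longrightarrow> T (e i) = t i *\<^sub>R e i"
    and S: "\<And>i. i \<in> I \<Longrightarrow> t i \<in> S"
  shows "enat (card I) \<le> eig_count T S"
proof -
  let ?J = "\<lambda>s. {i\<in>I. t i = s}"
  have fin: "finite I" by (rule orthonormal_finite[OF I])
  have "enat (card (?J s)) \<le> eig_mult T s" for s
  proof -
    have J: "orthonormal (?J s) e" by (rule orthonormal_subset[OF I]) auto
    have "enat (card (e ` ?J s)) \<le> eig_mult T s"
      unfolding eig_mult_def
      by (rule SUP_upper) (use orthonormal_independent(2)[OF J] fin ev in \<open>auto simp: eigenspace_def\<close>)
    then show ?thesis by (simp add: card_image[OF orthonormal_independent(1)[OF J]])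
  qed
  then have "(\<Sum>s\<in>t ` I. enat (card (?J s))) \<le> (\<Sum>s\<in>t ` I. eig_mult T s)" by (intro sum_mono)
  also have "\<dots> \<le> eig_count T S" unfolding eig_count_def by (rule SUP_upper) (use fin S in auto)
  also have "(\<Sum>s\<in>t ` I. enat (card (?J s))) = enat (\<Sum>s\<in>t ` I. card (?J s))"
    by (simp flip: of_nat_eq_enat)
  also have "(\<Sum>s\<in>t ` I. card (?J s)) = card I"
    using sum.image_gen[OF fin, of "\<lambda>_. 1::nat" t] by simp
  finally show ?thesis .
qed

lemma eig_count_mono: "S \<subseteq> S' \<Longrightarrow> eig_count T S \<le> eig_count T S'"
  unfolding eig_count_def by (rule SUP_subset_mono) auto

lemma is_kth_eig_mono:
  assumes "is_kth_eig T i s" "is_kth_eig T j t" "i \<le> j"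
  shows "s \<le> t"
proof (rule ccontr)
  assume "\<not> s \<le> t"
  then have "eig_count T {..t} \<le> eig_count T {..<s}" by (intro eig_count_mono) auto
  also have "\<dots> < enat i" using assms(1) by (simp add: is_kth_eig_def)
  also have "\<dots> \<le> enat j" using assms(3) by simp
  also have "\<dots> \<le> eig_count T {..t}" using assms(2) by (simp add: is_kth_eig_def)
  finally show False by simp
qed

lemma kth_eig_eq: "is_kth_eig T k t \<Longrightarrow> kth_eig T k = t"
  unfolding kth_eig_def by (blast intro: the_equality order.antisym is_kth_eig_mono)

lemma is_kth_eig_kth_eig: "\<exists>t. is_kth_eig T k t \<Longrightarrow> is_kth_eig T k (kth_eig T k)"
  using kth_eig_eq by metis

text \<open>With a trivial eigenspace \<open>t\<close> would have multiplicity 0, so removing it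
  would change no count and the two inequalities of \<open>is_kth_eig\<close> would contradict each
  other.\<close>

lemma is_kth_eig_eigenvector:
  assumes "is_kth_eig T k t" and T: "compact_selfadjoint T"
  obtains u where "norm u = 1" "T u = t *\<^sub>R u"
proof -
  have "\<exists>x\<in>eigenspace T t. x \<noteq> 0"
  proof (rule ccontr)
    assume "\<not> ?thesis"
    then have sub: "eigenspace T t \<subseteq> {0}" by blast
    have B0: "B = {}" if "B \<subseteq> eigenspace T t" "ell2C.independent B" for B
      using that sub ell2C.dependent_zero[of B] by blast
    have "eig_mult T t \<le> 0"
      unfolding eig_mult_def by (rule SUP_least) (use B0 in \<open>auto simp: zero_enat_def\<close>)
    then have mult: "eig_mult T t = 0" by simp
    have "eig_count T {..t} \<le> eig_count T {..<t}"
      unfolding eig_count_def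
    proof (rule SUP_mono)
      fix F assume "F \<in> {F. finite F \<and> F \<subseteq> {..t}}"
      then show "\<exists>F'\<in>{F. finite F \<and> F \<subseteq> {..<t}}. (\<Sum>s\<in>F. eig_mult T s) \<le> (\<Sum>s\<in>F'. eig_mult T s)"
      proof (intro bexI)
        show "(\<Sum>s\<in>F. eig_mult T s) \<le> (\<Sum>s\<in>F - {t}. eig_mult T s)"
          using mult \<open>F \<in> _\<close> by (intro eq_refl, intro sum.mono_neutral_right) auto
        show "F - {t} \<in> {F. finite F \<and> F \<subseteq> {..<t}}" using \<open>F \<in> _\<close> by (auto simp: less_le)
      qed
    qed
    with assms(1) show False unfolding is_kth_eig_def by (meson leD order_trans)
  qed
  then obtain x where "x \<noteq> 0" "T x = t *\<^sub>R x" by (auto simp: eigenspace_def)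
  then show ?thesis
    by (intro that[of "inverse (norm x) *\<^sub>R x"]) (auto simp: csa_scaleR[OF T])
qed

text \<open>A violation of the bound produces an eigenvector in the complement with eigenvalue below
  \<open>t (Suc k)\<close>. Together with those \<open>v i\<close> whose eigenvalues are also
  smaller it is one more than the defining count allows.\<close>

lemma kth_eig_le_rayleigh:
  assumes T: "compact_selfadjoint T"
    and kth: "\<And>i. i \<in> {1..Suc k} \<Longrightarrow> is_kth_eig T i (t i)"
    and v: "orthonormal {1..k} v" "\<And>i. i \<in> {1..k} \<Longrightarrow> T (v i) = t i *\<^sub>R v i"
    and x: "\<And>i. i \<in> {1..k} \<Longrightarrow> cinner (v i) x = 0"
  shows "t (Suc k) * (norm x)\<^sup>2 \<le> inner x (T x)"
proof (rule ccontr)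
  assume neg: "\<not> ?thesis"
  let ?S = "ocomp {1..k} v"
  have inv: "T z \<in> ?S" if "z \<in> ?S" for z using csa_invariant_ocomp[OF T v(2) that] by blast
  \<comment> \<open>For positive \<open>t (Suc k)\<close> infinite dimension gives the eigenvector.
    Otherwise the violating value of the form is negative, as the minimum principle
    requires.\<close>
  have "\<exists>u s. u \<in> ?S \<and> norm u = 1 \<and> T u = s *\<^sub>R u \<and> s < t (Suc k)"
  proof (cases "t (Suc k) > 0")
    case True
    then show ?thesis using csa_eigenvector_below_pos[OF T v] by blast
  next
    case False
    then have "t (Suc k) * (norm x)\<^sup>2 \<le> 0" by (simp add: mult_nonpos_nonneg)
    with neg have neg': "inner x (T x) < 0" by simp
    have xS: "x \<in> ?S" using x by (simp add: ocomp_def)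
    obtain u s where us: "u \<in> ?S" "norm u = 1" "T u = s *\<^sub>R u" "s < 0"
      "\<And>x. x \<in> ?S \<Longrightarrow> s * (norm x)\<^sup>2 \<le> inner x (T x)"
      using csa_min_eigenvector[OF T closed_ocomp subspace_ocomp inv xS neg'] by blast
    have "s * (norm x)\<^sup>2 < t (Suc k) * (norm x)\<^sup>2" using us(5)[OF xS] neg by simp
    then have "s < t (Suc k)" by (simp add: mult_less_cancel_right)
    with us show ?thesis by blast
  qed
  then obtain u s where u: "\<And>i. i \<in> {1..k} \<Longrightarrow> cinner (v i) u = 0" "norm u = 1" "T u = s *\<^sub>R u"
    "s < t (Suc k)" unfolding ocomp_def by blast
  \<comment> \<open>Ties with \<open>t (Suc k)\<close> are left out, because the count is over
    eigenvalues strictly below it.\<close>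
  define J where "J = {i\<in>{1..k}. t i < t (Suc k)}"
  have mono: "t i \<le> t j" if "1 \<le> i" "i \<le> j" "j \<le> Suc k" for i j
    using is_kth_eig_mono[OF kth kth that(2)] that by simp
  let ?e = "v(Suc k := u)" and ?s = "t(Suc k := s)"
  have uv: "cinner u (v i) = 0" if "i \<in> {1..k}" for i
    using u(1)[OF that] cinner_commute[of u "v i"] by simp
  have "orthonormal (insert (Suc k) J) ?e"
    using v(1) u(1,2) uv unfolding orthonormal_def J_def by (auto simp: cinner_self)
  then have "enat (card (insert (Suc k) J)) \<le> eig_count T {..<t (Suc k)}"
    by (rule eig_count_ge[where t = ?s]) (use u v J_def in auto)
  moreover have "card (insert (Suc k) J) = Suc (card J)" by (subst card_insert_disjoint) (auto simp: J_def)
  ultimately have count: "enat (Suc (card J)) \<le> eig_count T {..<t (Suc k)}" by simp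
  \<comment> \<open>By monotonicity \<open>J\<close> is an initial segment. The first index outside
    it therefore has eigenvalue \<open>t (Suc k)\<close>, and being the eigenvalue of that index
    caps the count at \<open>card J\<close>.\<close>
  have J: "J = {1..card J}"
  proof -
    have "\<exists>n. J = {1..n}"
    proof (cases "J = {}")
      case False
      have fin: "finite J" by (simp add: J_def)
      have "Max J \<in> J" using False fin by (rule Max_in[rotated])
      then have "J = {1..Max J}"
        using mono fin by (fastforce simp: J_def intro: le_less_trans)
      then show ?thesis by blast
    qed (auto intro!: exI[of _ 0])
    then show ?thesis by auto
  qed
  have "card J \<le> card {1..k}" by (rule card_mono) (auto simp: J_def)
  then have cJ: "card J \<le> k" by simp
  have "Suc (card J) \<notin> J" using J by (metis atLeastAtMost_iff not_less_eq_eq order_refl)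
  then have "t (Suc (card J)) = t (Suc k)"
    using mono[of "Suc (card J)" "Suc k"] cJ by (cases "card J = k") (auto simp: J_def)
  moreover have "is_kth_eig T (Suc (card J)) (t (Suc (card J)))" using cJ by (intro kth) simp
  ultimately have "eig_count T {..<t (Suc k)} < enat (Suc (card J))" by (simp add: is_kth_eig_def)
  with count show False by simp
qed

subsection \<open>Eigenvalues of matrices\<close>

lemma eigenvalue_iff_family:
  fixes M :: "complex Matrix.mat"
  assumes M: "M \<in> carrier_mat n n"
  shows "eigenvalue M e \<longleftrightarrow>
    (\<exists>c. (\<exists>i<n. c i \<noteq> 0) \<and> (\<forall>i<n. (\<Sum>j<n. M $$ (i, j) * c j) = e * c i))"
    (is "_ \<longleftrightarrow> ?R")
proof
  have mv: "vec_index (M *\<^sub>v z) i = (\<Sum>j<n. M $$ (i, j) * vec_index z j)"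
    if "i < n" "z \<in> carrier_vec n" for i z
    using that M by (simp add: scalar_prod_def atLeast0LessThan)
  show ?R if ev: "eigenvalue M e"
  proof -
    obtain z where z: "z \<in> carrier_vec n" "z \<noteq> 0\<^sub>v n" "M *\<^sub>v z = e \<cdot>\<^sub>v z"
      using ev M unfolding eigenvalue_def eigenvector_def by auto
    have "\<exists>i<n. vec_index z i \<noteq> 0"
      using z(1,2) by (metis Matrix.carrier_vecD eq_vecI index_zero_vec(1,2))
    moreover have "(\<Sum>j<n. M $$ (i, j) * vec_index z j) = e * vec_index z i" if "i < n" for i
      using mv[OF that z(1)] z(1) that by (simp add: z(3))
    ultimately show ?thesis by blast
  qed
  show "eigenvalue M e" if ?R
  proof -
    obtain c i where c: "i < n" "c i \<noteq> 0" "\<forall>i<n. (\<Sum>j<n. M $$ (i, j) * c j) = e * c i"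
      using \<open>?R\<close> by blast
    define z where "z = Matrix.vec n c"
    have z: "z \<in> carrier_vec n" "\<And>j. j < n \<Longrightarrow> vec_index z j = c j" by (auto simp: z_def)
    have "z \<noteq> 0\<^sub>v n" using z(2)[OF c(1)] c(1,2) by auto
    moreover have "M *\<^sub>v z = e \<cdot>\<^sub>v z"
    proof (rule eq_vecI)
      fix j assume "j < dim_vec (e \<cdot>\<^sub>v z)"
      then have j: "j < n" by (simp add: z_def)
      show "vec_index (M *\<^sub>v z) j = vec_index (e \<cdot>\<^sub>v z) j"
        using mv[OF j z(1)] c(3) j z by simp
    qed (use M in \<open>simp add: z_def\<close>)
    ultimately show ?thesis
      unfolding eigenvalue_def eigenvector_def using M z(1) by auto
  qed
qed

text \<open>\<open>mat_eig\<close> sorts the real parts of the roots of the characteristic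
  polynomial. There are \<open>n\<close> roots over the complex numbers, so for positive
  \<open>n\<close> the list has a head, the smallest real part.\<close>

lemma mat_eig_one:
  assumes M: "M \<in> carrier_mat n n" and n: "n > 0"
  shows "\<exists>e. eigenvalue M e \<and> Re e = mat_eig M 1"
    and "eigenvalue M e \<Longrightarrow> mat_eig M 1 \<le> Re e"
proof -
  let ?p = "char_poly M"
  let ?L = "sorted_list_of_multiset (image_mset Re (proots ?p))"
  have p: "degree ?p = n" "?p \<noteq> 0" using degree_monic_char_poly[OF M] by auto
  have set: "set ?L = Re ` {e. eigenvalue M e}"
    using p(2) by (simp add: eigenvalue_root_char_poly[OF M])
  have "length ?L = n" by (metis mset_sorted_list_of_multiset p(1) size_image_mset size_mset size_proots_complex)
  then have "?L \<noteq> []" using n by auto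
  then have hd: "mat_eig M 1 = hd ?L" "hd ?L \<in> set ?L"
    by (simp add: mat_eig_def hd_conv_nth, rule hd_in_set)
  then show "\<exists>e. eigenvalue M e \<and> Re e = mat_eig M 1" unfolding set by auto
  show "mat_eig M 1 \<le> Re e" if "eigenvalue M e"
  proof -
    have "Re e \<in> set ?L" using that unfolding set by blast
    moreover have "sorted ?L" by (rule sorted_sorted_list_of_multiset)
    ultimately show ?thesis unfolding hd(1) by (cases ?L) auto
  qed
qed

lemma mat_eig_similar_diag:
  assumes "similar_mat M (mat_diag n (\<lambda>i. complex_of_real (s i)))"
  shows "mat_eig M k = sort (map s [0..<n]) ! (k - 1)"
proof -
  let ?D = "mat_diag n (\<lambda>i. complex_of_real (s i))"
  have D: "?D \<in> carrier_mat n n" "upper_triangular ?D"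
    by (auto simp: mat_diag_def)
  have "diag_mat ?D = map (\<lambda>i. complex_of_real (s i)) [0..<n]"
    by (rule nth_equalityI) (auto simp: diag_mat_def mat_diag_def)
  then have "char_poly M = (\<Prod>i\<leftarrow>[0..<n]. [:- complex_of_real (s i), 1:])"
    using char_poly_similar[OF assms] char_poly_upper_triangular[OF D] by (simp add: comp_def)
  moreover have "proots (\<Prod>i\<leftarrow>xs. [:- c i, 1:]) = mset (map c xs)" for xs :: "nat list" and c :: "nat \<Rightarrow> complex"
  proof (induction xs)
    case (Cons a xs)
    have "(\<Prod>i\<leftarrow>xs. [:- c i, 1:]) \<noteq> 0" by (auto simp: prod_list_zero_iff)
    then show ?case using Cons by (simp add: proots_mult del: mult_pCons_left)
  qed simp
  ultimately have "proots (char_poly M) = mset (map (\<lambda>i. complex_of_real (s i)) [0..<n])" by simp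
  then have "image_mset Re (proots (char_poly M)) = mset (map s [0..<n])"
    by (simp add: image_mset.compositionality comp_def)
  then show ?thesis unfolding mat_eig_def by (simp only: sorted_list_of_multiset_mset)
qed

section \<open>Compressions to finite-dimensional subspaces and the Ky Fan principle\<close>

lemma proj_bounded_linear: "orthonormal I e \<Longrightarrow> bounded_linear (proj I e)"
  by (rule bounded_linear_intro[where K = 1])
    (auto simp: proj_add proj_scaleC norm_proj_le scaleR_ell2_def)

lemma proj_diff: "proj I e (x - y) = proj I e x - proj I e y"
  using proj_add[of I e "x - y" y] by simp

lemma proj_scaleR: "proj I e (a *\<^sub>R x) = a *\<^sub>R proj I e x"
  by (simp add: scaleR_ell2_def proj_scaleC)

lemma proj_sum: "proj I e (sum g J) = (\<Sum>j\<in>J. proj I e (g j))"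
  by (induction J rule: infinite_finite_induct) (auto simp: proj_add proj_eq_0)

lemma csa_proj_compress:
  "compact_selfadjoint T \<Longrightarrow> orthonormal I e \<Longrightarrow> compact_selfadjoint (\<lambda>x. proj I e (T (proj I e x)))"
  by (rule csa_compress) (simp_all add: proj_add proj_scaleC cinner_proj_left norm_proj_le)

text \<open>A vector in the span of \<open>e\<close> missed by \<open>f\<close> would extend
  \<open>f\<close> to \<open>d + 1\<close> orthonormal vectors in a span of dimension
  \<open>d\<close>.\<close>

lemma orthonormal_complete:
  fixes d :: nat
  assumes e: "orthonormal {..<d} e" and f: "orthonormal {..<d} f"
    and fe: "\<And>i. i < d \<Longrightarrow> proj {..<d} e (f i) = f i" and x: "proj {..<d} e x = x"
  shows "proj {..<d} f x = x"
proof (rule ccontr)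
  assume neq: "proj {..<d} f x \<noteq> x"
  define z where "z = x - proj {..<d} f x"
  have z0: "z \<noteq> 0" using neq by (simp add: z_def)
  define u where "u = inverse (norm z) *\<^sub>R z"
  have "norm u = 1" using z0 by (simp add: u_def)
  moreover have "cinner (f i) u = 0" if "i < d" for i
    using cinner_diff_proj[OF f, of i x] that by (simp add: u_def z_def cinner_scaleR_right)
  ultimately have "orthonormal {..<Suc d} (f(d := u))" by (rule orthonormal_fun_upd[OF f])
  from orthonormal_escape[OF e this]
  obtain a where a: "a < Suc d" "proj {..<d} e ((f(d := u)) a) \<noteq> (f(d := u)) a" by auto
  have "proj {..<d} e (proj {..<d} f x) = proj {..<d} f x"
    unfolding proj_def[of "{..<d}" f] proj_sum proj_scaleC by (intro sum.cong) (auto simp: fe)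
  then have "proj {..<d} e u = u" by (simp add: u_def z_def proj_diff proj_scaleR x)
  with a fe show False by (cases "a = d") auto
qed

text \<open>For orthonormal \<open>e\<close> this is the matrix, in the basis \<open>e\<close>, of
  the compression of \<open>T\<close> to the span of \<open>e\<close>.\<close>

definition gram_mat :: "(ell2 \<Rightarrow> ell2) \<Rightarrow> nat \<Rightarrow> (nat \<Rightarrow> ell2) \<Rightarrow> complex Matrix.mat" where
  "gram_mat T d e = Matrix.mat d d (\<lambda>(a, b). cinner (e a) (T (e b)))"

text \<open>Eigenvectors of the compression are split off one at a time inside the span of
  \<open>e\<close>. They diagonalize the matrix unitarily, which identifies the roots that
  \<open>mat_eig\<close> sorts, and are finally reordered to match that sorting.\<close>

lemma gram_mat_spectral:
  assumes T: "compact_selfadjoint T" and e: "orthonormal {..<d} e"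
  obtains f t where "orthonormal {..<d} f" "\<And>i. i < d \<Longrightarrow> proj {..<d} e (f i) = f i"
    "\<And>i. i < d \<Longrightarrow> proj {..<d} e (T (f i)) = t i *\<^sub>R f i"
    "\<And>i j. i \<le> j \<Longrightarrow> j < d \<Longrightarrow> t i \<le> t j" "\<And>i. i < d \<Longrightarrow> mat_eig (gram_mat T d e) (Suc i) = t i"
proof -
  let ?p = "proj {..<d} e"
  let ?C = "\<lambda>x. ?p (T (?p x))"
  have C: "compact_selfadjoint ?C" by (rule csa_proj_compress[OF T e])
  have "\<exists>f s. orthonormal {..<n} f \<and> (\<forall>i<n. ?p (f i) = f i \<and> ?C (f i) = s i *\<^sub>R f i)" if "n \<le> d" for n
    using that
  proof (induction n)
    case 0
    show ?case by (simp add: orthonormal_def)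
  next
    case (Suc n)
    then obtain f s where f: "orthonormal {..<n} f"
      "\<And>i. i < n \<Longrightarrow> ?p (f i) = f i" "\<And>i. i < n \<Longrightarrow> ?C (f i) = s i *\<^sub>R f i" by force
    define S where "S = ocomp {..<n} f \<inter> {x. ?p x = x}"
    have "closed {x. ?p x = x}"
      by (intro closed_Collect_eq linear_continuous_on proj_bounded_linear[OF e] continuous_on_id)
    then have S: "closed S" unfolding S_def by (intro closed_Int closed_ocomp)
    have "subspace {x. ?p x = x}" by (auto simp: subspace_def proj_add proj_scaleR proj_eq_0)
    then have S': "subspace S" unfolding S_def by (intro subspace_inter subspace_ocomp)
    have inv: "?C x \<in> S" if "x \<in> S" for x
      using that csa_invariant_ocomp[OF C, of "{..<n}" f s x] f(3) by (auto simp: S_def proj_idem[OF e])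
    obtain a where a: "a < d" "e a - proj {..<n} f (e a) \<noteq> 0"
      using orthonormal_escape[OF f(1) e] Suc.prems by auto
    have "e a - proj {..<n} f (e a) \<in> S"
    proof -
      have "?p (e a) = e a" by (rule proj_member[OF e]) (use a(1) in simp)
      moreover have "?p (proj {..<n} f (e a)) = proj {..<n} f (e a)"
        unfolding proj_def[of "{..<n}" f] proj_sum proj_scaleC by (intro sum.cong) (auto simp: f(2))
      ultimately show ?thesis
        using cinner_diff_proj[OF f(1)] by (auto simp: S_def ocomp_def proj_diff)
    qed
    from csa_eigenvector_exists[OF C S S' inv this a(2)]
    obtain u \<sigma> where u: "u \<in> S" "norm u = 1" "?C u = \<sigma> *\<^sub>R u" by blast
    then have u': "?p u = u" "\<And>i. i < n \<Longrightarrow> cinner (f i) u = 0" by (auto simp: S_def ocomp_def)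
    have "orthonormal {..<Suc n} (f(n := u))"
      by (rule orthonormal_fun_upd[OF f(1) u(2) u'(2)])
    moreover have "\<forall>i<Suc n. ?p ((f(n := u)) i) = (f(n := u)) i \<and>
        ?C ((f(n := u)) i) = (s(n := \<sigma>)) i *\<^sub>R (f(n := u)) i"
      using f(2,3) u u' by (simp add: less_Suc_eq)
    ultimately show ?case by blast
  qed
  then obtain f s where f: "orthonormal {..<d} f" "\<And>i. i < d \<Longrightarrow> ?p (f i) = f i"
    and Cf: "\<And>i. i < d \<Longrightarrow> ?C (f i) = s i *\<^sub>R f i" by (metis order_refl)
  have Tf: "?p (T (f i)) = s i *\<^sub>R f i" if "i < d" for i using Cf[OF that] f(2)[OF that] by simp
  \<comment> \<open>The change of basis from \<open>f\<close> to \<open>e\<close>, and below it the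
    adjoint, which turns out to be the inverse.\<close>
  define Q where "Q = Matrix.mat d d (\<lambda>(a, i). cinner (e a) (f i))"
  define Qs where "Qs = Matrix.mat d d (\<lambda>(i, a). cinner (f i) (e a))"
  let ?M = "gram_mat T d e" and ?D = "mat_diag d (\<lambda>i. complex_of_real (s i))"
  have car: "Q \<in> carrier_mat d d" "Qs \<in> carrier_mat d d" "?M \<in> carrier_mat d d" "?D \<in> carrier_mat d d"
    by (auto simp: Q_def Qs_def gram_mat_def)
  have QsQ: "Qs * Q = 1\<^sub>m d"
  proof (rule eq_matI)
    fix i j assume "i < dim_row (1\<^sub>m d :: complex mat)" "j < dim_col (1\<^sub>m d :: complex mat)"
    then have ij: "i < d" "j < d" by auto
    have "(Qs * Q) $$ (i, j) = cinner (f i) (?p (f j))"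
      using ij by (simp add: Q_def Qs_def scalar_prod_def proj_def cinner_sum_right cinner_simps
          atLeast0LessThan mult.commute)
    then show "(Qs * Q) $$ (i, j) = 1\<^sub>m d $$ (i, j)"
      using ij by (simp add: f orthonormal_cinner[OF f(1)])
  qed (simp_all add: Q_def Qs_def)
  then have QQs: "Q * Qs = 1\<^sub>m d" by (rule mat_mult_left_right_inverse[OF car(2,1)])
  have MQ: "?M * Q = Q * ?D"
  proof (rule eq_matI)
    fix a i assume "a < dim_row (Q * ?D)" "i < dim_col (Q * ?D)"
    then have ai: "a < d" "i < d" using car by auto
    have "(?M * Q) $$ (a, i) = cinner (e a) (T (?p (f i)))"
      using ai by (simp add: Q_def gram_mat_def scalar_prod_def proj_def csa_sum[OF T] csa_scaleC[OF T]
          cinner_sum_right cinner_simps atLeast0LessThan mult.commute)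
    also have "\<dots> = cinner (e a) (?p (T (f i)))" using ai by (simp add: f cinner_proj[OF e])
    also have "\<dots> = (Q * ?D) $$ (a, i)"
      using ai by (simp add: Tf cinner_simps mat_diag_mult_right[OF car(1)]) (simp add: Q_def mult.commute)
    finally show "(?M * Q) $$ (a, i) = (Q * ?D) $$ (a, i)" .
  qed (simp_all add: Q_def gram_mat_def mat_diag_def)
  have "?M = ?M * (Q * Qs)" using car by (simp add: QQs)
  also have "\<dots> = Q * ?D * Qs" using car MQ by (metis assoc_mult_mat)
  finally have "?M = Q * ?D * Qs" .
  then have "similar_mat ?M ?D"
    using car QsQ QQs by (intro similar_matI[of _ _ Q Qs d]) blast+
  then have eig: "mat_eig ?M (Suc i) = sort (map s [0..<d]) ! i" for i
    by (simp add: mat_eig_similar_diag)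
  \<comment> \<open>A permutation carries the sorting of the eigenvalues over to the
    eigenvectors.\<close>
  have "mset (sort (map s [0..<d])) = mset (map s [0..<d])" by simp
  then obtain \<pi> where \<pi>: "\<pi> permutes {..<length (map s [0..<d])}"
    "permute_list \<pi> (map s [0..<d]) = sort (map s [0..<d])"
    by (rule mset_eq_permutation)
  then have perm: "\<pi> permutes {..<d}" by simp
  have lt: "\<pi> i < d" if "i < d" for i using permutes_in_image[OF perm, of i] that by simp
  have t: "sort (map s [0..<d]) ! i = s (\<pi> i)" if "i < d" for i
    using lt[OF that] that permute_list_nth[OF \<pi>(1), of i] by (simp flip: \<pi>(2))
  show ?thesis
  proof (rule that[of "f \<circ> \<pi>" "s \<circ> \<pi>"])
    show "orthonormal {..<d} (f \<circ> \<pi>)"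
      using f(1) lt permutes_inj[OF perm] by (auto simp: orthonormal_def dest: injD)
    show "?p ((f \<circ> \<pi>) i) = (f \<circ> \<pi>) i" if "i < d" for i using f(2) lt that by simp
    show "?p (T ((f \<circ> \<pi>) i)) = (s \<circ> \<pi>) i *\<^sub>R (f \<circ> \<pi>) i" if "i < d" for i using Tf lt that by simp
    show "mat_eig ?M (Suc i) = (s \<circ> \<pi>) i" if "i < d" for i using eig t that by simp
    show "(s \<circ> \<pi>) i \<le> (s \<circ> \<pi>) j" if "i \<le> j" "j < d" for i j
      using t[of i] t[of j] that sorted_nth_mono[OF sorted_sort, of i j "map s [0..<d]"] by simp
  qed
qed

lemma mat_eig_gram_mat_mono:
  assumes "compact_selfadjoint T" "orthonormal {..<d} e" "1 \<le> i" "i \<le> j" "j \<le> d"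
  shows "mat_eig (gram_mat T d e) i \<le> mat_eig (gram_mat T d e) j"
proof -
  obtain f t where "\<And>i j. i \<le> j \<Longrightarrow> j < d \<Longrightarrow> t i \<le> (t j :: real)"
    "\<And>i. i < d \<Longrightarrow> mat_eig (gram_mat T d e) (Suc i) = t i"
    using gram_mat_spectral[OF assms(1,2)] by metis
  from this(1)[of "i - 1" "j - 1"] this(2)[of "i - 1"] this(2)[of "j - 1"] show ?thesis
    using assms(3-) by simp
qed

text \<open>The bathtub principle: total weight \<open>n\<close> with at most 1 per index is
  cheapest on the \<open>n\<close> smallest values. Measured from the pivot
  \<open>t (n - 1)\<close>, moving weight away from the first \<open>n\<close> indices never lowers
  the sum, and the pivot terms cancel because both weights have total \<open>n\<close>.\<close>

lemma sum_smallest_le_weighted_sum: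
  fixes t q :: "nat \<Rightarrow> real"
  assumes mono: "\<And>i j. i \<le> j \<Longrightarrow> j < d \<Longrightarrow> t i \<le> t j" and "n \<le> d"
    and q: "\<And>i. i < d \<Longrightarrow> 0 \<le> q i" "\<And>i. i < d \<Longrightarrow> q i \<le> 1" and sum: "(\<Sum>i<d. q i) = real n"
  shows "(\<Sum>i<n. t i) \<le> (\<Sum>i<d. t i * q i)"
proof (cases "n = 0")
  case True
  then have "q i = 0" if "i < d" for i
    using sum q that sum_nonneg_eq_0_iff[of "{..<d}" q] by simp
  then show ?thesis using True by simp
next
  case False
  let ?b = "t (n - 1)" and ?g = "\<lambda>i. if i < n then 1 else 0 :: real"
  have g: "(\<Sum>i<d. h i * ?g i) = (\<Sum>i<n. h i)" for h
  proof -
    have "(\<Sum>i<n. h i) = (\<Sum>i<n. h i * ?g i)" by simp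
    also have "\<dots> = (\<Sum>i<d. h i * ?g i)" using \<open>n \<le> d\<close> by (intro sum.mono_neutral_left) auto
    finally show ?thesis by simp
  qed
  have "0 \<le> (t i - ?b) * (q i - ?g i)" if "i < d" for i
  proof (cases "i < n")
    case True
    then have "t i \<le> ?b" using False \<open>n \<le> d\<close> by (intro mono) auto
    then show ?thesis using q(2)[OF that] True by (intro mult_nonpos_nonpos) auto
  next
    case False
    then have "?b \<le> t i" using that by (intro mono) auto
    then show ?thesis using q(1)[OF that] False by (intro mult_nonneg_nonneg) auto
  qed
  then have "0 \<le> (\<Sum>i<d. (t i - ?b) * (q i - ?g i))" by (intro sum_nonneg) auto
  also have "\<dots> = (\<Sum>i<d. t i * q i) - ?b * (\<Sum>i<d. q i) - (\<Sum>i<d. t i * ?g i) + ?b * (\<Sum>i<d. 1 * ?g i)"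
    unfolding sum_distrib_left sum_subtractf[symmetric] sum.distrib[symmetric]
    by (intro sum.cong) (auto simp: algebra_simps)
  also have "\<dots> = (\<Sum>i<d. t i * q i) - (\<Sum>i<n. t i)" unfolding g sum by simp
  finally show ?thesis by simp
qed

text \<open>In an eigenbasis \<open>f\<close> of the compression the right-hand side is a weighted
  sum of the eigenvalues. The weights \<open>q i\<close> are at most 1 by Bessel for
  \<open>y\<close>, and their total is \<open>card K\<close> because each \<open>y k\<close> is a
  unit vector in the span of \<open>f\<close>.\<close>

lemma sum_mat_eig_le_sum_rayleigh:
  assumes T: "compact_selfadjoint T" and e: "orthonormal {..<d} e"
    and y: "orthonormal K y" "\<And>k. k \<in> K \<Longrightarrow> proj {..<d} e (y k) = y k"
  shows "(\<Sum>k=1..card K. mat_eig (gram_mat T d e) k) \<le> (\<Sum>k\<in>K. inner (y k) (T (y k)))"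
proof -
  obtain f t where f: "orthonormal {..<d} f" "\<And>i. i < d \<Longrightarrow> proj {..<d} e (f i) = f i"
    and Tf: "\<And>i. i < d \<Longrightarrow> proj {..<d} e (T (f i)) = t i *\<^sub>R f i"
    and t: "\<And>i j. i \<le> j \<Longrightarrow> j < d \<Longrightarrow> t i \<le> t j" "\<And>i. i < d \<Longrightarrow> mat_eig (gram_mat T d e) (Suc i) = t i"
    using gram_mat_spectral[OF T e] by metis
  have yf: "proj {..<d} f (y k) = y k" if "k \<in> K" for k
    by (rule orthonormal_complete[OF e f(1) f(2) y(2)[OF that]])
  have cardK: "card K \<le> d"
    using orthonormal_escape[OF e y(1)] y(2) by (fastforce simp: not_le)
  define q where "q i = (\<Sum>k\<in>K. (cmod (cinner (f i) (y k)))\<^sup>2)" for i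
  have ray: "inner (y k) (T (y k)) = (\<Sum>i<d. t i * (cmod (cinner (f i) (y k)))\<^sup>2)" if "k \<in> K" for k
  proof -
    let ?c = "\<lambda>i. cinner (f i) (y k)"
    have "cinner (y k) (T (y k)) = cinner (y k) (proj {..<d} e (T (proj {..<d} f (y k))))"
      using cinner_proj_left[of "{..<d}" e "y k"] yf[OF that] y(2)[OF that] by simp
    also have "proj {..<d} e (T (proj {..<d} f (y k))) = (\<Sum>i<d. (?c i * t i) *\<^sub>C f i)"
      unfolding proj_def[of _ f] csa_sum[OF T] csa_scaleC[OF T] proj_sum proj_scaleC
      by (intro sum.cong) (auto simp: Tf scaleR_ell2_def)
    also have "cinner (y k) \<dots> = (\<Sum>i<d. complex_of_real (t i * (cmod (?c i))\<^sup>2))"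
      unfolding cinner_sum_right cinner_simps
      by (intro sum.cong) (auto simp: cmod_sq cinner_commute[of "y k"])
    finally show ?thesis by (simp add: inner_eq_Re_cinner)
  qed
  have "(\<Sum>k=1..card K. mat_eig (gram_mat T d e) k) = (\<Sum>i<card K. t i)"
    using cardK t(2) by (simp add: sum.atLeast1_atMost_eq)
  also have "\<dots> \<le> (\<Sum>i<d. t i * q i)"
  proof (rule sum_smallest_le_weighted_sum[OF t(1) cardK])
    show "q i \<le> 1" if "i < d" for i
      using bessel[OF y(1), of "f i"] that orthonormal_norm[OF f(1)]
      by (simp add: q_def cinner_commute[of "f i"])
    have "(\<Sum>i<d. q i) = (\<Sum>k\<in>K. (norm (proj {..<d} f (y k)))\<^sup>2)"
      unfolding q_def norm_proj_sq[OF f(1)] by (rule sum.swap)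
    also have "\<dots> = card K" by (simp add: yf orthonormal_norm[OF y(1)])
    finally show "(\<Sum>i<d. q i) = real (card K)" .
  qed (auto simp: q_def sum_nonneg)
  also have "\<dots> = (\<Sum>k\<in>K. inner (y k) (T (y k)))"
    unfolding q_def sum_distrib_left by (subst sum.swap) (simp add: ray)
  finally show ?thesis .
qed

text \<open>The span of the eigenvectors and its complement are both invariant, so the form splits
  without cross terms. On the complement \<open>low\<close> applies; on the span the form falls
  short of \<open>b\<close> by \<open>b - t k\<close> in the direction \<open>v k\<close>.\<close>

lemma csa_rayleigh_split:
  assumes T: "compact_selfadjoint T" and v: "orthonormal I v"
    and ev: "\<And>k. k \<in> I \<Longrightarrow> T (v k) = t k *\<^sub>R v k"
    and low: "\<And>z. z \<in> ocomp I v \<Longrightarrow> b * (norm z)\<^sup>2 \<le> inner z (T z)"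
  shows "b * (norm u)\<^sup>2 - (\<Sum>k\<in>I. (b - t k) * (cmod (cinner (v k) u))\<^sup>2) \<le> inner u (T u)"
proof -
  define q where "q = proj I v u"
  define z where "z = u - q"
  have u: "u = q + z" by (simp add: z_def)
  have zo: "z \<in> ocomp I v" using cinner_diff_proj[OF v] by (simp add: ocomp_def z_def q_def)
  have Tq: "T q = (\<Sum>k\<in>I. (t k * cinner (v k) u) *\<^sub>C v k)"
    unfolding q_def proj_def csa_sum[OF T] csa_scaleC[OF T]
    by (intro sum.cong) (auto simp: ev scaleR_ell2_def mult.commute)
  have zTq: "cinner z (T q) = 0"
    unfolding Tq cinner_sum_right cinner_simps using zo
    by (intro sum.neutral) (auto simp: ocomp_def cinner_commute[of z])
  have "cinner q (T q) = (\<Sum>k\<in>I. cnj (cinner (v k) u) * (t k * cinner (v k) u))"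
    unfolding Tq unfolding q_def proj_def by (rule cinner_orthonormal_sums[OF v])
  also have "\<dots> = complex_of_real (\<Sum>k\<in>I. t k * (cmod (cinner (v k) u))\<^sup>2)"
    by (simp add: cmod_sq algebra_simps)
  finally have qTq: "inner q (T q) = (\<Sum>k\<in>I. t k * (cmod (cinner (v k) u))\<^sup>2)"
    by (simp add: inner_eq_Re_cinner)
  have "inner z (T q) = 0" using zTq by (simp add: inner_eq_Re_cinner)
  moreover from this have "inner q (T z) = 0" using csa_inner[OF T, of q z] by (simp add: inner_commute)
  ultimately have "inner u (T u) = inner q (T q) + inner z (T z)"
    unfolding u by (simp add: csa_add[OF T] inner_simps)
  moreover have "(norm z)\<^sup>2 = (norm u)\<^sup>2 - (\<Sum>k\<in>I. (cmod (cinner (v k) u))\<^sup>2)"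
    using norm_proj_pythagoras[OF v, of u] norm_proj_sq[OF v, of u] by (simp add: z_def q_def)
  moreover have "(\<Sum>k\<in>I. (b - t k) * (cmod (cinner (v k) u))\<^sup>2)
      = b * (\<Sum>k\<in>I. (cmod (cinner (v k) u))\<^sup>2) - inner q (T q)"
    unfolding qTq sum_distrib_left sum_subtractf[symmetric] by (simp add: algebra_simps)
  ultimately show ?thesis using low[OF zo] by (simp add: right_diff_distrib)
qed

subsection \<open>The matrix defining \<open>\<beta>\<close>\<close>

text \<open>The matrix whose smallest eigenvalue is \<beta>, with the eigenvectors \<open>v\<close>,
  the Ritz vectors \<open>x\<close> and \<open>b\<close> in the role of the eigenvalue of index
  \<open>l + 1\<close>.\<close>

locale angle_matrix =
  fixes l :: nat and v :: "nat \<Rightarrow> ell2" and J :: "nat set" and x :: "nat \<Rightarrow> ell2"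
    and t :: "nat \<Rightarrow> real" and b :: real and M :: "complex Matrix.mat"
  assumes l: "1 \<le> l" and v: "orthonormal {1..l} v" and x: "orthonormal J x"
    and t: "\<And>k. k \<in> {1..l} \<Longrightarrow> t 1 \<le> t k" "\<And>k. k \<in> {1..l} \<Longrightarrow> t k \<le> b"
    and M: "M \<in> carrier_mat l l"
    and entry: "\<And>i j. i < l \<Longrightarrow> j < l \<Longrightarrow> M $$ (i, j) = (if i = j then complex_of_real (t (Suc i) - t 1) else 0)
      - cinner (v (Suc i)) (proj J x (v (Suc j))) * complex_of_real (t (Suc j) - b)"
begin

text \<open>The vector V D c, where D is the diagonal matrix of the nonnegative numbers
  \<open>b - t k\<close>.\<close>

definition weighted :: "(nat \<Rightarrow> complex) \<Rightarrow> ell2" where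
  "weighted c = (\<Sum>k\<in>{1..l}. (complex_of_real (b - t k) * c k) *\<^sub>C v k)"

text \<open>Since V^* V = I, the diagonal part of \<open>M\<close> is (b - t 1) I - V^* V D, and
  combining it with the projected part leaves (b - t 1) I - V^* (I - P) V D.\<close>

lemma row_sum:
  assumes i: "i < l"
  shows "(\<Sum>j<l. M $$ (i, j) * c (Suc j)) =
    complex_of_real (b - t 1) * c (Suc i) - cinner (v (Suc i)) (weighted c - proj J x (weighted c))"
proof -
  define E where "E = (\<Sum>j<l. complex_of_real (b - t (Suc j)) * c (Suc j) * cinner (v (Suc i)) (proj J x (v (Suc j))))"
  have "cinner (v (Suc i)) (weighted c) = complex_of_real (b - t (Suc i)) * c (Suc i)"
    unfolding weighted_def by (rule cinner_orthonormal_sum[OF v]) (use i in auto)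
  moreover have "cinner (v (Suc i)) (proj J x (weighted c)) = E"
    unfolding E_def weighted_def proj_sum proj_scaleC cinner_sum_right cinner_simps
    by (simp add: sum.atLeast1_atMost_eq)
  moreover have "(\<Sum>j<l. M $$ (i, j) * c (Suc j)) =
      (\<Sum>j<l. if i = j then complex_of_real (t (Suc i) - t 1) * c (Suc i) else 0) + E"
    unfolding E_def sum.distrib[symmetric] using i by (intro sum.cong) (auto simp: entry algebra_simps)
  moreover have "(\<Sum>j<l. if i = j then complex_of_real (t (Suc i) - t 1) * c (Suc i) else 0) = complex_of_real (t (Suc i) - t 1) * c (Suc i)"
    using i by simp
  ultimately show ?thesis by (simp add: cinner_diff_right) (simp add: algebra_simps)
qed

lemma eigenvalue_iff_weighted:
  "eigenvalue M e \<longleftrightarrow> (\<exists>c. (\<exists>k\<in>{1..l}. c k \<noteq> 0) \<and>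
    (\<forall>k\<in>{1..l}. (complex_of_real (b - t 1) - e) * c k = cinner (v k) (weighted c - proj J x (weighted c))))"
    (is "_ \<longleftrightarrow> (\<exists>c. ?Q c)")
proof -
  have im: "{1..l} = Suc ` {..<l}" by (simp add: image_Suc_lessThan)
  have ball: "(\<forall>k\<in>{1..l}. R k) \<longleftrightarrow> (\<forall>i<l. R (Suc i))"
    and bex: "(\<exists>k\<in>{1..l}. R k) \<longleftrightarrow> (\<exists>i<l. R (Suc i))" for R :: "nat \<Rightarrow> bool"
    unfolding im by auto
  have swap: "p - q = r \<longleftrightarrow> p - r = q" for p q r :: complex by (auto simp: algebra_simps)
  have Q: "?Q c \<longleftrightarrow> (\<exists>i<l. c (Suc i) \<noteq> 0) \<and>
      (\<forall>i<l. (\<Sum>j<l. M $$ (i, j) * c (Suc j)) = e * c (Suc i))" for c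
  proof -
    have "((\<Sum>j<l. M $$ (i, j) * c (Suc j)) = e * c (Suc i)) \<longleftrightarrow> (complex_of_real (b - t 1) - e) * c (Suc i) =
      cinner (v (Suc i)) (weighted c - proj J x (weighted c))" if "i < l" for i
      unfolding row_sum[OF that] left_diff_distrib by (rule swap)
    then show ?thesis unfolding ball bex by blast
  qed
  show ?thesis
  proof
    assume "eigenvalue M e"
    then obtain c where "\<exists>i<l. c i \<noteq> 0" "\<forall>i<l. (\<Sum>j<l. M $$ (i, j) * c j) = e * c i"
      unfolding eigenvalue_iff_family[OF M] by blast
    \<comment> \<open>Matrix indices start at 0, those of the eigenvectors at 1.\<close>
    then have "?Q (\<lambda>k. c (k - 1))" unfolding Q by simp
    then show "\<exists>c. ?Q c" by (rule exI[where x = "\<lambda>k. c (k - 1)"])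
  next
    assume "\<exists>c. ?Q c"
    then obtain c where "?Q c" by (rule exE)
    then show "eigenvalue M e"
      unfolding Q eigenvalue_iff_family[OF M] by (intro exI[of _ "\<lambda>i. c (Suc i)"])
  qed
qed

text \<open>The eigenvector equation is paired with D c instead of c. With w =
  \<open>weighted c\<close>, the squared norm of (I - P) w becomes (b - t 1 - Re e) S, where S is
  the D-weighted squared norm of c, and the squared norm of w is at most (b - t 1) S.\<close>

lemma eigenvalue_bounds:
  assumes "eigenvalue M e"
  shows "0 \<le> Re e" "Re e \<le> b - t 1"
proof -
  obtain c k0 where k0: "k0 \<in> {1..l}" "c k0 \<noteq> 0"
    and c: "\<And>k. k \<in> {1..l} \<Longrightarrow> (complex_of_real (b - t 1) - e) * c k = cinner (v k) (weighted c - proj J x (weighted c))"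
    using assms unfolding eigenvalue_iff_weighted by blast
  let ?w = "weighted c"
  let ?z = "?w - proj J x ?w"
  define S where "S = (\<Sum>k\<in>{1..l}. (b - t k) * (cmod (c k))\<^sup>2)"
  have "cinner ?w ?z = cinner ?z ?z"
    by (simp add: cinner_simps cinner_proj_left proj_idem[OF x])
  then have "complex_of_real ((norm ?z)\<^sup>2) = cinner ?w ?z" by (simp add: cinner_self)
  also have "\<dots> = (\<Sum>k\<in>{1..l}. cnj (complex_of_real (b - t k) * c k) * cinner (v k) ?z)"
    unfolding weighted_def[of c] cinner_sum_left cinner_scaleC_left ..
  also have "\<dots> = (\<Sum>k\<in>{1..l}. (complex_of_real (b - t 1) - e) * complex_of_real ((b - t k) * (cmod (c k))\<^sup>2))"
    by (intro sum.cong) (auto simp: c[symmetric] cmod_sq)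
  also have "\<dots> = (complex_of_real (b - t 1) - e) * complex_of_real S"
    by (simp add: S_def sum_distrib_left)
  finally have "Re (complex_of_real ((norm ?z)\<^sup>2)) = Re ((complex_of_real (b - t 1) - e) * complex_of_real S)" by simp
  then have eq: "(norm ?z)\<^sup>2 = (b - t 1 - Re e) * S" by simp
  have "(norm ?w)\<^sup>2 = (\<Sum>k\<in>{1..l}. (b - t k)\<^sup>2 * (cmod (c k))\<^sup>2)"
    unfolding weighted_def norm_orthonormal_sum[OF v]
    by (intro sum.cong) (auto simp: norm_mult power_mult_distrib simp flip: of_real_diff)
  also have "\<dots> \<le> (\<Sum>k\<in>{1..l}. (b - t 1) * ((b - t k) * (cmod (c k))\<^sup>2))"
  proof (rule sum_mono)
    fix k assume "k \<in> {1..l}"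
    then have "(b - t k) * (b - t k) \<le> (b - t 1) * (b - t k)"
      using t by (intro mult_right_mono) auto
    from mult_right_mono[OF this, of "(cmod (c k))\<^sup>2"]
    show "(b - t k)\<^sup>2 * (cmod (c k))\<^sup>2 \<le> (b - t 1) * ((b - t k) * (cmod (c k))\<^sup>2)"
      by (simp add: power2_eq_square mult.assoc)
  qed
  also have "\<dots> = (b - t 1) * S" by (simp add: S_def sum_distrib_left)
  finally have le: "(norm ?z)\<^sup>2 \<le> (b - t 1) * S"
    using norm_diff_proj_le[OF x, of ?w] by (meson norm_ge_zero order_trans power_mono)
  have bt: "t 1 \<le> b" using t l by force
  have S0: "0 \<le> S" unfolding S_def using t by (intro sum_nonneg mult_nonneg_nonneg) auto
  have "0 \<le> Re e \<and> Re e \<le> b - t 1"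
  proof (cases "S = 0")
    \<comment> \<open>Then c lives only where \<open>t k = b\<close>, so the weighted vector is 0
      and the equation leaves e = b - t 1.\<close>
    case True
    then have "(b - t k) * (cmod (c k))\<^sup>2 = 0" if "k \<in> {1..l}" for k
      using that t unfolding S_def by (subst (asm) sum_nonneg_eq_0_iff) auto
    then have "?w = 0" unfolding weighted_def by (intro sum.neutral) (auto simp flip: of_real_diff)
    then have "complex_of_real (b - t 1) - e = 0" using c[OF k0(1)] k0(2) by (simp add: proj_eq_0)
    then have "e = complex_of_real (b - t 1)" by simp
    then show ?thesis using bt by simp
  next
    case False
    with S0 have S: "0 < S" by simp
    have "0 \<le> (b - t 1 - Re e) * S" by (metis eq zero_le_power2)
    then have "0 \<le> b - t 1 - Re e" using S by (simp add: zero_le_mult_iff)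
    moreover have "(b - t 1 - Re e) * S \<le> (b - t 1) * S" using le eq by simp
    then have "b - t 1 - Re e \<le> b - t 1" using S by simp
    ultimately show ?thesis by simp
  qed
  then show "0 \<le> Re e" "Re e \<le> b - t 1" by auto
qed

lemma mat_eig_bounds: "0 \<le> mat_eig M 1" "mat_eig M 1 \<le> b - t 1"
proof -
  obtain e where e: "eigenvalue M e" "Re e = mat_eig M 1" using mat_eig_one(1)[OF M] l by auto
  then show "0 \<le> mat_eig M 1" "mat_eig M 1 \<le> b - t 1"
    using eigenvalue_bounds[OF e(1)] by simp_all
qed

text \<open>The largest value of the form \<open>\<Sum>k. (b - t k) * \<bar>\<langle>v k, u\<rangle>\<bar>\<^sup>2\<close> over unit vectors \<open>u\<close>
  orthogonal to the \<open>x k\<close> is an eigenvalue of the compression of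
  \<open>\<Sum>k. (b - t k) * \<langle>v k, \<cdot>\<rangle> v k\<close>, and such an eigenvalue gives one of \<^term>\<open>M\<close>.\<close>

lemma quadratic_form_le:
  assumes u: "norm u = 1" "u \<in> ocomp J x"
  shows "(\<Sum>k\<in>{1..l}. (b - t k) * (cmod (cinner (v k) u))\<^sup>2) \<le> b - t 1 - mat_eig M 1"
proof -
  define R where "R y = (\<Sum>k\<in>{1..l}. (b - t k) *\<^sub>R cinner (v k) y *\<^sub>C v k)" for y
  define Q where "Q y = y - proj J x y" for y
  have R: "compact_selfadjoint R"
    unfolding R_def by (intro csa_sum_op csa_scale csa_rank_one)
  have C: "compact_selfadjoint (\<lambda>y. Q (R (Q y)))"
    by (rule csa_compress[OF R])
      (simp_all add: Q_def proj_add proj_scaleC scaleC_simps cinner_simps cinner_proj_left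
        norm_diff_proj_le[OF x])
  have Rw: "R y = weighted (\<lambda>k. cinner (v k) y)" for y
    unfolding R_def weighted_def by (intro sum.cong) (auto simp: scaleR_ell2_def)
  have QQ: "Q (Q y) = Q y" for y by (simp add: Q_def proj_diff proj_idem[OF x])
  have Qadj: "inner (Q y) z = inner y (Q z)" for y z
    by (simp add: Q_def inner_eq_Re_cinner cinner_simps cinner_proj_left)
  have Qu: "Q u = u" using u(2) by (simp add: Q_def ocomp_def proj_eq_0)
  define s0 where "s0 = (\<Sum>k\<in>{1..l}. (b - t k) * (cmod (cinner (v k) u))\<^sup>2)"
  have "cinner u (R u) = complex_of_real s0"
    unfolding R_def s0_def cinner_sum_right cinner_simps of_real_sum
    by (intro sum.cong) (auto simp: cinner_commute[of u] cmod_sq)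
  then have s0: "inner u (Q (R (Q u))) = s0"
    unfolding Qadj[symmetric] Qu by (simp add: inner_eq_Re_cinner)
  \<comment> \<open>Positivity of \<open>s0\<close> makes the negated form take a negative value, as
    the minimum principle requires. In the other case the upper bound b - t 1 suffices.\<close>
  have "mat_eig M 1 \<le> b - t 1 - s0" if "s0 > 0"
  proof -
    have "inner u ((-1) *\<^sub>R Q (R (Q u))) < 0" using s0 that by simp
    from csa_min_eigenvector[OF csa_scale[OF C, of "-1"] closed_UNIV subspace_UNIV _ _ this]
    obtain y s where y: "s < 0" "norm y = 1" "(-1) *\<^sub>R Q (R (Q y)) = s *\<^sub>R y"
      and min: "\<And>z. s * (norm z)\<^sup>2 \<le> inner z ((-1) *\<^sub>R Q (R (Q z)))" by auto
    define \<tau> where "\<tau> = - s"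
    have \<tau>: "\<tau> > 0" "s0 \<le> \<tau>" using y(1) min[of u] s0 u(1) by (auto simp: \<tau>_def)
    have "- Q (R (Q y)) = s *\<^sub>R y" using y(3) by simp
    then have Cy: "Q (R (Q y)) = \<tau> *\<^sub>R y" by (metis \<tau>_def minus_minus scaleR_minus_left)
    \<comment> \<open>An eigenvector of the compression for a nonzero eigenvalue lies in the range
      of \<open>Q\<close>.\<close>
    have "\<tau> *\<^sub>R Q y = Q (\<tau> *\<^sub>R y)" by (simp add: Q_def proj_scaleR scaleR_diff_right)
    also have "\<dots> = \<tau> *\<^sub>R y" unfolding Cy[symmetric] QQ ..
    finally have "Q y = y" using \<tau>(1) by simp
    with Cy have QR: "Q (R y) = \<tau> *\<^sub>R y" by simp
    have "y \<noteq> 0" using y(2) by auto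
    have "R y \<noteq> 0" using QR \<tau>(1) \<open>y \<noteq> 0\<close> by (auto simp: Q_def proj_eq_0)
    then have "\<exists>k\<in>{1..l}. cinner (v k) y \<noteq> 0" unfolding R_def by (auto intro: sum.neutral)
    moreover have "\<forall>k\<in>{1..l}. (complex_of_real (b - t 1) - complex_of_real (b - t 1 - \<tau>)) * cinner (v k) y
        = cinner (v k) (R y - proj J x (R y))"
      using QR by (simp add: Q_def cinner_simps)
    ultimately have "eigenvalue M (complex_of_real (b - t 1 - \<tau>))"
      unfolding eigenvalue_iff_weighted Rw by (intro exI[where x = "\<lambda>k. cinner (v k) y"] conjI)
    from mat_eig_one(2)[OF M _ this] have "mat_eig M 1 \<le> b - t 1 - \<tau>" using l by simp
    with \<tau> show ?thesis by simp
  qed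
  then show ?thesis unfolding s0_def[symmetric] using mat_eig_bounds(2) by (cases "s0 > 0") auto
qed

end

subsection \<open>The smaller eigenvalue of a symmetric two by two matrix\<close>

text \<open>The subtracted fraction \<open>s\<close> is the nonnegative root of s (s + g) = \<rho>^2
  with g = |a - \<eta>|. Hence (a - m) (\<eta> - m) = \<rho>^2 with both factors nonnegative, and
  the last claim says that a square of a difference is nonnegative.\<close>

lemma quadratic_residual_bound:
  fixes a \<eta> \<rho> :: real
  assumes "\<rho> \<ge> 0"
  defines "m \<equiv> min a \<eta> - 2 * \<rho>\<^sup>2 / (\<bar>a - \<eta>\<bar> + sqrt ((a - \<eta>)\<^sup>2 + 4 * \<rho>\<^sup>2))"
  shows "0 \<le> a - m" "a - m \<le> max (a - \<eta>) 0 + \<rho>"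
    and "0 \<le> p \<Longrightarrow> 0 \<le> q \<Longrightarrow> m * (p\<^sup>2 + q\<^sup>2) \<le> a * p\<^sup>2 - 2 * \<rho> * p * q + \<eta> * q\<^sup>2"
proof -
  define g where "g = \<bar>a - \<eta>\<bar>"
  define R where "R = sqrt ((a - \<eta>)\<^sup>2 + 4 * \<rho>\<^sup>2)"
  define s where "s = 2 * \<rho>\<^sup>2 / (g + R)"
  have m: "m = min a \<eta> - s" by (simp add: m_def s_def g_def R_def)
  have g: "g \<ge> 0" by (simp add: g_def)
  have R2: "R\<^sup>2 = g\<^sup>2 + 4 * \<rho>\<^sup>2" by (simp add: R_def g_def)
  have R: "2 * \<rho> \<le> R" unfolding R_def by (rule real_le_rsqrt) (simp add: power_mult_distrib)
  have "s \<ge> 0 \<and> s \<le> \<rho> \<and> s * (s + g) = \<rho>\<^sup>2"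
  \<comment> \<open>This case contains the fraction 0/0, which evaluates to 0.\<close>
  proof (cases "\<rho> = 0")
    case True
    then show ?thesis by (simp add: s_def)
  next
    case False
    then have pos: "g + R > 0" using R g assms(1) by linarith
    \<comment> \<open>Rationalizing the denominator turns the fraction into the usual root
      formula.\<close>
    have "(R - g) / 2 * (g + R) = 2 * \<rho>\<^sup>2" using R2 by (simp add: algebra_simps power2_eq_square)
    then have s: "s = (R - g) / 2" unfolding s_def using pos by (simp add: field_simps)
    have "s * (s + g) = \<rho>\<^sup>2" unfolding s using R2 by (simp add: field_simps power2_eq_square)
    moreover have "s \<ge> 0" unfolding s_def using pos by simp
    moreover have "s \<le> \<rho>"
    proof -
      have "2 * \<rho>\<^sup>2 \<le> \<rho> * (g + R)"
        using mult_left_mono[of "2 * \<rho>" "g + R" \<rho>] R g assms(1) by (simp add: power2_eq_square)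
      then show ?thesis unfolding s_def using pos by (simp add: field_simps)
    qed
    ultimately show ?thesis by blast
  qed
  then have s: "s \<ge> 0" "s \<le> \<rho>" "s * (s + g) = \<rho>\<^sup>2" by auto
  show "0 \<le> a - m" "a - m \<le> max (a - \<eta>) 0 + \<rho>" using s(1,2) by (auto simp: m)
  show "m * (p\<^sup>2 + q\<^sup>2) \<le> a * p\<^sup>2 - 2 * \<rho> * p * q + \<eta> * q\<^sup>2" if pq: "0 \<le> p" "0 \<le> q"
  proof -
    have nn: "a - m \<ge> 0" "\<eta> - m \<ge> 0" using s(1) by (auto simp: m)
    have "(a - m) * (\<eta> - m) = \<rho>\<^sup>2"
    proof (cases "a \<le> \<eta>")
      case True
      then have "a - m = s" "\<eta> - m = s + g" by (auto simp: m g_def)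
      then show ?thesis using s(3) by simp
    next
      case False
      then have "\<eta> - m = s" "a - m = s + g" by (auto simp: m g_def)
      then show ?thesis using s(3) by (simp add: mult.commute)
    qed
    then have "sqrt (a - m) * sqrt (\<eta> - m) = \<rho>"
      using assms(1) by (simp flip: real_sqrt_mult)
    moreover have "0 \<le> (sqrt (a - m) * p - sqrt (\<eta> - m) * q)\<^sup>2" by simp
    ultimately have "2 * \<rho> * p * q \<le> (a - m) * p\<^sup>2 + (\<eta> - m) * q\<^sup>2"
      using nn by (simp add: power2_diff power_mult_distrib algebra_simps)
    then show ?thesis by (simp add: algebra_simps)
  qed
qed

subsection \<open>Frames and isometries\<close>

lemma cscalar_prod_sum:
  "y \<in> carrier_vec n \<Longrightarrow> x \<bullet>c y = (\<Sum>i<n. vec_index x i * cnj (vec_index y i))"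
  for x y :: "complex Matrix.vec"
  by (simp add: scalar_prod_def atLeast0LessThan)

lemma cvec_norm_sq: "x \<in> carrier_vec n \<Longrightarrow> (cvec_norm x)\<^sup>2 = (\<Sum>i<n. (cmod (vec_index x i))\<^sup>2)"
proof -
  assume x: "x \<in> carrier_vec n"
  have "x \<bullet>c x = complex_of_real (\<Sum>i<n. (cmod (vec_index x i))\<^sup>2)"
    unfolding cscalar_prod_sum[OF x] by (simp add: cmod_sq)
  then show ?thesis unfolding cvec_norm_def by (simp add: sum_nonneg)
qed

lemma cvec_norm_nonneg: "x \<in> carrier_vec n \<Longrightarrow> 0 \<le> cvec_norm x"
  unfolding cvec_norm_def by (simp add: cscalar_prod_sum sum_nonneg flip: complex_norm_square)

text \<open>Only norms are known to be preserved. Orthogonality of the images is recovered by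
  polarization, with z = 1 for the real part and z = \<open>\<i>\<close> for the imaginary
  part.\<close>

lemma isometry_onto_frame:
  assumes iso: "isometry_onto d V X"
  shows "orthonormal {..<d} (\<lambda>a. V (unit_vec d a))"
    and "c \<in> carrier_vec d \<Longrightarrow> V c = (\<Sum>a<d. vec_index c a *\<^sub>C V (unit_vec d a))"
    and "y \<in> X \<Longrightarrow> proj {..<d} (\<lambda>a. V (unit_vec d a)) y = y"
proof -
  let ?e = "\<lambda>a. V (unit_vec d a)"
  have add: "\<And>x y. x \<in> carrier_vec d \<Longrightarrow> y \<in> carrier_vec d \<Longrightarrow> V (x + y) = V x + V y"
    and scale: "\<And>c x. x \<in> carrier_vec d \<Longrightarrow> V (c \<cdot>\<^sub>v x) = c *\<^sub>C V x"
    and norm: "\<And>x. x \<in> carrier_vec d \<Longrightarrow> (norm (V x))\<^sup>2 = (\<Sum>i<d. (cmod (vec_index x i))\<^sup>2)"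
    and image: "V ` carrier_vec d = X"
    using iso cvec_norm_sq by (auto simp: isometry_onto_def)
  have norm1: "(norm (?e a))\<^sup>2 = 1" if "a < d" for a
  proof -
    have "(norm (?e a))\<^sup>2 = (\<Sum>i<d. if i = a then 1 else 0)"
      unfolding norm[OF unit_vec_carrier] using that by (intro sum.cong) auto
    then show ?thesis using that by simp
  qed
  have orth: "Re (z * cinner (?e a) (?e b)) = 0" if "a < d" "b < d" "a \<noteq> b" "cmod z = 1" for a b z
  proof -
    let ?s = "unit_vec d a + z \<cdot>\<^sub>v unit_vec d b"
    have "V ?s = ?e a + z *\<^sub>C ?e b" using that by (simp add: add scale)
    moreover have "(norm (V ?s))\<^sup>2 = (\<Sum>i<d. (if i = a then 1 else 0) + (if i = b then 1 else 0))"
    proof -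
      have "?s \<in> carrier_vec d" by simp
      from norm[OF this] show ?thesis using that by (simp only:) (intro sum.cong; auto)
    qed
    then have "(norm (V ?s))\<^sup>2 = 2" using that by (simp add: sum.distrib)
    moreover have "(norm (z *\<^sub>C ?e b))\<^sup>2 = 1" using norm1[OF that(2)] that(4) by (simp add: norm_scaleC)
    ultimately have "inner (?e a) (z *\<^sub>C ?e b) = 0"
      using norm1[OF that(1)] by (simp add: power2_norm_eq_inner inner_simps inner_commute)
    then show ?thesis by (simp add: inner_eq_Re_cinner cinner_simps)
  qed
  have "cinner (?e a) (?e b) = (if a = b then 1 else 0)" if "a < d" "b < d" for a b
  proof (cases "a = b")
    case True
    then show ?thesis using norm1[OF that(1)] by (simp add: cinner_self flip: of_real_power)
  next
    case False
    then show ?thesis using orth[OF that False, of 1] orth[OF that False, of \<i>] by (simp add: complex_eq_iff)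
  qed
  then show on: "orthonormal {..<d} ?e" by (simp add: orthonormal_def)
  show expand: "V c = (\<Sum>a<d. vec_index c a *\<^sub>C ?e a)" if c: "c \<in> carrier_vec d" for c
  proof -
    \<comment> \<open>Additivity is available for two vectors at a time, so the coordinates are
      switched on one by one.\<close>
    have "V (Matrix.vec d (\<lambda>i. if i < n then vec_index c i else 0)) = (\<Sum>a<n. vec_index c a *\<^sub>C ?e a)"
      if "n \<le> d" for n using that
    proof (induction n)
      case 0
      have "Matrix.vec d (\<lambda>i. 0) = (0::complex) \<cdot>\<^sub>v 0\<^sub>v d" by (intro eq_vecI) auto
      then show ?case using scale[of "0\<^sub>v d" 0] by simp
    next
      case (Suc n)
      have "Matrix.vec d (\<lambda>i. if i < Suc n then vec_index c i else 0) =
          Matrix.vec d (\<lambda>i. if i < n then vec_index c i else 0) + vec_index c n \<cdot>\<^sub>v unit_vec d n"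
        by (intro eq_vecI) (auto simp: less_Suc_eq unit_vec_def)
      then show ?case using Suc by (simp add: add scale)
    qed
    from this[of d] have "V (Matrix.vec d (\<lambda>i. if i < d then vec_index c i else 0)) =
        (\<Sum>a<d. vec_index c a *\<^sub>C ?e a)" by simp
    moreover have "Matrix.vec d (\<lambda>i. if i < d then vec_index c i else 0) = c"
      using c by (intro eq_vecI) auto
    ultimately show ?thesis by simp
  qed
  show "proj {..<d} ?e y = y" if yX: "y \<in> X"
  proof -
    obtain c where "c \<in> carrier_vec d" "y = V c" using yX image by blast
    then show ?thesis using expand proj_orthonormal_sum[OF on] by simp
  qed
qed

lemma frame_unit: "k \<in> {1..n} \<Longrightarrow> frame n f (unit_vec n (k - 1)) = f k"
proof -
  assume k: "k \<in> {1..n}"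
  have "frame n f (unit_vec n (k - 1)) = (\<Sum>i\<in>{1..n}. if i = k then f k else 0)"
    unfolding frame_def using k by (intro sum.cong) auto
  then show ?thesis using k by simp
qed

text \<open>Replaces the products U U^* of the definitions by \<open>proj\<close>, removing
  coefficient vectors from the later arguments.\<close>

lemma frame_adj: "frame n f (adj n (frame n f) z) = proj {1..n} f z"
  unfolding frame_def[of n f "adj n _ z"] proj_def
proof (rule sum.cong)
  fix k assume k: "k \<in> {1..n}"
  then have "k - 1 < n" by auto
  then have "vec_index (adj n (frame n f) z) (k - 1) = cinner (frame n f (unit_vec n (k - 1))) z"
    by (simp add: adj_def)
  then show "vec_index (adj n (frame n f) z) (k - 1) *\<^sub>C f k = cinner (f k) z *\<^sub>C f k"
    by (simp only: frame_unit[OF k])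
qed simp

lemma norm_frame:
  assumes "orthonormal {1..n} f" "c \<in> carrier_vec n"
  shows "norm (frame n f c) = cvec_norm c"
proof -
  have "(norm (frame n f c))\<^sup>2 = (cvec_norm c)\<^sup>2"
    unfolding frame_def norm_orthonormal_sum[OF assms(1)] cvec_norm_sq[OF assms(2)]
    by (simp add: sum.atLeast1_atMost_eq)
  then show ?thesis using cvec_norm_nonneg[OF assms(2)] by (simp add: power2_eq_iff_nonneg)
qed

lemma frame_image_ball:
  assumes f: "orthonormal {1..n} f"
  shows "frame n f ` {c \<in> carrier_vec n. cvec_norm c \<le> 1} = {p. proj {1..n} f p = p \<and> norm p \<le> 1}"
proof (intro equalityI subsetI)
  fix p assume "p \<in> frame n f ` {c \<in> carrier_vec n. cvec_norm c \<le> 1}"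
  then show "p \<in> {p. proj {1..n} f p = p \<and> norm p \<le> 1}"
    using norm_frame[OF f] proj_orthonormal_sum[OF f] by (auto simp: frame_def)
next
  fix p assume p: "p \<in> {p. proj {1..n} f p = p \<and> norm p \<le> 1}"
  let ?c = "adj n (frame n f) p"
  have c: "?c \<in> carrier_vec n" by (simp add: adj_def)
  have "frame n f ?c = p" using p by (simp add: frame_adj)
  then show "p \<in> frame n f ` {c \<in> carrier_vec n. cvec_norm c \<le> 1}"
    using c norm_frame[OF f c] p by (intro image_eqI[of _ _ ?c]) auto
qed

lemma op_norm_frame:
  assumes "orthonormal {1..n} f"
  shows "op_norm n (\<lambda>c. g (frame n f c)) = (SUP p\<in>{p. proj {1..n} f p = p \<and> norm p \<le> 1}. norm (g p))"
  unfolding op_norm_def frame_image_ball[OF assms, symmetric] by (simp add: image_image)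

subsection \<open>Parameter-dependent operators\<close>

lemma csa_par_op: "(\<And>m. compact_selfadjoint (A m)) \<Longrightarrow> compact_selfadjoint (par_op A \<theta> \<mu>)"
  unfolding par_op_def by (intro csa_sum_op csa_scale)

lemma norm_sum_scaleR_le:
  fixes A :: "'k::finite \<Rightarrow> ell2 \<Rightarrow> ell2" and a :: "real^'k"
  assumes "\<And>m z. norm (A m z) \<le> \<kappa> m * norm z"
  shows "norm (\<Sum>m\<in>UNIV. (a $ m) *\<^sub>R A m z) \<le> norm a * sum \<kappa> UNIV * norm z"
proof -
  have "norm (\<Sum>m\<in>UNIV. (a $ m) *\<^sub>R A m z) \<le> (\<Sum>m\<in>UNIV. norm a * (\<kappa> m * norm z))"
  proof (rule sum_norm_le)
    fix m
    have "norm ((a $ m) *\<^sub>R A m z) = \<bar>a $ m\<bar> * norm (A m z)" by simp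
    also have "\<dots> \<le> norm a * (\<kappa> m * norm z)"
      by (intro mult_mono assms component_le_norm_cart) auto
    finally show "norm ((a $ m) *\<^sub>R A m z) \<le> norm a * (\<kappa> m * norm z)" .
  qed
  then show ?thesis by (simp add: sum_distrib_left sum_distrib_right mult.assoc)
qed

lemma norm_par_op_le:
  assumes "\<And>m z. norm (A m z) \<le> \<kappa> m * norm z"
  shows "norm (par_op A \<theta> \<mu> z) \<le> norm (\<theta> \<mu>) * sum \<kappa> UNIV * norm z"
  unfolding par_op_def by (rule norm_sum_scaleR_le[of A \<kappa>, OF assms])

lemma norm_par_op_diff_le:
  assumes "\<And>m z. norm (A m z) \<le> \<kappa> m * norm z"
  shows "norm (par_op A \<theta> \<mu> z - par_op A \<theta> \<nu> z) \<le> norm (\<theta> \<mu> - \<theta> \<nu>) * sum \<kappa> UNIV * norm z"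
proof -
  have "par_op A \<theta> \<mu> z - par_op A \<theta> \<nu> z = (\<Sum>m\<in>UNIV. ((\<theta> \<mu> - \<theta> \<nu>) $ m) *\<^sub>R A m z)"
    by (simp add: par_op_def scaleR_diff_left sum_subtractf)
  then show ?thesis by (simp only: norm_sum_scaleR_le[of A \<kappa>, OF assms])
qed

text \<open>The link to the linear program: the form at \<open>u\<close> is the objective at the
  vector of the forms of the single operators.\<close>

lemma inner_par_op:
  "inner u (par_op A \<theta> \<mu> u) = inner (\<theta> \<mu>) (\<chi> m. inner u (A m u))"
  by (simp add: par_op_def inner_vec_def inner_sum_right)

lemma abs_rayleigh_le:
  fixes z :: ell2 and k :: real
  assumes "\<And>z. norm (T z) \<le> k * norm z" and "z \<noteq> 0"
  shows "\<bar>inner z (T z) / (norm z)\<^sup>2\<bar> \<le> k"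
proof -
  have "\<bar>inner z (T z)\<bar> \<le> norm z * (k * norm z)"
    by (rule order_trans[OF Cauchy_Schwarz_ineq2 mult_left_mono[OF assms(1)]]) simp
  then show ?thesis using assms(2) by (simp add: field_simps power2_eq_square)
qed

lemma ell2_nonzero: "(- {0} :: ell2 set) \<noteq> {}"
proof -
  have "unit_ell2 0 \<noteq> 0" using cinner_unit_ell2[of 0 0] by auto
  then show ?thesis by blast
qed

lemma norm_box_le:
  assumes "\<And>m z. norm (A m z) \<le> \<kappa> m * norm z" and y: "y \<in> box A"
  shows "norm y \<le> sum \<kappa> UNIV"
proof -
  have R: "- \<kappa> m \<le> inner z (A m z) / (norm z)\<^sup>2" "inner z (A m z) / (norm z)\<^sup>2 \<le> \<kappa> m"
    if "z \<in> - {0}" for z m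
  proof -
    have "\<bar>inner z (A m z) / (norm z)\<^sup>2\<bar> \<le> \<kappa> m"
      by (rule abs_rayleigh_le[OF assms(1)]) (use that in simp)
    from abs_le_D1[OF this] abs_le_D2[OF this]
    show "- \<kappa> m \<le> inner z (A m z) / (norm z)\<^sup>2" "inner z (A m z) / (norm z)\<^sup>2 \<le> \<kappa> m" by linarith+
  qed
  have lo: "- \<kappa> m \<le> rayleigh_min (A m)" for m
    unfolding rayleigh_min_def by (intro cINF_greatest ell2_nonzero R)
  have hi: "rayleigh_max (A m) \<le> \<kappa> m" for m
    unfolding rayleigh_max_def by (intro cSUP_least ell2_nonzero R)
  have "\<bar>y $ m\<bar> \<le> \<kappa> m" for m
  proof -
    have "rayleigh_min (A m) \<le> y $ m" "y $ m \<le> rayleigh_max (A m)" using y by (auto simp: box_def)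
    with lo[of m] hi[of m] show ?thesis by linarith
  qed
  then have "(\<Sum>m\<in>UNIV. \<bar>y $ m\<bar>) \<le> sum \<kappa> UNIV" by (intro sum_mono)
  then show ?thesis using norm_le_l1_cart[of y] by linarith
qed

lemma rayleigh_in_box:
  assumes "\<And>m z. norm (A m z) \<le> \<kappa> m * norm z" and u: "norm u = 1"
  shows "(\<chi> m. inner u (A m u)) \<in> box A"
proof -
  have R: "- \<kappa> m \<le> inner z (A m z) / (norm z)\<^sup>2" "inner z (A m z) / (norm z)\<^sup>2 \<le> \<kappa> m"
    if "z \<in> - {0}" for z m
  proof -
    have "\<bar>inner z (A m z) / (norm z)\<^sup>2\<bar> \<le> \<kappa> m"
      by (rule abs_rayleigh_le[OF assms(1)]) (use that in simp)
    from abs_le_D1[OF this] abs_le_D2[OF this]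
    show "- \<kappa> m \<le> inner z (A m z) / (norm z)\<^sup>2" "inner z (A m z) / (norm z)\<^sup>2 \<le> \<kappa> m" by linarith+
  qed
  have u0: "u \<in> - {0}" using u by auto
  have "rayleigh_min (A m) \<le> inner u (A m u) / (norm u)\<^sup>2" for m
    unfolding rayleigh_min_def
    by (intro cINF_lower[OF _ u0] bdd_belowI2[of _ "- \<kappa> m"] R)
  moreover have "inner u (A m u) / (norm u)\<^sup>2 \<le> rayleigh_max (A m)" for m
    unfolding rayleigh_max_def
    by (intro cSUP_upper[OF u0] bdd_aboveI2[of _ _ "\<kappa> m"] R)
  ultimately show ?thesis using u by (simp add: box_def)
qed

lemma abs_eig_le:
  assumes "\<And>m. compact_selfadjoint (A m)" and "\<And>m z. norm (A m z) \<le> \<kappa> m * norm z"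
    and "\<exists>t. is_kth_eig (par_op A \<theta> \<mu>) k t"
  shows "\<bar>eig A \<theta> k \<mu>\<bar> \<le> norm (\<theta> \<mu>) * sum \<kappa> UNIV"
proof -
  obtain u where "norm u = 1" "par_op A \<theta> \<mu> u = eig A \<theta> k \<mu> *\<^sub>R u"
    unfolding eig_def
    by (rule is_kth_eig_eigenvector[OF is_kth_eig_kth_eig[OF assms(3)] csa_par_op[of A, OF assms(1)]])
  then show ?thesis using norm_par_op_le[of A \<kappa> \<theta> \<mu> u, OF assms(2)] by simp
qed

section \<open>Ritz data at one step and one parameter\<close>

locale ritz_setup =
  fixes A :: "'k::finite \<Rightarrow> ell2 \<Rightarrow> ell2" and \<theta> :: "real^'p \<Rightarrow> real^'k" and l r :: nat
    and P :: "nat \<Rightarrow> (real^'p) set" and v :: "real^'p \<Rightarrow> nat \<Rightarrow> ell2"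
    and V :: "nat \<Rightarrow> complex Matrix.vec \<Rightarrow> ell2"
    and w :: "nat \<Rightarrow> real^'p \<Rightarrow> nat \<Rightarrow> complex Matrix.vec"
    and j :: nat and \<mu> :: "real^'p" and \<kappa> :: "'k \<Rightarrow> real"
  assumes csa: "\<And>m. compact_selfadjoint (A m)" and r: "1 \<le> r" "r \<le> l"
    and bound: "\<And>m z. norm (A m z) \<le> \<kappa> m * norm z"
    and snap: "\<And>\<nu>. \<nu> \<in> P j \<Longrightarrow> snapshots_at A \<theta> l v \<nu>"
    and iso: "isometry_onto (ell2C.dim (proj_space l P v j)) (V j) (proj_space l P v j)"
    and ritz: "ritz_vectors_at A \<theta> l r P v V w j \<mu>"
begin

abbreviation "d \<equiv> ell2C.dim (proj_space l P v j)"
abbreviation "e \<equiv> \<lambda>a. V j (unit_vec d a)"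
abbreviation "x \<equiv> \<lambda>k. V j (w j \<mu> k)"
abbreviation "T \<equiv> par_op A \<theta> \<mu>"
abbreviation "\<tau> \<equiv> \<lambda>k. Defs.ritz A \<theta> l P v V j k \<mu>"
abbreviation "px \<equiv> proj {1..r} x"
abbreviation "\<rho> \<equiv> residual A \<theta> r V w j \<mu>"

lemmas T = csa_par_op[of A \<theta> \<mu>, OF csa]
lemmas e = isometry_onto_frame(1)[OF iso]

lemma w: "k \<in> {1..r} \<Longrightarrow> w j \<mu> k \<in> carrier_vec d"
  and w_eig: "k \<in> {1..r} \<Longrightarrow> proj_mat A \<theta> l P v V j \<mu> *\<^sub>v w j \<mu> k = complex_of_real (\<tau> k) \<cdot>\<^sub>v w j \<mu> k"
  and w_orth: "a \<in> {1..r} \<Longrightarrow> b \<in> {1..r} \<Longrightarrow> w j \<mu> a \<bullet>c w j \<mu> b = (if a = b then 1 else 0)"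
  using ritz by (auto simp: ritz_vectors_at_def)

lemma proj_mat_eq: "proj_mat A \<theta> l P v V j \<mu> = gram_mat T d e"
  unfolding proj_mat_def Let_def mat_of_map_def gram_mat_def adj_def
  by (intro eq_matI) auto

lemma \<tau>_eq: "\<tau> k = mat_eig (gram_mat T d e) k"
  by (simp add: ritz_def proj_mat_eq)

lemma x_expand: "k \<in> {1..r} \<Longrightarrow> x k = (\<Sum>a<d. vec_index (w j \<mu> k) a *\<^sub>C e a)"
  by (rule isometry_onto_frame(2)[OF iso w])

lemma x: "orthonormal {1..r} x"
proof -
  have "cinner (x a) (x b) = (if a = b then 1 else 0)" if "a \<in> {1..r}" "b \<in> {1..r}" for a b
  proof -
    have "cinner (x a) (x b) = (\<Sum>i<d. cnj (vec_index (w j \<mu> a) i) * vec_index (w j \<mu> b) i)"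
      unfolding x_expand[OF that(1)] x_expand[OF that(2)] by (rule cinner_orthonormal_sums[OF e])
    also have "\<dots> = w j \<mu> b \<bullet>c w j \<mu> a"
      unfolding cscalar_prod_sum[OF w[OF that(1)]] by (simp add: mult.commute)
    finally show ?thesis using w_orth[OF that(2,1)] by simp
  qed
  then show ?thesis by (simp add: orthonormal_def)
qed

lemma proj_e_x: "k \<in> {1..r} \<Longrightarrow> proj {..<d} e (x k) = x k"
  using x_expand proj_orthonormal_sum[OF e] by simp

lemma proj_e_px: "proj {..<d} e (px z) = px z"
  unfolding proj_def[of "{1..r}"] proj_sum proj_scaleC by (intro sum.cong refl) (simp add: proj_e_x)

lemma x_eig:
  assumes k: "k \<in> {1..r}"
  shows "proj {..<d} e (T (x k)) = \<tau> k *\<^sub>R x k"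
proof -
  have "cinner (e a) (T (x k)) = \<tau> k * vec_index (w j \<mu> k) a" if a: "a < d" for a
  proof -
    have "cinner (e a) (T (x k)) = vec_index (gram_mat T d e *\<^sub>v w j \<mu> k) a"
      unfolding x_expand[OF k] csa_sum[OF T] csa_scaleC[OF T] cinner_sum_right cinner_simps
      using a w[OF k] by (simp add: gram_mat_def scalar_prod_def atLeast0LessThan mult.commute)
    then show ?thesis using w_eig[OF k] w[OF k] a by (simp add: proj_mat_eq)
  qed
  then have "proj {..<d} e (T (x k)) = (\<Sum>a<d. (\<tau> k * vec_index (w j \<mu> k) a) *\<^sub>C e a)"
    by (simp add: proj_def)
  also have "\<dots> = \<tau> k *\<^sub>R x k"
    unfolding x_expand[OF k] scaleR_ell2_def by (simp add: ell2C.scale_sum_right)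
  finally show ?thesis .
qed

lemma cinner_x_T:
  assumes "k \<in> {1..r}" "proj {..<d} e p = p"
  shows "cinner (x k) (T p) = \<tau> k * cinner (x k) p"
proof -
  have "cinner (x k) (T p) = cinner (T (x k)) (proj {..<d} e p)"
    by (simp add: assms(2) csa_cinner[OF T])
  also have "\<dots> = cinner (\<tau> k *\<^sub>R x k) p" by (simp only: cinner_proj_left[symmetric] x_eig[OF assms(1)])
  finally show ?thesis by (simp add: cinner_simps)
qed

lemma r_le_d: "r \<le> d"
  using orthonormal_escape[OF e x] proj_e_x by (fastforce simp: not_le)

lemma \<tau>_mono: "1 \<le> a \<Longrightarrow> a \<le> b \<Longrightarrow> b \<le> r \<Longrightarrow> \<tau> a \<le> \<tau> b"
  unfolding \<tau>_eq using r_le_d by (intro mat_eig_gram_mat_mono[OF T e]) auto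

lemma \<tau>_rayleigh: "k \<in> {1..r} \<Longrightarrow> inner (x k) (T (x k)) = \<tau> k"
  using cinner_x_T[of k "x k"] proj_e_x orthonormal_cinner[OF x] by (simp add: inner_eq_Re_cinner)

text \<open>The form is diagonal in the Ritz vectors with entries \<open>\<tau> k\<close>, the
  smallest of which is \<open>\<tau> 1\<close>.\<close>

lemma \<tau>_1_le:
  assumes "px p = p"
  shows "\<tau> 1 * (norm p)\<^sup>2 \<le> inner p (T p)"
proof -
  have pe: "proj {..<d} e p = p" using proj_e_px[of p] assms by simp
  have "cinner p (T p) = cinner (px p) (T p)" by (simp only: assms)
  also have "\<dots> = (\<Sum>k\<in>{1..r}. complex_of_real (\<tau> k * (cmod (cinner (x k) p))\<^sup>2))"
    unfolding proj_def cinner_sum_left cinner_scaleC_left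
    by (intro sum.cong refl) (simp add: cinner_x_T[OF _ pe] cmod_sq)
  finally have "inner p (T p) = (\<Sum>k\<in>{1..r}. \<tau> k * (cmod (cinner (x k) p))\<^sup>2)"
    by (simp add: inner_eq_Re_cinner)
  moreover have "\<tau> 1 * (norm p)\<^sup>2 = (\<Sum>k\<in>{1..r}. \<tau> 1 * (cmod (cinner (x k) p))\<^sup>2)"
    using norm_proj_sq[OF x, of p] assms by (simp add: sum_distrib_left)
  moreover have "(\<Sum>k\<in>{1..r}. \<tau> 1 * (cmod (cinner (x k) p))\<^sup>2) \<le> (\<Sum>k\<in>{1..r}. \<tau> k * (cmod (cinner (x k) p))\<^sup>2)"
    by (intro sum_mono mult_right_mono \<tau>_mono) auto
  ultimately show ?thesis by simp
qed

lemma ky_fan: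
  assumes "orthonormal K y" "\<And>k. k \<in> K \<Longrightarrow> y k \<in> proj_space l P v j"
  shows "(\<Sum>k=1..card K. \<tau> k) \<le> (\<Sum>k\<in>K. inner (y k) (T (y k)))"
  unfolding \<tau>_eq
  by (rule sum_mat_eig_le_sum_rayleigh[OF T e assms(1)]) (rule isometry_onto_frame(3)[OF iso assms(2)])

lemma residual_eq: "\<rho> = (SUP p\<in>{p. px p = p \<and> norm p \<le> 1}. norm (T p - px (T p)))"
proof -
  have U: "ritz_frame r V w j \<mu> = frame r x" by (simp add: ritz_frame_def)
  show ?thesis
    unfolding residual_def Let_def U frame_adj by (rule op_norm_frame[OF x])
qed

lemma residual_le:
  assumes "\<And>p. px p = p \<Longrightarrow> norm p \<le> 1 \<Longrightarrow> norm (T p - px (T p)) \<le> B"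
  shows "\<rho> \<le> B"
proof -
  have "px 0 = 0" by (simp add: proj_def)
  then show ?thesis unfolding residual_eq using assms by (intro cSUP_least) force+
qed

lemma le_residual:
  assumes p: "px p = p"
  shows "norm (T p - px (T p)) \<le> \<rho> * norm p"
proof (cases "p = 0")
  case True
  then show ?thesis by (simp add: csa_zero[OF T] proj_eq_0)
next
  case False
  obtain K where K: "\<And>z. norm (T z) \<le> K * norm z" "K > 0" using csa_bounded[OF T] by blast
  let ?S = "{p. px p = p \<and> norm p \<le> 1}"
  let ?q = "inverse (norm p) *\<^sub>R p"
  have "bdd_above ((\<lambda>p. norm (T p - px (T p))) ` ?S)"
  proof (rule bdd_aboveI2)
    fix p assume "p \<in> ?S"
    then have "K * norm p \<le> K * 1" using K(2) by (intro mult_left_mono) auto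
    then show "norm (T p - px (T p)) \<le> K"
      using norm_diff_proj_le[OF x, of "T p"] K(1)[of p] by linarith
  qed
  moreover have "?q \<in> ?S" using False p by (simp add: proj_scaleR)
  ultimately have "norm (T ?q - px (T ?q)) \<le> \<rho>" unfolding residual_eq by (intro cSUP_upper)
  also have "T ?q - px (T ?q) = inverse (norm p) *\<^sub>R (T p - px (T p))"
    by (simp only: csa_scaleR[OF T] proj_scaleR scaleR_diff_right)
  finally have le: "inverse (norm p) * norm (T p - px (T p)) \<le> \<rho>" by simp
  have scale: "N \<le> c * a" if "inverse a * N \<le> c" "a > 0" for a c N :: real
    using that by (simp add: field_simps)
  show ?thesis by (rule scale[OF le]) (use False in simp)
qed

lemma residual_nonneg: "0 \<le> \<rho>"
proof -
  have one: "1 \<in> {1..r}" using r by simp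
  have x1: "px (x 1) = x 1" "norm (x 1) = 1"
    by (rule proj_member[OF x one], rule orthonormal_norm[OF x one])
  have "0 \<le> norm (T (x 1) - px (T (x 1)))" by simp
  also have "\<dots> \<le> \<rho> * norm (x 1)" by (rule le_residual) (rule x1(1))
  finally show ?thesis by (simp only: x1(2) mult_1_right)
qed

context
  fixes \<nu> assumes \<nu>: "\<nu> \<in> P j"
begin

abbreviation "t \<equiv> \<lambda>k. eig A \<theta> k \<nu>"
abbreviation "S \<equiv> par_op A \<theta> \<nu>"

lemmas S = csa_par_op[of A \<theta> \<nu>, OF csa]

lemma t_kth: "k \<in> {1..Suc l} \<Longrightarrow> is_kth_eig S k (t k)"
  using snap[OF \<nu>] is_kth_eig_kth_eig by (auto simp: snapshots_at_def eig_def)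

lemma v: "orthonormal {1..l} (v \<nu>)"
  using snap[OF \<nu>] by (auto simp: snapshots_at_def orthonormal_def)

lemma v_eig: "k \<in> {1..l} \<Longrightarrow> S (v \<nu> k) = t k *\<^sub>R v \<nu> k"
  using snap[OF \<nu>] by (auto simp: snapshots_at_def)

lemma v_space: "k \<in> {1..l} \<Longrightarrow> v \<nu> k \<in> proj_space l P v j"
  unfolding proj_space_def using \<nu> by (intro ell2C.span_base) blast

lemma t_mono: "1 \<le> a \<Longrightarrow> a \<le> b \<Longrightarrow> b \<le> Suc l \<Longrightarrow> t a \<le> t b"
  using is_kth_eig_mono[OF t_kth t_kth] by simp

text \<open>Needed at two levels: \<open>k = l\<close> for \<beta> and \<open>k = r\<close> for the
  residual.\<close>

lemma rayleigh_split:
  assumes "k \<le> l"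
  shows "t (Suc k) * (norm u)\<^sup>2 - (\<Sum>i\<in>{1..k}. (t (Suc k) - t i) * (cmod (cinner (v \<nu> i) u))\<^sup>2) \<le> inner u (S u)"
proof (rule csa_rayleigh_split[OF S])
  show vk: "orthonormal {1..k} (v \<nu>)" by (rule orthonormal_subset[OF v]) (use assms in auto)
  show vek: "S (v \<nu> i) = t i *\<^sub>R v \<nu> i" if "i \<in> {1..k}" for i using that assms by (intro v_eig) auto
  show "t (Suc k) * (norm z)\<^sup>2 \<le> inner z (S z)" if "z \<in> ocomp {1..k} (v \<nu>)" for z
    by (rule kth_eig_le_rayleigh[OF S t_kth vk vek]) (use that assms in \<open>auto simp: ocomp_def\<close>)
qed

text \<open>Repeats the matrix inside \<open>beta\<close> to give it a name.\<close>

definition angle_mat :: "complex Matrix.mat" where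
  "angle_mat = (let \<Lambda> = mat_diag l (\<lambda>i. complex_of_real (t (Suc i)));
          F = frame l (v \<nu>);
          U = ritz_frame r V w j \<mu>;
          G = mat_of_map l (\<lambda>x. adj l F (U (adj r U (F x))))
      in \<Lambda> - complex_of_real (t 1) \<cdot>\<^sub>m 1\<^sub>m l - G * (\<Lambda> - complex_of_real (t (l + 1)) \<cdot>\<^sub>m 1\<^sub>m l))"

lemma beta_eq: "beta A \<theta> l r v V w \<nu> j \<mu> = mat_eig angle_mat 1"
  by (simp add: beta_def angle_mat_def Let_def)

lemma angle_matrix: "angle_matrix l (v \<nu>) {1..r} x t (t (Suc l)) angle_mat"
proof
  define G where "G = mat_of_map l (\<lambda>z. adj l (frame l (v \<nu>)) (px (frame l (v \<nu>) z)))"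
  define \<Lambda> where "\<Lambda> c = mat_diag l (\<lambda>i. complex_of_real (t (Suc i)) - complex_of_real c)" for c
  have L: "mat_diag l (\<lambda>i. complex_of_real (t (Suc i))) - complex_of_real c \<cdot>\<^sub>m 1\<^sub>m l = \<Lambda> c" for c
    by (intro eq_matI) (auto simp: \<Lambda>_def mat_diag_def)
  have U: "ritz_frame r V w j \<mu> = frame r x" by (simp add: ritz_frame_def)
  have M: "angle_mat = \<Lambda> (t 1) - G * \<Lambda> (t (Suc l))"
    unfolding angle_mat_def Let_def L U frame_adj G_def by simp
  have car: "G \<in> carrier_mat l l" "\<And>c. \<Lambda> c \<in> carrier_mat l l" by (auto simp: G_def mat_of_map_def \<Lambda>_def)
  show "angle_mat \<in> carrier_mat l l"
    unfolding M by (rule minus_carrier_mat[OF mult_carrier_mat[OF car(1) car(2)]])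
  fix a b assume ab: "a < l" "b < l"
  have "G $$ (a, b) = cinner (v \<nu> (Suc a)) (px (v \<nu> (Suc b)))"
    using ab frame_unit[of "Suc a" l "v \<nu>"] frame_unit[of "Suc b" l "v \<nu>"]
    by (simp add: G_def mat_of_map_def adj_def)
  moreover have "(G * \<Lambda> (t (Suc l))) $$ (a, b) = G $$ (a, b) * complex_of_real (t (Suc b) - t (Suc l))"
    unfolding \<Lambda>_def mat_diag_mult_right[OF car(1)] using ab by simp
  moreover have "angle_mat $$ (a, b) = \<Lambda> (t 1) $$ (a, b) - (G * \<Lambda> (t (Suc l))) $$ (a, b)"
    unfolding M by (rule index_minus_mat) (use ab carrier_matD[OF car(2)] carrier_matD[OF car(1)] in auto)
  moreover have "\<Lambda> (t 1) $$ (a, b) = (if a = b then complex_of_real (t (Suc a) - t 1) else 0)"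
    using ab by (simp add: \<Lambda>_def mat_diag_def)
  ultimately show "angle_mat $$ (a, b) = (if a = b then complex_of_real (t (Suc a) - t 1) else 0)
      - cinner (v \<nu> (Suc a)) (px (v \<nu> (Suc b))) * complex_of_real (t (Suc b) - t (Suc l))"
    by simp
qed (use r v x t_mono in auto)

lemma beta_nonneg: "0 \<le> beta A \<theta> l r v V w \<nu> j \<mu>"
  unfolding beta_eq by (rule angle_matrix.mat_eig_bounds(1)[OF angle_matrix])

text \<open>Splitting at level \<open>l\<close> bounds the form below by \<open>t (Suc l)\<close>
  minus a weighted sum, and orthogonality to the Ritz space limits that sum to
  \<open>t (Suc l) - t 1 - beta\<close>. This is what makes the constraints of the linear program
  valid for such \<open>u\<close>.\<close>

lemma beta_le:
  assumes "norm u = 1" "u \<in> ocomp {1..r} x"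
  shows "t 1 + beta A \<theta> l r v V w \<nu> j \<mu> \<le> inner u (S u)"
  using angle_matrix.quadratic_form_le[OF angle_matrix assms] rayleigh_split[of l u] assms(1)
  unfolding beta_eq by simp

text \<open>The first snapshot at \<open>\<nu>\<close> lies in the projection space and is a test
  vector for the smallest Ritz value at \<open>\<mu>\<close>.\<close>

lemma \<tau>_1_le_t_1: "\<tau> 1 \<le> t 1 + norm (\<theta> \<mu> - \<theta> \<nu>) * sum \<kappa> UNIV"
proof -
  have n: "norm (v \<nu> 1) = 1" using r by (intro orthonormal_norm[OF v]) simp
  have "(\<Sum>k=1..card {1::nat}. \<tau> k) \<le> (\<Sum>k\<in>{1}. inner (v \<nu> k) (T (v \<nu> k)))"
    using r by (intro ky_fan orthonormal_subset[OF v] v_space) auto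
  then have "\<tau> 1 \<le> inner (v \<nu> 1) (T (v \<nu> 1))" by simp
  also have "\<dots> = inner (v \<nu> 1) (S (v \<nu> 1)) + inner (v \<nu> 1) (T (v \<nu> 1) - S (v \<nu> 1))"
    by (simp add: inner_diff_right)
  also have "inner (v \<nu> 1) (S (v \<nu> 1)) = t 1"
    using r n by (simp add: v_eig flip: power2_norm_eq_inner)
  also have "inner (v \<nu> 1) (T (v \<nu> 1) - S (v \<nu> 1)) \<le> norm (\<theta> \<mu> - \<theta> \<nu>) * sum \<kappa> UNIV"
    using norm_cauchy_schwarz[of "v \<nu> 1" "T (v \<nu> 1) - S (v \<nu> 1)"]
      norm_par_op_diff_le[of A \<kappa> \<theta> \<mu> "v \<nu> 1" \<nu>, OF bound] n by simp
  finally show ?thesis by simp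
qed

lemma eta_lower:
  assumes "is_arg_min (inner (\<theta> \<mu>)) (\<lambda>z. z \<in> Y_LB A \<theta> l r P v V w j \<mu>) y"
  shows "t 1 - norm (\<theta> \<mu> - \<theta> \<nu>) * sum \<kappa> UNIV \<le> eta A \<theta> l r P v V w j \<mu>"
  unfolding eta_def
proof (rule cINF_greatest)
  show "Y_LB A \<theta> l r P v V w j \<mu> \<noteq> {}" using assms by (auto simp: is_arg_min_def)
  fix z assume z: "z \<in> Y_LB A \<theta> l r P v V w j \<mu>"
  then have "t 1 \<le> inner (\<theta> \<nu>) z" using \<nu> beta_nonneg by (fastforce simp: Y_LB_def)
  moreover have "\<bar>inner (\<theta> \<mu> - \<theta> \<nu>) z\<bar> \<le> norm (\<theta> \<mu> - \<theta> \<nu>) * norm z" by (rule Cauchy_Schwarz_ineq2)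
  moreover have "norm (\<theta> \<mu> - \<theta> \<nu>) * norm z \<le> norm (\<theta> \<mu> - \<theta> \<nu>) * sum \<kappa> UNIV"
    using z by (intro mult_left_mono norm_box_le[of A \<kappa>, OF bound]) (auto simp: Y_LB_def)
  ultimately show "t 1 - norm (\<theta> \<mu> - \<theta> \<nu>) * sum \<kappa> UNIV \<le> inner (\<theta> \<mu>) z"
    by (simp add: inner_diff_left abs_le_iff)
qed

end

end

section \<open>The residual estimate and the bounds on the gap\<close>

context ritz_setup
begin

text \<open>Upper and lower bounds for the sum of the first \<open>r\<close> Ritz values pinch, and
  the spectral gap turns the slack into a distance \<open>q\<close>, with q^2 = 2 r \<epsilon> /
  \<delta>, between Ritz vectors and eigenvectors at \<open>\<nu>\<close>. A residual vector then
  has three parts: \<open>\<epsilon>\<close> for replacing \<open>T\<close> by \<open>?S\<close>,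
  and \<open>r K q\<close> each for the components inside and outside the span of the
  eigenvectors.\<close>

lemma residual_small:
  assumes \<nu>: "\<nu> \<in> P j" and \<delta>: "\<delta> > 0" "\<delta> \<le> eig A \<theta> (r + 1) \<nu> - eig A \<theta> r \<nu>"
  defines "\<epsilon> \<equiv> norm (\<theta> \<mu> - \<theta> \<nu>) * sum \<kappa> UNIV" and "K \<equiv> norm (\<theta> \<nu>) * sum \<kappa> UNIV"
  shows "\<rho> \<le> \<epsilon> + 2 * real r * K * sqrt (2 * real r * \<epsilon> / \<delta>)"
proof -
  let ?S = "par_op A \<theta> \<nu>" and ?t = "\<lambda>k. eig A \<theta> k \<nu>" and ?v = "v \<nu>"
  let ?b = "?t (Suc r)" and ?I = "{1..r}"
  let ?pv = "proj ?I ?v"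
  have S: "compact_selfadjoint ?S" by (rule S[OF \<nu>])
  have vI: "orthonormal ?I ?v" by (rule orthonormal_subset[OF v[OF \<nu>]]) (use r in auto)
  have diff: "\<bar>inner z (T z) - inner z (?S z)\<bar> \<le> \<epsilon>" if "norm z = 1" for z
  proof -
    have "\<bar>inner z (T z - ?S z)\<bar> \<le> norm z * norm (T z - ?S z)" by (rule Cauchy_Schwarz_ineq2)
    also have "\<dots> \<le> \<epsilon>"
      using norm_par_op_diff_le[of A \<kappa> \<theta> \<mu> z \<nu>, OF bound] that by (simp add: \<epsilon>_def)
    finally show ?thesis by (simp add: inner_diff_right)
  qed
  have \<epsilon>: "0 \<le> \<epsilon>" using diff[of "?v 1"] orthonormal_norm[OF vI, of 1] r by fastforce
  \<comment> \<open>The squared length of the projection of the eigenvector \<open>?v i\<close> onto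
    the Ritz space.\<close>
  define p where "p i = (\<Sum>k\<in>?I. (cmod (cinner (?v i) (x k)))\<^sup>2)" for i
  have p: "1 - p i = (norm (?v i - px (?v i)))\<^sup>2" if "i \<in> ?I" for i
    using norm_proj_pythagoras[OF x, of "?v i"] norm_proj_sq[OF x, of "?v i"]
      orthonormal_norm[OF vI that] by (simp add: p_def cinner_commute[of "?v i"])
  have "(\<Sum>k=1..card ?I. \<tau> k) \<le> (\<Sum>k\<in>?I. inner (?v k) (T (?v k)))"
    by (rule ky_fan[OF vI]) (use v_space[OF \<nu>] r in auto)
  also have "\<dots> \<le> (\<Sum>k\<in>?I. ?t k + \<epsilon>)"
  proof (rule sum_mono)
    fix k assume k: "k \<in> ?I"
    have "?S (?v k) = ?t k *\<^sub>R ?v k" using k r by (intro v_eig[OF \<nu>]) auto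
    then have "inner (?v k) (?S (?v k)) = ?t k"
      using orthonormal_norm[OF vI k] by (simp flip: power2_norm_eq_inner)
    then show "inner (?v k) (T (?v k)) \<le> ?t k + \<epsilon>"
      using diff[OF orthonormal_norm[OF vI k]] by linarith
  qed
  finally have upper: "(\<Sum>k\<in>?I. \<tau> k) \<le> (\<Sum>k\<in>?I. ?t k) + r * \<epsilon>" by (simp add: sum.distrib)
  have "(\<Sum>k\<in>?I. ?b - (\<Sum>i\<in>?I. (?b - ?t i) * (cmod (cinner (?v i) (x k)))\<^sup>2) - \<epsilon>) \<le> (\<Sum>k\<in>?I. \<tau> k)"
  proof (rule sum_mono)
    fix k assume k: "k \<in> ?I"
    show "?b - (\<Sum>i\<in>?I. (?b - ?t i) * (cmod (cinner (?v i) (x k)))\<^sup>2) - \<epsilon> \<le> \<tau> k"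
      using rayleigh_split[OF \<nu> r(2), of "x k"] \<tau>_rayleigh[OF k] diff[OF orthonormal_norm[OF x k]]
        orthonormal_norm[OF x k] by simp
  qed
  also have "(\<Sum>k\<in>?I. ?b - (\<Sum>i\<in>?I. (?b - ?t i) * (cmod (cinner (?v i) (x k)))\<^sup>2) - \<epsilon>)
      = r * ?b - (\<Sum>i\<in>?I. (?b - ?t i) * p i) - r * \<epsilon>"
    unfolding p_def sum_distrib_left sum_subtractf by (subst sum.swap) simp
  \<comment> \<open>One \<open>r * \<epsilon>\<close> comes from the upper bound and one from the
    lower bound.\<close>
  finally have weighted: "(\<Sum>i\<in>?I. (?b - ?t i) * (1 - p i)) \<le> 2 * r * \<epsilon>"
    using upper by (simp add: right_diff_distrib sum_subtractf)
  have "(\<Sum>i\<in>?I. \<delta> * (1 - p i)) \<le> (\<Sum>i\<in>?I. (?b - ?t i) * (1 - p i))"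
  proof (intro sum_mono mult_right_mono)
    fix i assume i: "i \<in> ?I"
    show "0 \<le> 1 - p i" by (simp add: p[OF i])
    have "?t i \<le> ?t r" using i r by (intro t_mono[OF \<nu>]) auto
    then show "\<delta> \<le> ?b - ?t i" using \<delta>(2) by simp
  qed
  from order_trans[OF this weighted] have "\<delta> * (\<Sum>i\<in>?I. 1 - p i) \<le> 2 * r * \<epsilon>"
    unfolding sum_distrib_left .
  then have sum_p: "(\<Sum>i\<in>?I. 1 - p i) \<le> 2 * r * \<epsilon> / \<delta>"
    unfolding pos_le_divide_eq[OF \<delta>(1)] by (simp only: mult.commute)
  define q where "q = sqrt (2 * r * \<epsilon> / \<delta>)"
  have q: "0 \<le> q" "q\<^sup>2 = 2 * r * \<epsilon> / \<delta>" using \<epsilon> \<delta>(1) by (simp_all add: q_def)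
  have v_close: "norm (?v i - px (?v i)) \<le> q" if i: "i \<in> ?I" for i
  proof -
    have "(norm (?v i - px (?v i)))\<^sup>2 \<le> (\<Sum>i\<in>?I. 1 - p i)"
      unfolding p[OF i, symmetric] by (rule member_le_sum[OF i]) (auto simp: p)
    also note sum_p
    also note q(2)[symmetric]
    finally show ?thesis by (rule power2_le_imp_le[OF _ q(1)])
  qed
  \<comment> \<open>The situation is symmetric: both families have \<open>r\<close> members, so
    exchanging the sums shows that the squared distances of the \<open>x k\<close> from the span of
    the \<open>?v i\<close> have the same total.\<close>
  have x_close: "norm (x k - ?pv (x k)) \<le> q" if k: "k \<in> ?I" for k
  proof -
    have eq: "(norm (x k - ?pv (x k)))\<^sup>2 = 1 - (\<Sum>i\<in>?I. (cmod (cinner (?v i) (x k)))\<^sup>2)" if "k \<in> ?I" for k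
      using norm_proj_pythagoras[OF vI, of "x k"] norm_proj_sq[OF vI, of "x k"]
        orthonormal_norm[OF x that] by simp
    have "(norm (x k - ?pv (x k)))\<^sup>2 \<le> (\<Sum>k\<in>?I. (norm (x k - ?pv (x k)))\<^sup>2)"
      by (rule member_le_sum[OF k]) auto
    also have "\<dots> = (\<Sum>k\<in>?I. 1 - (\<Sum>i\<in>?I. (cmod (cinner (?v i) (x k)))\<^sup>2))"
      by (intro sum.cong eq refl)
    also have "\<dots> = (\<Sum>i\<in>?I. 1 - p i)"
      unfolding p_def sum_subtractf by (subst sum.swap) (rule refl)
    also note sum_p
    also note q(2)[symmetric]
    finally show ?thesis by (rule power2_le_imp_le[OF _ q(1)])
  qed
  have SK: "norm (?S z) \<le> K * norm z" for z
    unfolding K_def by (rule norm_par_op_le[of A \<kappa>, OF bound])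
  have K: "0 \<le> K" by (rule operator_bound_nonneg[OF SK])
  have "\<rho> \<le> \<epsilon> + (r * K * q + r * K * q)"
  proof (rule residual_le)
    fix y assume y: "px y = y" "norm y \<le> 1"
    define z where "z = y - ?pv y"
    have z: "norm z \<le> r * q"
    proof -
      have "z = (\<Sum>k\<in>?I. cinner (x k) y *\<^sub>C (x k - ?pv (x k)))"
      proof -
        have "z = px y - ?pv (px y)" by (simp only: z_def y(1))
        also have "\<dots> = (\<Sum>k\<in>?I. cinner (x k) y *\<^sub>C (x k - ?pv (x k)))"
          unfolding proj_def[of _ x] proj_sum proj_scaleC scaleC_simps by (simp add: sum_subtractf)
        finally show ?thesis .
      qed
      also have "norm \<dots> \<le> (\<Sum>k\<in>?I. q)"
      proof (rule sum_norm_le)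
        fix k assume k: "k \<in> ?I"
        have "cmod (cinner (x k) y) \<le> 1"
          using cinner_cauchy_schwarz[of "x k" y] orthonormal_norm[OF x k] y(2) by simp
        then have "cmod (cinner (x k) y) * norm (x k - ?pv (x k)) \<le> 1 * q"
          by (intro mult_mono x_close k) auto
        then show "norm (cinner (x k) y *\<^sub>C (x k - ?pv (x k))) \<le> q" by (simp add: norm_scaleC)
      qed
      finally show ?thesis by simp
    qed
    define R where "R u = u - px u" for u
    have R: "norm (R u) \<le> norm u" "R (u + u') = R u + R u'" for u u'
      unfolding R_def by (rule norm_diff_proj_le[OF x], simp add: proj_add)
    \<comment> \<open>Inside the span \<open>?S\<close> acts diagonally, so after removing the Ritz
      component only the small vectors \<open>?v i - px (?v i)\<close> remain.\<close>
    have "R (?S (?pv y)) = (\<Sum>i\<in>?I. cinner (?v i) y *\<^sub>C ?t i *\<^sub>R (?v i - px (?v i)))"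
    proof -
      have "?S (?pv y) = (\<Sum>i\<in>?I. cinner (?v i) y *\<^sub>C ?t i *\<^sub>R ?v i)"
        unfolding proj_def csa_sum[OF S] csa_scaleC[OF S]
        by (intro sum.cong refl arg_cong[where f = "\<lambda>u. _ *\<^sub>C u"] v_eig[OF \<nu>]) (use r in auto)
      then show ?thesis
        by (simp only: R_def proj_sum proj_scaleC proj_scaleR scaleC_simps scaleR_diff_right sum_subtractf)
    qed
    also have "norm \<dots> \<le> (\<Sum>i\<in>?I. K * q)"
    proof (rule sum_norm_le)
      fix i assume i: "i \<in> ?I"
      have le1: "cmod (cinner (?v i) y) \<le> 1"
        using cinner_cauchy_schwarz[of "?v i" y] orthonormal_norm[OF vI i] y(2) by simp
      have "\<exists>s. is_kth_eig ?S i s" using t_kth[OF \<nu>, of i] i r by auto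
      then have "\<bar>?t i\<bar> \<le> K" unfolding K_def by (rule abs_eig_le[of A \<kappa>, OF csa bound])
      then have "\<bar>?t i\<bar> * norm (?v i - px (?v i)) \<le> K * q" by (intro mult_mono v_close i K) auto
      from mult_mono[OF le1 this] have "cmod (cinner (?v i) y) * (\<bar>?t i\<bar> * norm (?v i - px (?v i))) \<le> 1 * (K * q)"
        by simp
      then show "norm (cinner (?v i) y *\<^sub>C ?t i *\<^sub>R (?v i - px (?v i))) \<le> K * q"
        by (simp add: norm_scaleC)
    qed
    finally have 1: "norm (R (?S (?pv y))) \<le> r * K * q" by simp
    have "norm (R (?S z)) \<le> K * norm z" using R(1)[of "?S z"] SK[of z] by linarith
    also have "\<dots> \<le> K * (r * q)" by (intro mult_left_mono z K)
    finally have 2: "norm (R (?S z)) \<le> r * K * q" by (simp add: mult_ac)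
    have "norm (R (T y - ?S y)) \<le> norm (T y - ?S y)" by (rule R(1))
    also have "\<dots> \<le> \<epsilon> * norm y"
      unfolding \<epsilon>_def by (rule norm_par_op_diff_le[of A \<kappa>, OF bound])
    also have "\<dots> \<le> \<epsilon> * 1" by (intro mult_left_mono y \<epsilon>)
    finally have 3: "norm (R (T y - ?S y)) \<le> \<epsilon>" by simp
    have "T y = (T y - ?S y) + (?S (?pv y) + ?S z)"
      by (simp add: z_def flip: csa_add[OF S])
    then have "R (T y) = R (T y - ?S y) + (R (?S (?pv y)) + R (?S z))" by (metis R(2))
    then have "norm (R (T y)) \<le> norm (R (T y - ?S y)) + (norm (R (?S (?pv y))) + norm (R (?S z)))"
      by (metis add_left_mono norm_triangle_ineq order_trans)
    with 1 2 3 show "norm (T y - px (T y)) \<le> \<epsilon> + (r * K * q + r * K * q)"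
      unfolding R_def by linarith
  qed
  then show ?thesis unfolding q_def by (simp add: mult_ac)
qed

lemma eig_1_le_rayleigh:
  assumes "\<exists>s. is_kth_eig T 1 s"
  shows "eig A \<theta> 1 \<mu> * (norm z)\<^sup>2 \<le> inner z (T z)"
proof -
  have "is_kth_eig T i (eig A \<theta> 1 \<mu>)" if "i \<in> {1..Suc 0}" for i
    using is_kth_eig_kth_eig[OF assms] that by (simp add: eig_def le_Suc_eq)
  \<comment> \<open>With \<open>k = 0\<close> there is no orthogonality condition; the family is an
    arbitrary dummy.\<close>
  from kth_eig_le_rayleigh[where k = 0 and t = "\<lambda>_. eig A \<theta> 1 \<mu>" and v = "\<lambda>_. 0" and x = z, OF T this]
  show ?thesis by (simp add: orthonormal_def)
qed

lemma err_nonneg: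
  assumes "\<exists>s. is_kth_eig T 1 s"
  shows "0 \<le> err_E A \<theta> l P v V j \<mu>"
proof -
  have one: "1 \<in> {1..r}" using r by simp
  show ?thesis
    using eig_1_le_rayleigh[OF assms, of "x 1"] \<tau>_rayleigh[OF one] orthonormal_norm[OF x one]
    by (simp add: err_E_def)
qed

context
  fixes y assumes y: "is_arg_min (inner (\<theta> \<mu>)) (\<lambda>z. z \<in> Y_LB A \<theta> l r P v V w j \<mu>) y"
begin

abbreviation "\<eta> \<equiv> eta A \<theta> l r P v V w j \<mu>"

text \<open>For the normalized vector the forms of the \<open>A m\<close> are a feasible point of
  the linear program, and the objective there is the Rayleigh quotient.\<close>

lemma eta_le:
  assumes z: "z \<in> ocomp {1..r} x"
  shows "\<eta> * (norm z)\<^sup>2 \<le> inner z (T z)"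
proof (cases "z = 0")
  case False
  define u where "u = inverse (norm z) *\<^sub>R z"
  have u: "norm u = 1" "u \<in> ocomp {1..r} x"
    using False z by (auto simp: u_def ocomp_def cinner_scaleR_right)
  let ?y = "\<chi> m. inner u (A m u)"
  have "?y \<in> Y_LB A \<theta> l r P v V w j \<mu>"
    using rayleigh_in_box[of A \<kappa>, OF bound u(1)] beta_le[OF _ u] by (auto simp: Y_LB_def inner_par_op)
  moreover have "bdd_below (inner (\<theta> \<mu>) ` Y_LB A \<theta> l r P v V w j \<mu>)"
    using y by (intro bdd_belowI2[of _ "inner (\<theta> \<mu>) y"]) (auto simp: is_arg_min_def not_less)
  ultimately have "\<eta> \<le> inner (\<theta> \<mu>) ?y" unfolding eta_def by (intro cINF_lower)
  also have "\<dots> = inner z (T z) / (norm z)\<^sup>2"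
    unfolding inner_par_op[symmetric] by (simp add: u_def csa_scaleR[OF T] power2_eq_square divide_inverse)
  finally show ?thesis using False by (simp add: field_simps)
qed simp

text \<open>A unit eigenvector for the smallest eigenvalue is split into its Ritz component p and
  the rest q. The two diagonal terms and the cross term of the form are bounded separately, which
  leaves the two by two form at the norms of p and q.\<close>

lemma lambda_LB_le:
  assumes "\<exists>s. is_kth_eig T 1 s"
  shows "lambda_LB A \<theta> l r P v V w j \<mu> \<le> eig A \<theta> 1 \<mu>"
proof -
  obtain u where u: "norm u = 1" "T u = eig A \<theta> 1 \<mu> *\<^sub>R u"
    unfolding eig_def by (rule is_kth_eig_eigenvector[OF is_kth_eig_kth_eig[OF assms] T])
  define p where "p = px u"
  define q where "q = u - p"
  have p: "px p = p" by (simp only: p_def proj_idem[OF x])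
  have q: "q \<in> ocomp {1..r} x"
    unfolding q_def p_def ocomp_def using cinner_diff_proj[OF x] by blast
  have "px q = 0" by (rule proj_eq_0) (use q in \<open>simp add: ocomp_def\<close>)
  \<comment> \<open>Only the part of \<open>T p\<close> outside the Ritz space meets q, and that
    part is measured by the residual.\<close>
  then have "inner q (px (T p)) = 0"
    unfolding inner_eq_Re_cinner cinner_proj_left[symmetric] by (simp only:) simp
  then have "\<bar>inner q (T p)\<bar> = \<bar>inner q (T p - px (T p))\<bar>" by (simp add: inner_diff_right)
  also have "\<dots> \<le> norm q * (\<rho> * norm p)"
    by (rule order_trans[OF Cauchy_Schwarz_ineq2 mult_left_mono[OF le_residual[OF p]]]) simp
  finally have cross: "- (\<rho> * norm p * norm q) \<le> inner q (T p)" by (simp add: abs_le_iff mult_ac)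
  have "u = p + q" by (simp add: q_def)
  then have "inner u (T u) = inner p (T p) + 2 * inner q (T p) + inner q (T q)"
    using csa_inner[OF T, of p q] by (simp add: csa_add[OF T] inner_simps inner_commute)
  then have "eig A \<theta> 1 \<mu> = inner p (T p) + 2 * inner q (T p) + inner q (T q)"
    using u by (simp flip: power2_norm_eq_inner)
  moreover have "\<tau> 1 * (norm p)\<^sup>2 \<le> inner p (T p)" by (rule \<tau>_1_le[OF p])
  moreover have "\<eta> * (norm q)\<^sup>2 \<le> inner q (T q)" by (rule eta_le[OF q])
  moreover have "lambda_LB A \<theta> l r P v V w j \<mu> * ((norm p)\<^sup>2 + (norm q)\<^sup>2)
      \<le> \<tau> 1 * (norm p)\<^sup>2 - 2 * \<rho> * norm p * norm q + \<eta> * (norm q)\<^sup>2"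
    unfolding lambda_LB_def by (rule quadratic_residual_bound(3)[OF residual_nonneg]) simp_all
  moreover have "(norm p)\<^sup>2 + (norm q)\<^sup>2 = 1"
    using norm_proj_pythagoras[OF x, of u] u(1) by (simp add: p_def q_def)
  ultimately show ?thesis using cross by simp
qed

lemma err_le_gap:
  assumes "\<exists>s. is_kth_eig T 1 s"
  shows "err_E A \<theta> l P v V j \<mu> \<le> gap_H A \<theta> l r P v V w j \<mu>"
  using lambda_LB_le[OF assms] by (simp add: err_E_def gap_H_def)

lemma gap_nonneg: "0 \<le> gap_H A \<theta> l r P v V w j \<mu>"
  unfolding gap_H_def lambda_LB_def by (rule quadratic_residual_bound(1)[OF residual_nonneg])

text \<open>Of the three \<open>\<epsilon>\<close>, two come from the difference of the smallest
  Ritz value and \<eta>, one from the residual.\<close>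

lemma gap_small:
  assumes \<nu>: "\<nu> \<in> P j" and \<delta>: "\<delta> > 0" "\<delta> \<le> eig A \<theta> (r + 1) \<nu> - eig A \<theta> r \<nu>"
  defines "\<epsilon> \<equiv> norm (\<theta> \<mu> - \<theta> \<nu>) * sum \<kappa> UNIV"
  shows "gap_H A \<theta> l r P v V w j \<mu>
    \<le> 3 * \<epsilon> + 2 * real r * (norm (\<theta> \<nu>) * sum \<kappa> UNIV) * sqrt (2 * real r * \<epsilon> / \<delta>)"
proof -
  have "gap_H A \<theta> l r P v V w j \<mu> \<le> max (\<tau> 1 - \<eta>) 0 + \<rho>"
    unfolding gap_H_def lambda_LB_def by (rule quadratic_residual_bound(2)[OF residual_nonneg])
  moreover have "\<tau> 1 - \<eta> \<le> 2 * \<epsilon>"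
    using \<tau>_1_le_t_1[OF \<nu>] eta_lower[OF \<nu> y] by (simp add: \<epsilon>_def)
  moreover have "0 \<le> \<epsilon>"
  proof -
    have "0 \<le> sum \<kappa> UNIV" by (intro sum_nonneg operator_bound_nonneg[OF bound])
    then show ?thesis unfolding \<epsilon>_def by simp
  qed
  ultimately show ?thesis using residual_small[OF assms(1-3)] by (simp add: \<epsilon>_def)
qed

end

end

subsection \<open>Continuity of real analytic functions\<close>

text \<open>Unordered convergence at one corner point gives absolute summability there. Scaling
  towards the centre gains a factor on every nonconstant term, so f is Lipschitz at the
  centre.\<close>

lemma real_analytic_isCont:
  fixes f :: "real^'p \<Rightarrow> real"
  assumes "real_analytic f"
  shows "isCont f x"
proof -
  have "\<exists>e>0. \<exists>c. \<forall>y. dist y x < e \<longrightarrow>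
      ((\<lambda>\<alpha>. c \<alpha> * (\<Prod>i\<in>UNIV. (y $ i - x $ i) ^ \<alpha> i)) has_sum f y) UNIV"
    using assms unfolding real_analytic_def by (rule spec)
  then obtain e c where e: "e > 0" and c: "\<And>y. dist y x < e \<Longrightarrow>
      ((\<lambda>\<alpha>. c \<alpha> * (\<Prod>i\<in>UNIV. (y $ i - x $ i) ^ \<alpha> i)) has_sum f y) UNIV"
    by blast
  \<comment> \<open>The corner with all offsets \<open>R\<close> has l1 distance e / 2 from
    \<open>x\<close>, hence lies in the ball of convergence.\<close>
  define R where "R = e / (2 * real CARD('p))"
  have R: "R > 0" "real CARD('p) * R < e" using e by (simp_all add: R_def field_simps)
  define b where "b \<alpha> = \<bar>c \<alpha>\<bar> * (\<Prod>i\<in>UNIV. R ^ \<alpha> i)" for \<alpha> :: "'p \<Rightarrow> nat"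
  have "dist (x + (\<chi> i. R)) x < e"
    using norm_le_l1_cart[of "\<chi> i. R :: real^'p"] R by (simp add: dist_norm)
  from has_sum_imp_summable[OF c[OF this]]
  have "(\<lambda>\<alpha>. c \<alpha> * (\<Prod>i\<in>UNIV. R ^ \<alpha> i)) summable_on UNIV" by simp
  from summable_on_iff_abs_summable_on_real[THEN iffD1, OF this]
  have "(\<lambda>\<alpha>. norm (c \<alpha> * (\<Prod>i\<in>UNIV. R ^ \<alpha> i))) summable_on UNIV" .
  then have "b summable_on UNIV"
    using R(1) by (simp add: b_def[abs_def] abs_mult abs_prod power_abs)
  then obtain S where S: "(b has_sum S) UNIV" by (auto simp: summable_on_def)
  have bound: "\<bar>f y - f x\<bar> \<le> S / R * norm (y - x)" if y: "norm (y - x) < min e R" for y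
  proof -
    define s where "s = norm (y - x) / R"
    have s: "0 \<le> s" "s \<le> 1" "norm (y - x) = s * R" using y R(1) by (auto simp: s_def)
    \<comment> \<open>Subtracting the expansion at \<open>x\<close> itself, where 0^0 = 1, removes
      exactly the constant term.\<close>
    let ?g = "\<lambda>\<alpha>. c \<alpha> * (\<Prod>i\<in>UNIV. (y $ i - x $ i) ^ \<alpha> i) - c \<alpha> * (\<Prod>i\<in>UNIV. (x $ i - x $ i) ^ \<alpha> i)"
    have g: "(?g has_sum (f y - f x)) UNIV"
    proof -
      have "dist y x < e" "dist x x < e" using y e by (simp_all add: dist_norm)
      from has_sum_add[OF c[OF this(1)] has_sum_uminusI[OF c[OF this(2)]]] show ?thesis by simp
    qed
    have le: "\<bar>?g \<alpha>\<bar> \<le> s * b \<alpha>" for \<alpha>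
    proof (cases "\<forall>i. \<alpha> i = 0")
      case True
      then show ?thesis using s(1) by (simp add: b_def)
    next
      case False
      then obtain k where k: "\<alpha> k \<noteq> 0" by blast
      have zero: "(\<Prod>i\<in>UNIV. (x $ i - x $ i) ^ \<alpha> i) = 0" using k by (intro prod_zero) auto
      have "\<bar>?g \<alpha>\<bar> = \<bar>c \<alpha>\<bar> * (\<Prod>i\<in>UNIV. \<bar>y $ i - x $ i\<bar> ^ \<alpha> i)"
        by (simp only: zero mult_zero_right diff_0_right abs_mult abs_prod power_abs)
      also have "\<dots> \<le> \<bar>c \<alpha>\<bar> * (\<Prod>i\<in>UNIV. (s * R) ^ \<alpha> i)"
        using component_le_norm_cart[of "y - x"] s(3)
        by (intro mult_left_mono prod_mono conjI power_mono) auto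
      also have "(\<Prod>i\<in>UNIV. (s * R) ^ \<alpha> i) = (\<Prod>i\<in>UNIV. s ^ \<alpha> i) * (\<Prod>i\<in>UNIV. R ^ \<alpha> i)"
        by (simp add: power_mult_distrib prod.distrib)
      also have "\<bar>c \<alpha>\<bar> * \<dots> \<le> \<bar>c \<alpha>\<bar> * (s * (\<Prod>i\<in>UNIV. R ^ \<alpha> i))"
      proof (intro mult_left_mono mult_right_mono prod_nonneg)
        \<comment> \<open>One factor \<open>s\<close> is kept from a variable that occurs; the
          others are at most 1.\<close>
        have "(\<Prod>i\<in>UNIV. s ^ \<alpha> i) = s ^ \<alpha> k * (\<Prod>i\<in>UNIV - {k}. s ^ \<alpha> i)"
          by (simp add: prod.remove)
        also have "\<dots> \<le> s ^ 1 * 1"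
          using s k by (intro mult_mono power_decreasing prod_le_1 prod_nonneg) (auto simp: power_le_one)
        finally show "(\<Prod>i\<in>UNIV. s ^ \<alpha> i) \<le> s" by simp
      qed (use R in auto)
      finally show ?thesis by (simp add: b_def mult_ac)
    qed
    have sS: "((\<lambda>\<alpha>. s * b \<alpha>) has_sum s * S) UNIV" by (rule has_sum_cmult_right[OF S])
    have "f y - f x \<le> s * S" using has_sum_mono[OF g sS] le abs_le_D1 by blast
    moreover have "((\<lambda>\<alpha>. - ?g \<alpha>) has_sum - (f y - f x)) UNIV"
      unfolding has_sum_uminus minus_minus by (rule g)
    from has_sum_mono[OF this sS] le have "- (f y - f x) \<le> s * S" using abs_le_D2 by blast
    ultimately show ?thesis by (simp add: s_def abs_le_iff mult.commute)
  qed
  have "((\<lambda>y. f y - f x) \<longlongrightarrow> 0) (at x)"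
  proof (rule Lim_null_comparison)
    show "\<forall>\<^sub>F y in at x. norm (f y - f x) \<le> S / R * norm (y - x)"
      unfolding eventually_at using e R bound by (intro exI[of _ "min e R"]) (auto simp: dist_norm)
    have "((\<lambda>y. S / R * norm (y - x)) \<longlongrightarrow> S / R * norm (x - x)) (at x)" by (intro tendsto_intros)
    then show "((\<lambda>y. S / R * norm (y - x)) \<longlongrightarrow> 0) (at x)" by simp
  qed
  then show ?thesis unfolding isCont_def by (rule LIM_zero_cancel)
qed

lemma real_analytic_vec_continuous_on:
  assumes "\<And>m. real_analytic (\<lambda>\<mu>. \<theta> \<mu> $ m)"
  shows "continuous_on D \<theta>"
proof -
  have "continuous_on D (\<lambda>\<mu>. \<chi> m. \<theta> \<mu> $ m)"
    by (intro continuous_on_vec_lambda continuous_at_imp_continuous_on ballI real_analytic_isCont assms)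
  then show ?thesis by simp
qed

section \<open>Convergence of the greedy procedure\<close>

lemma subset_from_Suc:
  fixes P :: "nat \<Rightarrow> 'a set"
  assumes "\<And>j. j \<ge> 1 \<Longrightarrow> P j \<subseteq> P (Suc j)" "1 \<le> a" "a \<le> b"
  shows "P a \<subseteq> P b"
  using assms(3)
proof (induction b rule: dec_induct)
  case (step n)
  then show ?case using assms(1)[of n] assms(2) by auto
qed simp

theorem theorem4:
  fixes D :: "(real^'p) set"
    and A :: "'k::finite \<Rightarrow> ell2 \<Rightarrow> ell2"
    and \<theta> :: "real^'p \<Rightarrow> real^'k"
    and l r :: nat
    and \<zeta> :: real
  assumes "compact D"
    and "\<And>m. compact_selfadjoint (A m)"
    and "\<And>m. real_analytic (\<lambda>\<mu>. \<theta> \<mu> $ m)"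
    and "\<And>\<mu>. \<mu> \<in> D \<Longrightarrow> \<exists>t<0. \<exists>x. x \<noteq> 0 \<and> par_op A \<theta> \<mu> x = t *\<^sub>R x"
    and "1 \<le> r" and "r \<le> l"
    and "\<And>\<mu> k. \<mu> \<in> D \<Longrightarrow> k \<in> {1..r+1} \<Longrightarrow> \<exists>t. is_kth_eig (par_op A \<theta> \<mu>) k t"
    and "(INF \<mu>\<in>D. eig A \<theta> (r + 1) \<mu>) - (SUP \<mu>\<in>D. eig A \<theta> r \<mu>) > 0"
    and "\<zeta> > 0"
  shows "\<exists>h\<^sub>0>0. \<forall>G \<mu>s P v V w y \<Theta>.
           uniform_grid D h\<^sub>0 G \<and>
           greedy_run A \<theta> l r P v V w D G \<mu>s y \<Theta> \<and>
           (\<forall>j\<ge>1. \<forall>\<mu>\<in>D. gap_H A \<theta> l r P v V w (Suc j) \<mu> \<le> gap_H A \<theta> l r P v V w j \<mu>) \<and>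
           (\<forall>j\<ge>1. \<forall>\<mu>\<in>D. sigma_min (\<Theta> j \<mu>) > \<zeta>)
         \<longrightarrow> (\<lambda>j. SUP \<mu>\<in>D. err_E A \<theta> l P v V j \<mu>) \<longlonglongrightarrow> 0 \<and>
             (\<lambda>j. err_E A \<theta> l P v V j (\<mu>s (Suc j))) \<longlonglongrightarrow> 0 \<and>
             (\<lambda>j. gap_H A \<theta> l r P v V w j (\<mu>s (Suc j))) \<longlonglongrightarrow> 0"
proof -
  note csa = assms(2)
  have "\<forall>m. \<exists>k. \<forall>z. norm (A m z) \<le> k * norm z" using csa_bounded[OF csa] by metis
  then obtain \<kappa> where \<kappa>: "\<And>m z. norm (A m z) \<le> \<kappa> m * norm z" by metis
  have cont: "continuous_on D \<theta>" by (rule real_analytic_vec_continuous_on[OF assms(3)])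
  have "bounded (\<theta> ` D)" by (intro compact_imp_bounded compact_continuous_image cont assms(1))
  then obtain B where B: "\<And>\<mu>. \<mu> \<in> D \<Longrightarrow> norm (\<theta> \<mu>) \<le> B" "B > 0"
    unfolding bounded_pos by blast
  have \<kappa>0: "0 \<le> sum \<kappa> UNIV" by (intro sum_nonneg operator_bound_nonneg[OF \<kappa>])
  \<comment> \<open>The infimum and supremum in the gap condition carry information only for bounded
    families.\<close>
  have eig_bound: "\<bar>eig A \<theta> k \<mu>\<bar> \<le> B * sum \<kappa> UNIV" if "\<mu> \<in> D" "k \<in> {1..r+1}" for \<mu> k
    using abs_eig_le[of A \<kappa>, OF csa \<kappa> assms(7)[OF that]] mult_right_mono[OF B(1)[OF that(1)] \<kappa>0]
    by linarith
  define \<delta> where "\<delta> = (INF \<mu>\<in>D. eig A \<theta> (r + 1) \<mu>) - (SUP \<mu>\<in>D. eig A \<theta> r \<mu>)"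
  have \<delta>: "\<delta> > 0" using assms(8) by (simp add: \<delta>_def)
  have gap: "\<delta> \<le> eig A \<theta> (r + 1) \<nu> - eig A \<theta> r \<nu>" if \<nu>: "\<nu> \<in> D" for \<nu>
  proof -
    have "bdd_below ((\<lambda>\<mu>. eig A \<theta> (r + 1) \<mu>) ` D)"
      using eig_bound[of _ "r + 1"] by (intro bdd_belowI2[of _ "- (B * sum \<kappa> UNIV)"]) (fastforce simp: abs_le_iff)
    from cINF_lower[OF this \<nu>] have "(INF \<mu>\<in>D. eig A \<theta> (r + 1) \<mu>) \<le> eig A \<theta> (r + 1) \<nu>" .
    moreover have "bdd_above ((\<lambda>\<mu>. eig A \<theta> r \<mu>) ` D)"
      using eig_bound[of _ r] assms(5) by (intro bdd_aboveI2[of _ _ "B * sum \<kappa> UNIV"]) (fastforce simp: abs_le_iff)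
    from cSUP_upper[OF \<nu> this] have "eig A \<theta> r \<nu> \<le> (SUP \<mu>\<in>D. eig A \<theta> r \<mu>)" .
    ultimately show ?thesis by (simp add: \<delta>_def)
  qed
  \<comment> \<open>The bound of \<open>gap_small\<close> with the norm of
    \<open>\<theta> \<nu>\<close> replaced by its maximal size \<open>B\<close>, so that it depends
    on the distance alone.\<close>
  define \<phi> where "\<phi> s = 3 * (s * sum \<kappa> UNIV)
    + 2 * real r * (B * sum \<kappa> UNIV) * sqrt (2 * real r * (s * sum \<kappa> UNIV) / \<delta>)" for s
  have \<phi>_small: "\<exists>\<eta>>0. \<forall>s. 0 \<le> s \<and> s < \<eta> \<longrightarrow> \<phi> s < \<epsilon>" if "\<epsilon> > 0" for \<epsilon>
  proof -
    have "isCont \<phi> 0" unfolding \<phi>_def using \<delta> by (intro continuous_intros) auto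
    then have "\<exists>\<eta>>0. \<forall>s. dist s 0 < \<eta> \<longrightarrow> dist (\<phi> s) (\<phi> 0) < \<epsilon>"
      using that unfolding continuous_at_eps_delta by blast
    moreover have "\<phi> 0 = 0" by (simp add: \<phi>_def)
    ultimately show ?thesis by (auto simp: dist_real_def abs_less_iff)
  qed
  have main: "(\<lambda>j. SUP \<mu>\<in>D. err_E A \<theta> l P v V j \<mu>) \<longlonglongrightarrow> 0 \<and>
             (\<lambda>j. err_E A \<theta> l P v V j (\<mu>s (Suc j))) \<longlonglongrightarrow> 0 \<and>
             (\<lambda>j. gap_H A \<theta> l r P v V w j (\<mu>s (Suc j))) \<longlonglongrightarrow> 0"
    if run: "greedy_run A \<theta> l r P v V w D G \<mu>s y \<Theta>" and GD: "G \<subseteq> D"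
      and mono: "\<And>j \<mu>. j \<ge> 1 \<Longrightarrow> \<mu> \<in> D \<Longrightarrow>
        gap_H A \<theta> l r P v V w (Suc j) \<mu> \<le> gap_H A \<theta> l r P v V w j \<mu>"
    for G \<mu>s P v V w y \<Theta>
  proof -
    let ?H = "gap_H A \<theta> l r P v V w" and ?E = "err_E A \<theta> l P v V"
    have P1: "P 1 = G" using run unfolding greedy_run_def by (rule conjunct1)
    have run_step: "(\<forall>\<nu>\<in>P j. snapshots_at A \<theta> l v \<nu>) \<and>
        isometry_onto (ell2C.dim (proj_space l P v j)) (V j) (proj_space l P v j) \<and>
        (\<forall>\<mu>\<in>D. ritz_vectors_at A \<theta> l r P v V w j \<mu> \<and>
          lp_choice A \<theta> l r P v V w j \<mu> (y j \<mu>) (\<Theta> j \<mu>)) \<and>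
        is_arg_max (?H j) (\<lambda>\<mu>. \<mu> \<in> D) (\<mu>s (Suc j)) \<and> P (Suc j) = insert (\<mu>s (Suc j)) (P j)"
      if "j \<ge> 1" for j
      using run that unfolding greedy_run_def by blast
    have step: "P (Suc j) = insert (\<mu>s (Suc j)) (P j)" "is_arg_max (?H j) (\<lambda>\<mu>. \<mu> \<in> D) (\<mu>s (Suc j))"
      if "j \<ge> 1" for j using run_step[OF that] by blast+
    have \<mu>sD: "\<mu>s (Suc j) \<in> D" if "j \<ge> 1" for j using step(2)[OF that] by (simp add: is_arg_max_def)
    have max: "?H j \<mu> \<le> ?H j (\<mu>s (Suc j))" if "j \<ge> 1" "\<mu> \<in> D" for j \<mu>
      using step(2)[OF that(1)] that(2) by (auto simp: is_arg_max_def not_less)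
    have PD: "P j \<subseteq> D" if "j \<ge> 1" for j using that
    proof (induction j rule: dec_induct)
      case base
      show ?case unfolding P1 by (rule GD)
    next
      case (step j)
      then show ?case using run_step[of j] \<mu>sD[of j] by auto
    qed
    have P_mono: "P a \<subseteq> P b" if "1 \<le> a" "a \<le> b" for a b
      by (rule subset_from_Suc[OF _ that]) (use step(1) in blast)
    have setting: "ritz_setup A \<theta> l r P v V w j \<mu> \<kappa>" if "j \<ge> 1" "\<mu> \<in> D" for j \<mu>
      using run_step[OF that(1)] that(2) by (intro ritz_setup.intro csa \<kappa> assms(5,6)) blast+
    have argmin: "is_arg_min (inner (\<theta> \<mu>)) (\<lambda>z. z \<in> Y_LB A \<theta> l r P v V w j \<mu>) (y j \<mu>)"
      if "j \<ge> 1" "\<mu> \<in> D" for j \<mu>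
      using run_step[OF that(1)] that(2) unfolding lp_choice_def by blast
    have kth1: "\<exists>s. is_kth_eig (par_op A \<theta> \<mu>) 1 s" if "\<mu> \<in> D" for \<mu>
      by (rule assms(7)[OF that]) simp
    have E: "0 \<le> ?E j \<mu>" "?E j \<mu> \<le> ?H j \<mu>" if "j \<ge> 1" "\<mu> \<in> D" for j \<mu>
      using ritz_setup.err_nonneg[OF setting[OF that] kth1[OF that(2)]]
        ritz_setup.err_le_gap[OF setting[OF that] argmin[OF that] kth1[OF that(2)]] by auto
    define h where "h j = ?H j (\<mu>s (Suc j))" for j
    have h0: "0 \<le> h j" if "j \<ge> 1" for j
      unfolding h_def by (rule ritz_setup.gap_nonneg[OF setting[OF that \<mu>sD[OF that]] argmin[OF that \<mu>sD[OF that]]])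
    \<comment> \<open>At the new maximizer the old gap is already at least as large, and the old
      maximum dominates it.\<close>
    have h_Suc: "h (Suc j) \<le> h j" if "j \<ge> 1" for j
      unfolding h_def using mono[OF that \<mu>sD[of "Suc j"]] max[OF that \<mu>sD[of "Suc j"]] by simp
    have h_mono: "h b \<le> h a" if "1 \<le> a" "a \<le> b" for a b
      using that(2)
    proof (induction b rule: dec_induct)
      case (step b)
      then show ?case using h_Suc[of b] that(1) by simp
    qed simp
    have h_close: "h j \<le> \<phi> (norm (\<theta> (\<mu>s (Suc j)) - \<theta> \<nu>))" if j: "j \<ge> 1" and \<nu>: "\<nu> \<in> P j" for j \<nu>
    proof -
      have \<nu>D: "\<nu> \<in> D" using PD[OF j] \<nu> by blast
      let ?s = "norm (\<theta> (\<mu>s (Suc j)) - \<theta> \<nu>) * sum \<kappa> UNIV"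
      have "h j \<le> 3 * ?s + 2 * real r * (norm (\<theta> \<nu>) * sum \<kappa> UNIV) * sqrt (2 * real r * ?s / \<delta>)"
        unfolding h_def
        by (rule ritz_setup.gap_small[OF setting[OF j \<mu>sD[OF j]] argmin[OF j \<mu>sD[OF j]] \<nu> \<delta> gap[OF \<nu>D]])
      also have "\<dots> \<le> \<phi> (norm (\<theta> (\<mu>s (Suc j)) - \<theta> \<nu>))"
        unfolding \<phi>_def using \<kappa>0 \<delta> B(1)[OF \<nu>D]
        by (intro add_left_mono mult_right_mono mult_left_mono) auto
      finally show ?thesis .
    qed
    have "\<exists>j\<ge>1. h j < \<epsilon>" if \<epsilon>: "\<epsilon> > 0" for \<epsilon>
    proof -
      obtain \<eta> where \<eta>: "\<eta> > 0" "\<And>s. 0 \<le> s \<Longrightarrow> s < \<eta> \<Longrightarrow> \<phi> s < \<epsilon>" using \<phi>_small[OF \<epsilon>] by blast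
      \<comment> \<open>The greedy points start with \<open>\<mu>s 2\<close>.\<close>
      define X where "X n = \<mu>s (Suc (Suc n))" for n
      have XD: "X n \<in> D" for n using \<mu>sD[of "Suc n"] by (simp add: X_def)
      obtain L \<sigma> where \<sigma>: "L \<in> D" "strict_mono \<sigma>" "(X \<circ> \<sigma>) \<longlonglongrightarrow> L"
        using assms(1) XD unfolding compact_def by metis
      have "(\<lambda>n. \<theta> ((X \<circ> \<sigma>) n)) \<longlonglongrightarrow> \<theta> L"
        using continuous_on_tendsto_compose[OF cont \<sigma>(3) \<sigma>(1)] XD by simp
      then have "Cauchy (\<lambda>n. \<theta> ((X \<circ> \<sigma>) n))" by (rule LIMSEQ_imp_Cauchy)
      then obtain N where N: "\<And>m n. m \<ge> N \<Longrightarrow> n \<ge> N \<Longrightarrow> dist (\<theta> ((X \<circ> \<sigma>) m)) (\<theta> ((X \<circ> \<sigma>) n)) < \<eta>"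
        using \<eta>(1) unfolding Cauchy_def by blast
      \<comment> \<open>At this step the next greedy point is \<open>X (\<sigma> (Suc N))\<close>,
        while the nearby point \<open>X (\<sigma> N)\<close> has already been added.\<close>
      let ?j = "Suc (\<sigma> (Suc N))"
      have "\<sigma> N < \<sigma> (Suc N)" using \<sigma>(2) by (simp add: strict_mono_Suc_iff)
      then have "P (Suc (Suc (\<sigma> N))) \<subseteq> P ?j" by (intro P_mono) auto
      moreover have "X (\<sigma> N) \<in> P (Suc (Suc (\<sigma> N)))" using step(1)[of "Suc (\<sigma> N)"] by (simp add: X_def)
      ultimately have "h ?j \<le> \<phi> (norm (\<theta> (\<mu>s (Suc ?j)) - \<theta> (X (\<sigma> N))))" by (intro h_close) auto
      also have "\<dots> < \<epsilon>" using N[of "Suc N" N] by (intro \<eta>(2)) (simp_all add: X_def dist_norm)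
      finally show ?thesis by (intro exI[of _ ?j]) simp
    qed
    then have h_lim: "h \<longlonglongrightarrow> 0"
    proof (intro LIMSEQ_I)
      fix \<epsilon> :: real assume "\<epsilon> > 0"
      with \<open>\<And>\<epsilon>. \<epsilon> > 0 \<Longrightarrow> \<exists>j\<ge>1. h j < \<epsilon>\<close> obtain j where j: "j \<ge> 1" "h j < \<epsilon>" by blast
      have "norm (h n - 0) < \<epsilon>" if "n \<ge> j" for n
        using h_mono[OF j(1) that] h0[of n] j that by simp
      then show "\<exists>N. \<forall>n\<ge>N. norm (h n - 0) < \<epsilon>" by blast
    qed
    \<comment> \<open>The bounds hold from step 1 on, whereas the sequences also have a term at
      0.\<close>
    have ev: "\<forall>\<^sub>F j in sequentially. R j" if "\<And>j. j \<ge> 1 \<Longrightarrow> R j" for R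
      using that unfolding eventually_sequentially by blast
    have "(\<lambda>j. ?E j (\<mu>s (Suc j))) \<longlonglongrightarrow> 0"
      by (rule tendsto_sandwich[OF ev ev tendsto_const h_lim]) (use E \<mu>sD in \<open>auto simp: h_def\<close>)
    moreover have "(\<lambda>j. SUP \<mu>\<in>D. ?E j \<mu>) \<longlonglongrightarrow> 0"
    proof (rule tendsto_sandwich[OF ev ev tendsto_const h_lim])
      fix j :: nat assume j: "j \<ge> 1"
      have le: "?E j \<mu> \<le> h j" if "\<mu> \<in> D" for \<mu> using E(2)[OF j that] max[OF j that] by (simp add: h_def)
      show "(SUP \<mu>\<in>D. ?E j \<mu>) \<le> h j" using \<mu>sD[OF j] le by (intro cSUP_least) auto
      have "0 \<le> ?E j (\<mu>s (Suc j))" by (rule E(1)[OF j \<mu>sD[OF j]])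
      also have "\<dots> \<le> (SUP \<mu>\<in>D. ?E j \<mu>)"
        by (rule cSUP_upper[OF \<mu>sD[OF j] bdd_aboveI2[OF le]])
      finally show "0 \<le> (SUP \<mu>\<in>D. ?E j \<mu>)" .
    qed
    moreover have "(\<lambda>j. ?H j (\<mu>s (Suc j))) \<longlonglongrightarrow> 0" using h_lim by (simp add: h_def[abs_def])
    ultimately show ?thesis by blast
  qed
  show ?thesis
  \<comment> \<open>\<open>main\<close> covers every initial set contained in \<open>D\<close>, so 1
    serves as the threshold.\<close>
  proof (rule exI[where x = "1::real"], rule conjI, simp, intro allI impI, elim conjE)
    fix G \<mu>s P v V w y \<Theta>
    assume "uniform_grid D 1 G" "greedy_run A \<theta> l r P v V w D G \<mu>s y \<Theta>"
      and "\<forall>j\<ge>1. \<forall>\<mu>\<in>D. gap_H A \<theta> l r P v V w (Suc j) \<mu> \<le> gap_H A \<theta> l r P v V w j \<mu>"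
    then show "(\<lambda>j. SUP \<mu>\<in>D. err_E A \<theta> l P v V j \<mu>) \<longlonglongrightarrow> 0 \<and>
             (\<lambda>j. err_E A \<theta> l P v V j (\<mu>s (Suc j))) \<longlonglongrightarrow> 0 \<and>
             (\<lambda>j. gap_H A \<theta> l r P v V w j (\<mu>s (Suc j))) \<longlonglongrightarrow> 0"
      by (intro main[of P v V w G \<mu>s y \<Theta>]) (auto simp: uniform_grid_def)
  qed
qed

end
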